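(* Let $G=\langle s_1,\dots,s_r\rangle$ be a free group or free semigroup (with identity) of rank $r$, and let $(T,K^G,\mu,\alpha)$ be the process induced by an invariant transition system $\mathbf P=(\{P^s\}_{s\in S},\pi)$ with finite or countably infinite state space $K$ and $-\sum_{i\in K}\pi_i\log\pi_i<\infty$. Then $$f(T)=(2r-1)\sum_{i\in K}\pi_i\log(\pi_i)-\sum_{s\in S_+}\sum_{i,j\in K}\pi_iP^s_{ij}\log(\pi_iP^s_{ij}),$$ where $S_+=\{s_1,\dots,s_r\}$ (and $0\log 0=0$).
   Context: $G=\langle s_1,\dots,s_r\rangle$ is either a free group or a free semigroup with identity $e$ on $s_1,\dots,s_r$. Put $S=\{s_1^{\pm1},\dots,s_r^{\pm1}\}$ in the group case and $S=\{s_1,\dots,s_r\}$ in the semigroup case; $|\cdot|$ is word length with respect to $S$ and $B(e,n)$ is the ball of radius $n$ about $e$. The left-Cayley graph $\Gamma_L$ has vertex set $G$ and an edge from $g$ to $sg$ for every $g\in G$, $s\in S$; paths ignore edge directions. $\mathrm{Past}(g_1;g_2)$ is the set of $f\in G$ such that every path in $\Gamma_L$ from $f$ to $g_1$ passes through $g_2$. Transition systems. A stochastic matrix with state space $K$ is a $K\times K$ matrix with entries in $[0,1]$ and all row sums $1$. A transition system is a collection of stochastic matrices $\{P^s\}_{s\in S}$ and a probability vector $\pi$ on $K$. It is invariant if $\pi P^s=\pi$ for all $s\in S$ and, when $G$ is a group, $\pi_iP^{s^{-1}}_{ij}=\pi_jP^s_{ji}$ for all $s\in S$, $i,j\in K$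 (here $P^{s^{-1}}$ is the matrix indexed by $s^{-1}\in S$, not an inverse matrix). $K^G$ (product topology, $K$ discrete) is the set of functions $x:G\to K$, with canonical action $T_gx(f)=x(fg)$ and canonical partition $\alpha=\{A_k:k\in K\}$, $A_k=\{x:x(e)=k\}$. The process induced by $\mathbf P$ is $(T,K^G,\mu,\alpha)$, where $\mu$ is the Borel probability measure on $K^G$ determined by: $\mu(A_k)=\pi_k$; and whenever $|sg|=|g|+1$ ($g\in G$, $s\in S$), $f_1,\dots,f_n\in\mathrm{Past}(sg;g)\setminus\{g\}$ and $k,k_0,\dots,k_n\in K$, $$\mu\Big(T_{sg}^{-1}A_k\,\Big|\,T_g^{-1}A_{k_0}\cap\bigcap_{i=1}^nT_{f_i}^{-1}A_{k_i}\Big)=P^s_{k_0,k}$$ if the conditioning event has positive measure. The measure $\mu$ is $T$-invariant when $\mathbf P$ is invariant. $f$-invariant. For a partition $\alpha$, $H(\alpha)=-\sum_{A\in\alpha}\mu(A)\log\mu(A)$, $\alpha^n=\bigvee_{g\in B(e,n)}T_g^{-1}\alpha$, $$F(T,\alpha)=(1-2r)H(\alpha)+\sum_{i=1}^rH(\alpha\vee T_{s_i}^{-1}\alpha),\qquad f(T,\alpha)=\inf_{n>0}F(T,\alpha^n),$$ and $f(T)$ is the common value of $f(T,\alpha)$ over all generating partitions $\alpha$ with $H(\alpha)<\infty$ (generating: the smallest $\sigma$-algebra containing $\alpha$ and closed under all $T_g^{-1}$ is everything up to measure zero). The canonical partition is generating. *)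

theory Defs
  imports "HOL-Probability.Probability" "HOL-Algebra.Algebra"
begin

section \<open>Free groups and free semigroups with identity\<close>

definition list_mult :: "('g, 'm) monoid_scheme \<Rightarrow> 'g list \<Rightarrow> 'g" where
  "list_mult G ws = foldr (\<otimes>\<^bsub>G\<^esub>) ws \<one>\<^bsub>G\<^esub>"

text \<open>A letter \<open>(i, True)\<close> stands for the generator \<open>s i\<close>, and \<open>(i, False)\<close> for its inverse.\<close>

fun letter_value :: "('g, 'm) monoid_scheme \<Rightarrow> (nat \<Rightarrow> 'g) \<Rightarrow> nat \<times> bool \<Rightarrow> 'g" where
  "letter_value G s (i, b) = (if b then s i else inv\<^bsub>G\<^esub> (s i))"

definition reduced_words :: "nat \<Rightarrow> (nat \<times> bool) list set" where
  "reduced_words r =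
     {w \<in> lists ({1..r} \<times> UNIV). successively (\<lambda>a b. \<not> (fst a = fst b \<and> snd a \<noteq> snd b)) w}"

definition free_group_on :: "('g, 'm) monoid_scheme \<Rightarrow> (nat \<Rightarrow> 'g) \<Rightarrow> nat \<Rightarrow> bool" where
  "free_group_on G s r \<longleftrightarrow>
     group G \<and> s \<in> {1..r} \<rightarrow> carrier G \<and>
     bij_betw (\<lambda>w. list_mult G (map (letter_value G s) w)) (reduced_words r) (carrier G)"

definition free_semigroup_on :: "('g, 'm) monoid_scheme \<Rightarrow> (nat \<Rightarrow> 'g) \<Rightarrow> nat \<Rightarrow> bool" where
  "free_semigroup_on G s r \<longleftrightarrow>
     monoid G \<and> s \<in> {1..r} \<rightarrow> carrier G \<and>
     bij_betw (\<lambda>w. list_mult G (map s w)) (lists {1..r}) (carrier G)"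

text \<open>For \<open>r \<ge> 1\<close> a free semigroup with identity is never a group, so the case distinction
  below separates the free group from the free semigroup.\<close>

definition gen_set :: "('g, 'm) monoid_scheme \<Rightarrow> (nat \<Rightarrow> 'g) \<Rightarrow> nat \<Rightarrow> 'g set" where
  "gen_set G s r =
     (if group G then s ` {1..r} \<union> (\<lambda>i. inv\<^bsub>G\<^esub> (s i)) ` {1..r} else s ` {1..r})"

definition word_length :: "('g, 'm) monoid_scheme \<Rightarrow> 'g set \<Rightarrow> 'g \<Rightarrow> nat" where
  "word_length G S g = (LEAST n. \<exists>ws \<in> lists S. length ws = n \<and> list_mult G ws = g)"

definition word_ball :: "('g, 'm) monoid_scheme \<Rightarrow> 'g set \<Rightarrow> nat \<Rightarrow> 'g set" where
  "word_ball G S n = {g \<in> carrier G. word_length G S g \<le> n}"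


section \<open>The left-Cayley graph and pasts\<close>

definition cayley_adj :: "('g, 'm) monoid_scheme \<Rightarrow> 'g set \<Rightarrow> 'g \<Rightarrow> 'g \<Rightarrow> bool" where
  "cayley_adj G S g h \<longleftrightarrow> (\<exists>t\<in>S. h = t \<otimes>\<^bsub>G\<^esub> g \<or> g = t \<otimes>\<^bsub>G\<^esub> h)"

definition cayley_path :: "('g, 'm) monoid_scheme \<Rightarrow> 'g set \<Rightarrow> 'g \<Rightarrow> 'g \<Rightarrow> 'g list \<Rightarrow> bool" where
  "cayley_path G S g h p \<longleftrightarrow>
     p \<noteq> [] \<and> set p \<subseteq> carrier G \<and> hd p = g \<and> last p = h \<and> successively (cayley_adj G S) p"

definition past :: "('g, 'm) monoid_scheme \<Rightarrow> 'g set \<Rightarrow> 'g \<Rightarrow> 'g \<Rightarrow> 'g set" where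
  "past G S g1 g2 = {f \<in> carrier G. \<forall>p. cayley_path G S f g1 p \<longrightarrow> g2 \<in> set p}"


section \<open>Transition systems\<close>

definition stochastic_matrix :: "'k set \<Rightarrow> ('k \<Rightarrow> 'k \<Rightarrow> real) \<Rightarrow> bool" where
  "stochastic_matrix K Q \<longleftrightarrow>
     (\<forall>i\<in>K. (\<forall>j\<in>K. 0 \<le> Q i j \<and> Q i j \<le> 1) \<and> ((\<lambda>j. Q i j) has_sum 1) K)"

definition probability_vector :: "'k set \<Rightarrow> ('k \<Rightarrow> real) \<Rightarrow> bool" where
  "probability_vector K p \<longleftrightarrow> (\<forall>i\<in>K. 0 \<le> p i) \<and> (p has_sum 1) K"

definition transition_system ::
    "'g set \<Rightarrow> 'k set \<Rightarrow> ('g \<Rightarrow> 'k \<Rightarrow> 'k \<Rightarrow> real) \<Rightarrow> ('k \<Rightarrow> real) \<Rightarrow> bool" where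
  "transition_system S K P p \<longleftrightarrow> (\<forall>t\<in>S. stochastic_matrix K (P t)) \<and> probability_vector K p"

definition invariant_system ::
    "('g, 'm) monoid_scheme \<Rightarrow> 'g set \<Rightarrow> 'k set \<Rightarrow> ('g \<Rightarrow> 'k \<Rightarrow> 'k \<Rightarrow> real) \<Rightarrow> ('k \<Rightarrow> real) \<Rightarrow> bool" where
  "invariant_system G S K P p \<longleftrightarrow>
     (\<forall>t\<in>S. \<forall>j\<in>K. ((\<lambda>i. p i * P t i j) has_sum p j) K) \<and>
     (group G \<longrightarrow> (\<forall>t\<in>S. \<forall>i\<in>K. \<forall>j\<in>K. p i * P (inv\<^bsub>G\<^esub> t) i j = p j * P t j i))"


section \<open>The process induced by a transition system\<close>

definition config_topology :: "('g, 'm) monoid_scheme \<Rightarrow> 'k set \<Rightarrow> ('g \<Rightarrow> 'k) topology" where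
  "config_topology G K = product_topology (\<lambda>_. discrete_topology K) (carrier G)"

definition shift_action :: "('g, 'm) monoid_scheme \<Rightarrow> 'g \<Rightarrow> ('g \<Rightarrow> 'k) \<Rightarrow> 'g \<Rightarrow> 'k" where
  "shift_action G g x = (\<lambda>f\<in>carrier G. x (f \<otimes>\<^bsub>G\<^esub> g))"

definition cylinder :: "('g, 'm) monoid_scheme \<Rightarrow> 'k set \<Rightarrow> 'k \<Rightarrow> ('g \<Rightarrow> 'k) set" where
  "cylinder G K k = {x \<in> carrier G \<rightarrow>\<^sub>E K. x \<one>\<^bsub>G\<^esub> = k}"

text \<open>The finite set \<open>F\<close> and the labelling \<open>c\<close> encode the points \<open>f\<^sub>1, \<dots>, f\<^sub>n\<close> and the states
  \<open>k\<^sub>1, \<dots>, k\<^sub>n\<close>.\<close>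

definition induced_measure ::
    "('g, 'm) monoid_scheme \<Rightarrow> 'g set \<Rightarrow> 'k set \<Rightarrow> ('g \<Rightarrow> 'k \<Rightarrow> 'k \<Rightarrow> real) \<Rightarrow> ('k \<Rightarrow> real) \<Rightarrow>
     ('g \<Rightarrow> 'k) measure \<Rightarrow> bool" where
  "induced_measure G S K P p \<mu> \<longleftrightarrow>
     prob_space \<mu> \<and>
     sets \<mu> = sigma_sets (carrier G \<rightarrow>\<^sub>E K) {U. openin (config_topology G K) U} \<and>
     (\<forall>k\<in>K. measure \<mu> (cylinder G K k) = p k) \<and>
     (\<forall>g\<in>carrier G. \<forall>t\<in>S. word_length G S (t \<otimes>\<^bsub>G\<^esub> g) = word_length G S g + 1 \<longrightarrow>
       (\<forall>F c k k0. finite F \<and> F \<subseteq> past G S (t \<otimes>\<^bsub>G\<^esub> g) g - {g} \<and> c \<in> F \<rightarrow> K \<and> k \<in> K \<and> k0 \<in> K \<longrightarrow>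
         \<P>(x in \<mu>. shift_action G g x \<in> cylinder G K k0 \<and> (\<forall>f\<in>F. shift_action G f x \<in> cylinder G K (c f))) > 0 \<longrightarrow>
         \<P>(x in \<mu>. shift_action G (t \<otimes>\<^bsub>G\<^esub> g) x \<in> cylinder G K k \<bar>
                   shift_action G g x \<in> cylinder G K k0 \<and> (\<forall>f\<in>F. shift_action G f x \<in> cylinder G K (c f)))
           = P t k0 k))"


section \<open>Entropy of partitions and the f-invariant\<close>

definition measurable_partition :: "'x measure \<Rightarrow> 'x set set \<Rightarrow> bool" where
  "measurable_partition M \<alpha> \<longleftrightarrow> partition_on (space M) \<alpha> \<and> countable \<alpha> \<and> \<alpha> \<subseteq> sets M"

text \<open>The terms are nonnegative when \<open>M\<close> is a probability space, so summing in \<^typ>\<open>ennreal\<close> gives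
  the extended-valued Shannon entropy; note \<open>ln 0 = 0\<close>.\<close>

definition partition_entropy :: "'x measure \<Rightarrow> 'x set set \<Rightarrow> ereal" where
  "partition_entropy M \<alpha> =
     enn2ereal (\<Sum>\<^sub>\<infinity>A\<in>\<alpha>. ennreal (- (measure M A * ln (measure M A))))"

definition pullback :: "'x measure \<Rightarrow> ('x \<Rightarrow> 'x) \<Rightarrow> 'x set set \<Rightarrow> 'x set set" where
  "pullback M h \<alpha> = (\<lambda>A. h -` A \<inter> space M) ` \<alpha> - {{}}"

definition ball_refinement ::
    "('g, 'm) monoid_scheme \<Rightarrow> 'g set \<Rightarrow> 'x measure \<Rightarrow> ('g \<Rightarrow> 'x \<Rightarrow> 'x) \<Rightarrow> 'x set set \<Rightarrow> nat \<Rightarrow> 'x set set" where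
  "ball_refinement G S M T \<alpha> n = common_refinement ((\<lambda>g. pullback M (T g) \<alpha>) ` word_ball G S n)"

definition F_functional ::
    "(nat \<Rightarrow> 'g) \<Rightarrow> nat \<Rightarrow> 'x measure \<Rightarrow> ('g \<Rightarrow> 'x \<Rightarrow> 'x) \<Rightarrow> 'x set set \<Rightarrow> ereal" where
  "F_functional s r M T \<alpha> =
     ereal (1 - 2 * real r) * partition_entropy M \<alpha> +
     (\<Sum>i=1..r. partition_entropy M (common_refinement {\<alpha>, pullback M (T (s i)) \<alpha>}))"

definition f_partition ::
    "('g, 'm) monoid_scheme \<Rightarrow> (nat \<Rightarrow> 'g) \<Rightarrow> nat \<Rightarrow> 'x measure \<Rightarrow> ('g \<Rightarrow> 'x \<Rightarrow> 'x) \<Rightarrow> 'x set set \<Rightarrow> ereal" where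
  "f_partition G s r M T \<alpha> =
     (INF n\<in>{0<..}. F_functional s r M T (ball_refinement G (gen_set G s r) M T \<alpha> n))"

definition generating ::
    "('g, 'm) monoid_scheme \<Rightarrow> 'x measure \<Rightarrow> ('g \<Rightarrow> 'x \<Rightarrow> 'x) \<Rightarrow> 'x set set \<Rightarrow> bool" where
  "generating G M T \<alpha> \<longleftrightarrow>
     (\<forall>A\<in>sets M.
        \<exists>B \<in> \<Inter>{\<A>. sigma_algebra (space M) \<A> \<and> \<alpha> \<subseteq> \<A> \<and>
                    (\<forall>g\<in>carrier G. \<forall>C\<in>\<A>. T g -` C \<inter> space M \<in> \<A>)}.
          emeasure M ((A - B) \<union> (B - A)) = 0)"

definition f_invariant ::
    "('g, 'm) monoid_scheme \<Rightarrow> (nat \<Rightarrow> 'g) \<Rightarrow> nat \<Rightarrow> 'x measure \<Rightarrow> ('g \<Rightarrow> 'x \<Rightarrow> 'x) \<Rightarrow> ereal" where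
  "f_invariant G s r M T =
     (THE v. (\<exists>\<alpha>. measurable_partition M \<alpha> \<and> generating G M T \<alpha> \<and> partition_entropy M \<alpha> < \<infinity>) \<and>
             (\<forall>\<alpha>. measurable_partition M \<alpha> \<and> generating G M T \<alpha> \<and> partition_entropy M \<alpha> < \<infinity> \<longrightarrow>
                  f_partition G s r M T \<alpha> = v))"

end

theory Submission
  imports Defs
begin

text \<open>
  A countable partition is treated as an observable: a map with countable range whose fibres are its
  cells. Only the equivalence relation of having the same value matters, so joins become pairs and
  refinements over balls become windows, without any bookkeeping of labels. For an observable \<open>\<xi>\<close>
  put \<open>F(\<xi>) = (1 - 2 r) H(\<xi>) + (\<Sum>i. H(\<xi>, \<xi> \<circ> T\<^sub>i))\<close>. The value of \<open>f\<close> follows from two facts.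

  First, \<open>f\<close> takes the same value on all generating partitions of finite entropy. Adjoining to
  \<open>\<gamma>\<close> a translate of a coarsening of \<open>\<gamma>\<close> by one letter never increases \<open>F\<close> (\<open>F_obs_split_le\<close>): if
  the entropy grows by \<open>h\<close>, each of the \<open>r\<close> pair entropies grows by at most \<open>2 h\<close>, and the one
  belonging to the generator used grows by at most \<open>h\<close>. Any finite prefix-closed window is built by such
  steps, even with a second observable carried along (\<open>F_obs_window_antimono\<close>). Write \<open>\<xi>\<^sup>n\<close> for the
  refinement of \<open>\<xi>\<close> over the ball of radius \<open>n\<close>. Joining with \<open>\<eta>\<close> changes \<open>F\<close> by at most a constant
  times a conditional entropy (\<open>F_obs_refine_le\<close>, \<open>F_obs_coarsen_le\<close>). Together these give
  \<open>F(\<alpha>\<^sup>n) \<le> F(\<alpha>\<^sup>n, \<beta>\<^sup>m) + (2 r - 1) H(\<beta>\<^sup>m | \<alpha>\<^sup>n) \<le> F(\<alpha>, \<beta>\<^sup>m) + (2 r - 1) H(\<beta>\<^sup>m | \<alpha>\<^sup>n)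
     \<le> F(\<beta>\<^sup>m) + H(\<alpha> | \<beta>\<^sup>m) + (2 r - 1) H(\<beta>\<^sup>m | \<alpha>\<^sup>n)\<close>.
  Since \<open>\<alpha>\<close> and \<open>\<beta>\<close> generate, letting first \<open>n\<close> and then \<open>m\<close> tend to infinity removes both
  conditional entropies (\<open>cond_entropy_to_0\<close>), so \<open>f(\<alpha>) \<le> f(\<beta>)\<close> (\<open>f_obs_le\<close>), and by symmetry
  equality holds.

  Secondly, for the canonical partition \<open>F\<close> does not change at all under refinement. Elements of the
  group or semigroup are written as reduced words. The defining conditional probabilities of the
  process say that adjoining to a finite set of words a word \<open>u # v\<close> that is not a suffix of any of
  them, with \<open>v\<close> already present, multiplies cylinder probabilities by the transition probability of
  the letter \<open>u\<close> (\<open>prob_cyl_insert\<close>); hence it raises the entropy by a number \<open>h\<close> that depends on \<open>u\<close>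
  alone. Removing a longest word \<open>u # v = w @ [t]\<close> from a window closed under prefixes and suffixes
  lowers \<open>H\<close> by \<open>h\<close>; it lowers the pair entropy of the \<open>i\<close>-th generator by \<open>2 h\<close>, except by \<open>h\<close> only
  when \<open>t\<close> is that generator or its inverse. As \<open>(1 - 2 r) + 2 (r - 1) + 1 = 0\<close>, \<open>F\<close> is unchanged
  (\<open>F_obs_window_origin\<close>), so \<open>f = F\<close> for the canonical partition, and this value is the formula
  claimed (\<open>F_obs_origin\<close>).

  Both parts compare entropies of translates, which rests on the shifts preserving the measure
  (\<open>U_preserves\<close>); this is where invariance of the transition system enters. The group and the semigroup are handled together: in the semigroup only
  positive letters occur, and then every word is reduced.
\<close>

section \<open>Observables and their entropy\<close>

definition observable :: "'x measure \<Rightarrow> ('x \<Rightarrow> 'a) \<Rightarrow> bool" where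
  "observable M \<xi> \<longleftrightarrow> countable (\<xi> ` space M) \<and> (\<forall>v. {x\<in>space M. \<xi> x = v} \<in> sets M)"

definition finer :: "'x measure \<Rightarrow> ('x \<Rightarrow> 'a) \<Rightarrow> ('x \<Rightarrow> 'b) \<Rightarrow> bool" where
  "finer M \<xi> \<eta> \<longleftrightarrow> (\<forall>x\<in>space M. \<forall>x'\<in>space M. \<xi> x = \<xi> x' \<longrightarrow> \<eta> x = \<eta> x')"

definition cell_prob :: "'x measure \<Rightarrow> ('x \<Rightarrow> 'a) \<Rightarrow> 'x \<Rightarrow> real" where
  "cell_prob M \<xi> x = measure M {x'\<in>space M. \<xi> x' = \<xi> x}"

text \<open>The Shannon entropy, written as the mean of the information function: monotonicity, invariance
  and submodularity then follow from pointwise (in)equalities between integrands.\<close>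

definition obs_entropy :: "'x measure \<Rightarrow> ('x \<Rightarrow> 'a) \<Rightarrow> real" where
  "obs_entropy M \<xi> = (\<integral>x. - ln (cell_prob M \<xi> x) \<partial>M)"

definition finite_entropy :: "'x measure \<Rightarrow> ('x \<Rightarrow> 'a) \<Rightarrow> bool" where
  "finite_entropy M \<xi> \<longleftrightarrow> observable M \<xi> \<and> integrable M (\<lambda>x. - ln (cell_prob M \<xi> x))"

definition cond_entropy :: "'x measure \<Rightarrow> ('x \<Rightarrow> 'a) \<Rightarrow> ('x \<Rightarrow> 'b) \<Rightarrow> real" where
  "cond_entropy M \<xi> \<eta> = obs_entropy M (\<lambda>x. (\<xi> x, \<eta> x)) - obs_entropy M \<eta>"

lemma finerI: "(\<And>x x'. x \<in> space M \<Longrightarrow> x' \<in> space M \<Longrightarrow> \<xi> x = \<xi> x' \<Longrightarrow> \<eta> x = \<eta> x') \<Longrightarrow> finer M \<xi> \<eta>"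
  unfolding finer_def by blast

lemma finerD: "finer M \<xi> \<eta> \<Longrightarrow> x \<in> space M \<Longrightarrow> x' \<in> space M \<Longrightarrow> \<xi> x = \<xi> x' \<Longrightarrow> \<eta> x = \<eta> x'"
  unfolding finer_def by blast

lemma finer_trans: "finer M \<xi> \<eta> \<Longrightarrow> finer M \<eta> \<zeta> \<Longrightarrow> finer M \<xi> \<zeta>"
  unfolding finer_def by blast

lemma observable_sets:
  assumes "observable M \<xi>" shows "{x\<in>space M. Q (\<xi> x)} \<in> sets M"
proof -
  have "{x\<in>space M. Q (\<xi> x)} = (\<Union>v\<in>\<xi> ` space M \<inter> Collect Q. {x\<in>space M. \<xi> x = v})" by auto
  also have "\<dots> \<in> sets M"
    using assms by (intro sets.countable_UN') (auto simp: observable_def intro: countable_subset)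
  finally show ?thesis .
qed

lemma observable_finer:
  assumes "observable M \<xi>" "finer M \<xi> \<eta>" shows "observable M \<eta>"
proof -
  have "{x\<in>space M. \<eta> x = v} \<in> sets M" for v
  proof -
    have "{x\<in>space M. \<eta> x = v} = {x\<in>space M. \<xi> x \<in> \<xi> ` {x\<in>space M. \<eta> x = v}}"
      using assms(2) by (auto simp: finer_def)
    also have "\<dots> \<in> sets M" by (rule observable_sets[OF assms(1)])
    finally show ?thesis .
  qed
  moreover have "\<eta> ` space M = (\<lambda>a. \<eta> (SOME x. x \<in> space M \<and> \<xi> x = a)) ` \<xi> ` space M"
  proof -
    have "\<eta> (SOME x'. x' \<in> space M \<and> \<xi> x' = \<xi> x) = \<eta> x" if "x \<in> space M" for x
      using someI[of "\<lambda>x'. x' \<in> space M \<and> \<xi> x' = \<xi> x" x] that finerD[OF assms(2)] by blast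
    then show ?thesis unfolding image_image by (intro image_cong) simp_all
  qed
  moreover from this have "countable (\<eta> ` space M)" using assms(1) by (simp add: observable_def)
  ultimately show ?thesis unfolding observable_def by blast
qed

lemma observable_measurable:
  fixes f :: "'a \<Rightarrow> 'b::topological_space"
  assumes "observable M \<xi>" shows "(\<lambda>x. f (\<xi> x)) \<in> borel_measurable M"
proof (rule measurableI)
  fix A :: "'b set" assume "A \<in> sets borel"
  have "(\<lambda>x. f (\<xi> x)) -` A \<inter> space M = {x\<in>space M. f (\<xi> x) \<in> A}" by auto
  also have "\<dots> \<in> sets M" by (rule observable_sets[OF assms])
  finally show "(\<lambda>x. f (\<xi> x)) -` A \<inter> space M \<in> sets M" .
qed auto

lemma observable_Pair:
  assumes "observable M \<xi>" "observable M \<eta>" shows "observable M (\<lambda>x. (\<xi> x, \<eta> x))"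
  unfolding observable_def
proof (intro conjI allI)
  have "(\<lambda>x. (\<xi> x, \<eta> x)) ` space M \<subseteq> \<xi> ` space M \<times> \<eta> ` space M" by auto
  moreover have "countable (\<xi> ` space M \<times> \<eta> ` space M)"
    using assms by (simp add: observable_def)
  ultimately show "countable ((\<lambda>x. (\<xi> x, \<eta> x)) ` space M)" by (rule countable_subset)
  fix v
  have "{x\<in>space M. (\<xi> x, \<eta> x) = v} = {x\<in>space M. \<xi> x = fst v} \<inter> {x\<in>space M. \<eta> x = snd v}"
    by auto
  also have "\<dots> \<in> sets M" using assms by (intro sets.Int) (simp_all add: observable_def)
  finally show "{x\<in>space M. (\<xi> x, \<eta> x) = v} \<in> sets M" .
qed

lemma finer_cell_subset:
  "finer M \<xi> \<eta> \<Longrightarrow> x \<in> space M \<Longrightarrow> {x'\<in>space M. \<xi> x' = \<xi> x} \<subseteq> {x'\<in>space M. \<eta> x' = \<eta> x}"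
  by (auto dest: finerD)

text \<open>For each point exactly one summand on the right survives; exchanging sum and integral is the whole
  content. All countable sums over labels below are obtained from this identity.\<close>

lemma nn_integral_split_observable:
  assumes "observable M \<xi>" "\<And>v. f v \<in> borel_measurable M"
  shows "(\<integral>\<^sup>+x. f (\<xi> x) x \<partial>M) = (\<integral>\<^sup>+v. (\<integral>\<^sup>+x. f v x * indicator {x\<in>space M. \<xi> x = v} x \<partial>M) \<partial>count_space (\<xi> ` space M))"
proof -
  have "(\<integral>\<^sup>+x. f (\<xi> x) x \<partial>M) = (\<integral>\<^sup>+x. (\<integral>\<^sup>+v. f v x * indicator {x\<in>space M. \<xi> x = v} x \<partial>count_space (\<xi> ` space M)) \<partial>M)"
  proof (rule nn_integral_cong)
    fix x assume x: "x \<in> space M"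
    have "(\<integral>\<^sup>+v. f v x * indicator {x\<in>space M. \<xi> x = v} x \<partial>count_space (\<xi> ` space M))
        = (\<Sum>v\<in>{\<xi> x}. f v x * indicator {x\<in>space M. \<xi> x = v} x)"
      using x by (intro nn_integral_count_space') auto
    then show "f (\<xi> x) x = (\<integral>\<^sup>+v. f v x * indicator {x\<in>space M. \<xi> x = v} x \<partial>count_space (\<xi> ` space M))"
      using x by simp
  qed
  also have "\<dots> = (\<integral>\<^sup>+v. (\<integral>\<^sup>+x. f v x * indicator {x\<in>space M. \<xi> x = v} x \<partial>M) \<partial>count_space (\<xi> ` space M))"
    using assms by (intro nn_integral_count_space_nn_integral) (auto simp: observable_def)
  finally show ?thesis .
qed

lemma nn_integral_observable:
  assumes "observable M \<xi>"
  shows "(\<integral>\<^sup>+x. f (\<xi> x) \<partial>M) = (\<integral>\<^sup>+v. f v * emeasure M {x\<in>space M. \<xi> x = v} \<partial>count_space (\<xi> ` space M))"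
proof -
  have "(\<integral>\<^sup>+x. f (\<xi> x) \<partial>M) = (\<integral>\<^sup>+v. (\<integral>\<^sup>+x. f v * indicator {x\<in>space M. \<xi> x = v} x \<partial>M) \<partial>count_space (\<xi> ` space M))"
    by (rule nn_integral_split_observable[OF assms, of "\<lambda>v _. f v"]) simp
  also have "\<dots> = (\<integral>\<^sup>+v. f v * emeasure M {x\<in>space M. \<xi> x = v} \<partial>count_space (\<xi> ` space M))"
    using assms by (intro nn_integral_cong nn_integral_cmult_indicator) (auto simp: observable_def)
  finally show ?thesis .
qed

lemma emeasure_split_observable:
  assumes "observable M \<xi>" "A \<in> sets M"
  shows "emeasure M A = (\<integral>\<^sup>+v. emeasure M {x\<in>A. \<xi> x = v} \<partial>count_space (\<xi> ` space M))"
proof -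
  have [measurable]: "{x \<in> space M. \<xi> x = v} \<in> sets M" for v using assms(1) by (auto simp: observable_def)
  have e: "{x\<in>A. \<xi> x = v} = A \<inter> {x\<in>space M. \<xi> x = v}" for v
    using sets.sets_into_space[OF assms(2)] by auto
  have "emeasure M A = (\<integral>\<^sup>+x. indicator A x \<partial>M)" using assms(2) by simp
  also have "\<dots> = (\<integral>\<^sup>+v. (\<integral>\<^sup>+x. indicator A x * indicator {x\<in>space M. \<xi> x = v} x \<partial>M) \<partial>count_space (\<xi> ` space M))"
    using assms by (intro nn_integral_split_observable[where f="\<lambda>_ x. indicator A x"]) auto
  also have "\<dots> = (\<integral>\<^sup>+v. emeasure M {x\<in>A. \<xi> x = v} \<partial>count_space (\<xi> ` space M))"
    unfolding e using assms(2) by (simp flip: indicator_inter_arith)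
  finally show ?thesis .
qed

text \<open>The integrand is the density ratio between the law making \<open>\<xi>\<close> and \<open>\<eta>\<close> conditionally independent
  given \<open>\<zeta>\<close> and the true joint law. Its integral is the mass of the former law on the atoms of the
  latter, hence at most 1. With \<open>ln q \<le> q - 1\<close> this yields submodularity of entropy.\<close>

lemma (in prob_space) nn_integral_independence_ratio:
  assumes \<xi>: "observable M \<xi>" and \<eta>: "observable M \<eta>" and \<zeta>: "observable M \<zeta>"
  shows "(\<integral>\<^sup>+\<omega>. ennreal (cell_prob M (\<lambda>\<omega>. (\<xi> \<omega>, \<zeta> \<omega>)) \<omega> * cell_prob M (\<lambda>\<omega>. (\<eta> \<omega>, \<zeta> \<omega>)) \<omega>
            / (cell_prob M (\<lambda>\<omega>. (\<xi> \<omega>, \<eta> \<omega>, \<zeta> \<omega>)) \<omega> * cell_prob M \<zeta> \<omega>)) \<partial>M) \<le> 1"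
proof -
  define e3 where "e3 x y z = {\<omega>\<in>space M. \<xi> \<omega> = x \<and> \<eta> \<omega> = y \<and> \<zeta> \<omega> = z}" for x y z
  define ex where "ex x z = {\<omega>\<in>space M. \<xi> \<omega> = x \<and> \<zeta> \<omega> = z}" for x z
  define ey where "ey y z = {\<omega>\<in>space M. \<eta> \<omega> = y \<and> \<zeta> \<omega> = z}" for y z
  define e where "e z = {\<omega>\<in>space M. \<zeta> \<omega> = z}" for z
  have XS: "{\<omega> \<in> space M. \<xi> \<omega> = v} \<in> sets M" and YS: "{\<omega> \<in> space M. \<eta> \<omega> = u} \<in> sets M"
    and ZS: "{\<omega> \<in> space M. \<zeta> \<omega> = t} \<in> sets M" for v u t
    using \<xi> \<eta> \<zeta> by (auto simp: observable_def)
  have [measurable]: "e3 x y z \<in> sets M" "ex x z \<in> sets M" "ey y z \<in> sets M" "e z \<in> sets M" for x y z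
    unfolding e3_def ex_def ey_def e_def using XS YS ZS by auto
  define \<phi> where "\<phi> x y z = ennreal (prob (ex x z) * prob (ey y z) / (prob (e3 x y z) * prob (e z)))" for x y z
  note obsP = observable_Pair[OF \<xi> observable_Pair[OF \<eta> \<zeta>]]
  have "(\<integral>\<^sup>+\<omega>. ennreal (cell_prob M (\<lambda>\<omega>. (\<xi> \<omega>, \<zeta> \<omega>)) \<omega> * cell_prob M (\<lambda>\<omega>. (\<eta> \<omega>, \<zeta> \<omega>)) \<omega>
            / (cell_prob M (\<lambda>\<omega>. (\<xi> \<omega>, \<eta> \<omega>, \<zeta> \<omega>)) \<omega> * cell_prob M \<zeta> \<omega>)) \<partial>M)
     = (\<integral>\<^sup>+\<omega>. \<phi> (\<xi> \<omega>) (\<eta> \<omega>) (\<zeta> \<omega>) \<partial>M)"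
    by (simp add: cell_prob_def \<phi>_def e3_def ex_def ey_def e_def)
  also have "\<dots> = (\<integral>\<^sup>+z. (\<integral>\<^sup>+\<omega>. \<phi> (\<xi> \<omega>) (\<eta> \<omega>) z * indicator {\<omega>\<in>space M. \<zeta> \<omega> = z} \<omega> \<partial>M) \<partial>count_space (\<zeta> ` space M))"
    by (rule nn_integral_split_observable[OF \<zeta>, where f="\<lambda>z \<omega>. \<phi> (\<xi> \<omega>) (\<eta> \<omega>) z"])
       (rule observable_measurable[OF observable_Pair[OF \<xi> \<eta>], where f="\<lambda>(x,y). \<phi> x y _", simplified])
  also have "\<dots> \<le> (\<integral>\<^sup>+z. emeasure M {\<omega>\<in>space M. \<zeta> \<omega> = z} \<partial>count_space (\<zeta> ` space M))"
  proof (rule nn_integral_mono)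
    fix z
    have m1: "(\<lambda>\<omega>. \<phi> x (\<eta> \<omega>) z * indicator {\<omega> \<in> space M. \<zeta> \<omega> = z} \<omega>) \<in> borel_measurable M" for x
      using ZS by (intro borel_measurable_times_ennreal observable_measurable[OF \<eta>, of "\<lambda>y. \<phi> x y z"]) auto
    have "(\<integral>\<^sup>+\<omega>. \<phi> (\<xi> \<omega>) (\<eta> \<omega>) z * indicator {\<omega>\<in>space M. \<zeta> \<omega> = z} \<omega> \<partial>M)
       = (\<integral>\<^sup>+x. (\<integral>\<^sup>+\<omega>. \<phi> x (\<eta> \<omega>) z * indicator {\<omega>\<in>space M. \<zeta> \<omega> = z} \<omega> * indicator {\<omega>\<in>space M. \<xi> \<omega> = x} \<omega> \<partial>M) \<partial>count_space (\<xi> ` space M))"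
      by (rule nn_integral_split_observable[OF \<xi>, where f="\<lambda>x \<omega>. \<phi> x (\<eta> \<omega>) z * indicator {\<omega>\<in>space M. \<zeta> \<omega> = z} \<omega>"]) (rule m1)
    also have "\<dots> = (\<integral>\<^sup>+x. (\<integral>\<^sup>+y. \<phi> x y z * emeasure M (e3 x y z) \<partial>count_space (\<eta> ` space M)) \<partial>count_space (\<xi> ` space M))"
    proof (rule nn_integral_cong)
      fix x
      have "(\<integral>\<^sup>+\<omega>. \<phi> x (\<eta> \<omega>) z * indicator {\<omega>\<in>space M. \<zeta> \<omega> = z} \<omega> * indicator {\<omega>\<in>space M. \<xi> \<omega> = x} \<omega> \<partial>M)
        = (\<integral>\<^sup>+\<omega>. \<phi> x (\<eta> \<omega>) z * indicator (ex x z) \<omega> \<partial>M)"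
        by (rule nn_integral_cong) (auto simp: indicator_def ex_def)
      also have "\<dots> = (\<integral>\<^sup>+y. (\<integral>\<^sup>+\<omega>. \<phi> x y z * indicator (ex x z) \<omega> * indicator {\<omega>\<in>space M. \<eta> \<omega> = y} \<omega> \<partial>M) \<partial>count_space (\<eta> ` space M))"
        by (rule nn_integral_split_observable[OF \<eta>, where f="\<lambda>y \<omega>. \<phi> x y z * indicator (ex x z) \<omega>"]) simp
      also have "\<dots> = (\<integral>\<^sup>+y. \<phi> x y z * emeasure M (e3 x y z) \<partial>count_space (\<eta> ` space M))"
      proof (rule nn_integral_cong)
        fix y
        have "(\<integral>\<^sup>+\<omega>. \<phi> x y z * indicator (ex x z) \<omega> * indicator {\<omega>\<in>space M. \<eta> \<omega> = y} \<omega> \<partial>M)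
          = (\<integral>\<^sup>+\<omega>. \<phi> x y z * indicator (e3 x y z) \<omega> \<partial>M)"
          by (rule nn_integral_cong) (auto simp: indicator_def e3_def ex_def)
        then show "(\<integral>\<^sup>+\<omega>. \<phi> x y z * indicator (ex x z) \<omega> * indicator {\<omega>\<in>space M. \<eta> \<omega> = y} \<omega> \<partial>M) = \<phi> x y z * emeasure M (e3 x y z)"
          by (simp add: nn_integral_cmult_indicator)
      qed
      finally show "(\<integral>\<^sup>+\<omega>. \<phi> x (\<eta> \<omega>) z * indicator {\<omega>\<in>space M. \<zeta> \<omega> = z} \<omega> * indicator {\<omega>\<in>space M. \<xi> \<omega> = x} \<omega> \<partial>M)
        = (\<integral>\<^sup>+y. \<phi> x y z * emeasure M (e3 x y z) \<partial>count_space (\<eta> ` space M))" .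
    qed
    also have "\<dots> \<le> (\<integral>\<^sup>+x. (\<integral>\<^sup>+y. ennreal (prob (ex x z) / prob (e z)) * emeasure M (ey y z) \<partial>count_space (\<eta> ` space M)) \<partial>count_space (\<xi> ` space M))"
    proof (intro nn_integral_mono)
      fix x y
      have "prob (ex x z) * prob (ey y z) / (prob (e3 x y z) * prob (e z)) * prob (e3 x y z) \<le> prob (ex x z) / prob (e z) * prob (ey y z)"
        by (cases "prob (e3 x y z) = 0") auto
      then show "\<phi> x y z * emeasure M (e3 x y z) \<le> ennreal (prob (ex x z) / prob (e z)) * emeasure M (ey y z)"
        unfolding \<phi>_def emeasure_eq_measure by (subst (1 2) ennreal_mult[symmetric]) (auto intro: ennreal_leI)
    qed
    also have "\<dots> = (\<integral>\<^sup>+x. ennreal (prob (ex x z) / prob (e z)) * emeasure M (e z) \<partial>count_space (\<xi> ` space M))"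
    proof (intro nn_integral_cong)
      fix x
      have "(\<integral>\<^sup>+y. emeasure M (ey y z) \<partial>count_space (\<eta> ` space M)) = emeasure M (e z)"
        unfolding emeasure_split_observable[OF \<eta> \<open>e z \<in> sets M\<close>]
        by (intro nn_integral_cong arg_cong[of _ _ "emeasure M"]) (auto simp: ey_def e_def)
      then show "(\<integral>\<^sup>+y. ennreal (prob (ex x z) / prob (e z)) * emeasure M (ey y z) \<partial>count_space (\<eta> ` space M)) = ennreal (prob (ex x z) / prob (e z)) * emeasure M (e z)"
        by (simp add: nn_integral_cmult)
    qed
    also have "\<dots> \<le> (\<integral>\<^sup>+x. emeasure M (ex x z) \<partial>count_space (\<xi> ` space M))"
    proof (intro nn_integral_mono)
      fix x
      have "prob (ex x z) / prob (e z) * prob (e z) \<le> prob (ex x z)"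
        by (cases "prob (e z) = 0") auto
      then show "ennreal (prob (ex x z) / prob (e z)) * emeasure M (e z) \<le> emeasure M (ex x z)"
        unfolding emeasure_eq_measure by (subst ennreal_mult[symmetric]) (auto intro: ennreal_leI)
    qed
    also have "\<dots> = emeasure M (e z)"
      unfolding emeasure_split_observable[OF \<xi> \<open>e z \<in> sets M\<close>]
      by (intro nn_integral_cong arg_cong[of _ _ "emeasure M"]) (auto simp: ex_def e_def)
    finally show "(\<integral>\<^sup>+\<omega>. \<phi> (\<xi> \<omega>) (\<eta> \<omega>) z * indicator {\<omega>\<in>space M. \<zeta> \<omega> = z} \<omega> \<partial>M) \<le> emeasure M {\<omega>\<in>space M. \<zeta> \<omega> = z}"
      by (simp add: e_def)
  qed
  also have "\<dots> = emeasure M (space M)"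
    by (subst emeasure_split_observable[OF \<zeta>, of "space M"]) auto
  finally show ?thesis by (simp add: emeasure_space_1)
qed

context prob_space
begin

abbreviation "law \<xi> v \<equiv> prob {x\<in>space M. \<xi> x = v}"

lemma cell_prob_nonneg: "0 \<le> cell_prob M \<xi> x"
  and cell_prob_le_1: "cell_prob M \<xi> x \<le> 1"
  by (simp_all add: cell_prob_def)

lemma cell_prob_measurable:
  "observable M \<xi> \<Longrightarrow> cell_prob M \<xi> \<in> borel_measurable M"
  using observable_measurable[of M \<xi> "\<lambda>v. law \<xi> v"]
  by (simp add: cell_prob_def[abs_def])

lemma AE_cell_prob_pos:
  assumes "observable M \<xi>" shows "AE x in M. 0 < cell_prob M \<xi> x"
proof -
  let ?V = "{v\<in>\<xi> ` space M. law \<xi> v = 0}"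
  have "(\<Union>v\<in>?V. {x\<in>space M. \<xi> x = v}) \<in> null_sets M"
  proof (rule null_sets_UN')
    show "countable ?V" using assms by (auto simp: observable_def intro: countable_subset)
    show "{x\<in>space M. \<xi> x = v} \<in> null_sets M" if "v \<in> ?V" for v
      using that assms by (auto simp: observable_def emeasure_eq_measure intro!: null_setsI)
  qed
  then show ?thesis
  proof (rule AE_I')
    show "{x \<in> space M. \<not> 0 < cell_prob M \<xi> x} \<subseteq> (\<Union>v\<in>?V. {x\<in>space M. \<xi> x = v})"
      by (auto simp: cell_prob_def not_less measure_le_0_iff)
  qed
qed

lemma cell_prob_mono:
  assumes "observable M \<eta>" "finer M \<xi> \<eta>" "x \<in> space M"
  shows "cell_prob M \<xi> x \<le> cell_prob M \<eta> x"
  unfolding cell_prob_def using assms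
  by (intro finite_measure_mono finer_cell_subset) (auto simp: observable_def)

lemma cell_prob_cong:
  assumes "finer M \<xi> \<eta>" "finer M \<eta> \<xi>" "x \<in> space M"
  shows "cell_prob M \<xi> x = cell_prob M \<eta> x"
proof -
  have "{x'\<in>space M. \<xi> x' = \<xi> x} = {x'\<in>space M. \<eta> x' = \<eta> x}"
    using finer_cell_subset[OF assms(1,3)] finer_cell_subset[OF assms(2,3)] by (rule equalityI)
  then show ?thesis unfolding cell_prob_def by (rule arg_cong)
qed

lemma obs_entropy_cong:
  assumes "finer M \<xi> \<eta>" "finer M \<eta> \<xi>"
  shows "obs_entropy M \<xi> = obs_entropy M \<eta>"
  unfolding obs_entropy_def by (intro Bochner_Integration.integral_cong) (simp_all add: cell_prob_cong[OF assms])

lemma info_measurable: "observable M \<xi> \<Longrightarrow> (\<lambda>x. - ln (cell_prob M \<xi> x)) \<in> borel_measurable M"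
  using cell_prob_measurable by measurable

lemma info_nonneg: "0 \<le> - ln (cell_prob M \<xi> x)"
  using cell_prob_nonneg[of \<xi> x] cell_prob_le_1[of \<xi> x]
  by (cases "cell_prob M \<xi> x = 0") (auto simp: ln_le_zero_iff)

lemma obs_entropy_nonneg: "0 \<le> obs_entropy M \<xi>"
  unfolding obs_entropy_def by (intro integral_nonneg_AE AE_I2 info_nonneg)

lemma AE_info_mono:
  assumes "observable M \<xi>" "finer M \<xi> \<eta>"
  shows "AE x in M. - ln (cell_prob M \<eta> x) \<le> - ln (cell_prob M \<xi> x)"
  using AE_cell_prob_pos[OF assms(1)] AE_space
proof eventually_elim
  case (elim x)
  with cell_prob_mono[OF observable_finer[OF assms] assms(2)] have "cell_prob M \<xi> x \<le> cell_prob M \<eta> x" by simp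
  with elim show ?case by (simp add: ln_mono)
qed

lemma finite_entropy_observable: "finite_entropy M \<xi> \<Longrightarrow> observable M \<xi>"
  by (simp add: finite_entropy_def)

lemma finite_entropy_finer:
  assumes "finite_entropy M \<xi>" "finer M \<xi> \<eta>" shows "finite_entropy M \<eta>"
proof -
  have o: "observable M \<xi>" and i: "integrable M (\<lambda>x. - ln (cell_prob M \<xi> x))"
    using assms(1) by (auto simp: finite_entropy_def)
  note o' = observable_finer[OF o assms(2)]
  have "integrable M (\<lambda>x. - ln (cell_prob M \<eta> x))"
  proof (rule Bochner_Integration.integrable_bound[OF i info_measurable[OF o']])
    show "AE x in M. norm (- ln (cell_prob M \<eta> x)) \<le> norm (- ln (cell_prob M \<xi> x))"
      using AE_info_mono[OF o assms(2)]
    proof eventually_elim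
      case (elim x)
      then show ?case using info_nonneg[of \<eta> x] info_nonneg[of \<xi> x] by simp
    qed
  qed
  with o' show ?thesis by (simp add: finite_entropy_def)
qed

lemma obs_entropy_mono:
  assumes "finite_entropy M \<xi>" "finer M \<xi> \<eta>"
  shows "obs_entropy M \<eta> \<le> obs_entropy M \<xi>"
  unfolding obs_entropy_def
  using assms finite_entropy_finer[OF assms] AE_info_mono[OF finite_entropy_observable[OF assms(1)] assms(2)]
  by (intro integral_mono_AE) (simp_all add: finite_entropy_def)

text \<open>Off a null set the information functions satisfy
  \<open>I(\<xi>,\<eta>,\<zeta>) + I(\<zeta>) \<le> I(\<xi>,\<zeta>) + I(\<eta>,\<zeta>) + R - 1\<close>, where \<open>R\<close> is the ratio of
  \<open>nn_integral_independence_ratio\<close>. This bound gives integrability as well as the inequality.\<close>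

lemma obs_entropy_submodular:
  assumes "finite_entropy M (\<lambda>x. (\<xi> x, \<zeta> x))" "finite_entropy M (\<lambda>x. (\<eta> x, \<zeta> x))"
  shows "finite_entropy M (\<lambda>x. (\<xi> x, \<eta> x, \<zeta> x))" (is ?fin)
    and "obs_entropy M (\<lambda>x. (\<xi> x, \<eta> x, \<zeta> x)) + obs_entropy M \<zeta>
       \<le> obs_entropy M (\<lambda>x. (\<xi> x, \<zeta> x)) + obs_entropy M (\<lambda>x. (\<eta> x, \<zeta> x))" (is ?ineq)
proof -
  have f1: "finer M (\<lambda>x. (\<xi> x, \<zeta> x)) \<xi>" and f2: "finer M (\<lambda>x. (\<xi> x, \<zeta> x)) \<zeta>"
    and f3: "finer M (\<lambda>x. (\<eta> x, \<zeta> x)) \<eta>" by (simp_all add: finer_def)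
  note F\<zeta> = finite_entropy_finer[OF assms(1) f2]
  note o1 = finite_entropy_observable[OF assms(1)] and o2 = finite_entropy_observable[OF assms(2)]
  have o\<xi>: "observable M \<xi>" using o1 f1 by (rule observable_finer)
  have o\<eta>: "observable M \<eta>" using o2 f3 by (rule observable_finer)
  have o\<zeta>: "observable M \<zeta>" using o1 f2 by (rule observable_finer)
  note o3 = observable_Pair[OF o\<xi> o2]
  define a where "a = cell_prob M (\<lambda>x. (\<xi> x, \<zeta> x))"
  define b where "b = cell_prob M (\<lambda>x. (\<eta> x, \<zeta> x))"
  define c where "c = cell_prob M (\<lambda>x. (\<xi> x, \<eta> x, \<zeta> x))"
  define d where "d = cell_prob M \<zeta>"
  have [measurable]: "a \<in> borel_measurable M" "b \<in> borel_measurable M" "c \<in> borel_measurable M" "d \<in> borel_measurable M"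
    unfolding a_def b_def c_def d_def using o1 o2 o3 o\<zeta> by (auto intro: cell_prob_measurable)
  define R where "R x = a x * b x / (c x * d x)" for x
  have Rm [measurable]: "R \<in> borel_measurable M" unfolding R_def by measurable
  have R0: "0 \<le> R x" for x by (simp add: R_def a_def b_def c_def d_def cell_prob_nonneg)
  have R1: "(\<integral>\<^sup>+x. ennreal (R x) \<partial>M) \<le> 1"
    using nn_integral_independence_ratio[OF o\<xi> o\<eta> o\<zeta>] by (simp add: R_def a_def b_def c_def d_def)
  have Ri: "integrable M R"
    using R1 R0 by (intro integrableI_nonneg) (auto simp: order.strict_trans1)
  have RI: "(\<integral>x. R x \<partial>M) \<le> 1"
    using R1 R0 by (subst integral_eq_nn_integral) (auto simp: enn2real_leI)
  have ia: "integrable M (\<lambda>x. - ln (a x))" and ib: "integrable M (\<lambda>x. - ln (b x))" and id: "integrable M (\<lambda>x. - ln (d x))"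
    using assms F\<zeta> by (simp_all add: finite_entropy_def a_def b_def d_def)
  let ?B = "\<lambda>x. (- ln (a x)) + (- ln (b x)) - (- ln (d x)) + R x - 1"
  have iB: "integrable M ?B" using ia ib id Ri by (intro Bochner_Integration.integrable_diff Bochner_Integration.integrable_add) auto
  have pt: "AE x in M. - ln (c x) \<le> ?B x"
    using AE_cell_prob_pos[OF o1] AE_cell_prob_pos[OF o2] AE_cell_prob_pos[OF o3] AE_cell_prob_pos[OF o\<zeta>]
  proof eventually_elim
    case (elim x)
    then have p: "0 < a x" "0 < b x" "0 < c x" "0 < d x" by (simp_all add: a_def b_def c_def d_def)
    have "ln (R x) \<le> R x - 1" using p by (intro ln_le_minus_one) (simp add: R_def)
    moreover have "ln (R x) = ln (a x) + ln (b x) - (ln (c x) + ln (d x))"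
      using p by (simp add: R_def ln_div ln_mult)
    ultimately show ?case by simp
  qed
  have c0: "0 \<le> - ln (c x)" for x unfolding c_def by (rule info_nonneg)
  have ic: "integrable M (\<lambda>x. - ln (c x))"
  proof (rule Bochner_Integration.integrable_bound[OF iB])
    show "AE x in M. norm (- ln (c x)) \<le> norm (?B x)"
      using pt
    proof eventually_elim
      case (elim x)
      with c0[of x] show ?case by simp
    qed
  qed simp
  then show ?fin using o3 by (simp add: finite_entropy_def c_def)
  have "(\<integral>x. - ln (c x) \<partial>M) \<le> (\<integral>x. ?B x \<partial>M)"
    using ic iB pt by (rule integral_mono_AE)
  also have "\<dots> = (\<integral>x. - ln (a x) \<partial>M) + (\<integral>x. - ln (b x) \<partial>M) - (\<integral>x. - ln (d x) \<partial>M) + (\<integral>x. R x \<partial>M) - 1"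
    using ia ib id Ri by (simp add: prob_space)
  finally show ?ineq using RI by (simp add: obs_entropy_def a_def b_def c_def d_def)
qed

lemma finite_entropy_const: "finite_entropy M (\<lambda>_. c)"
proof -
  have "countable ((\<lambda>_. c) ` space M)" by (rule countable_subset[of _ "{c}"]) auto
  then have "observable M (\<lambda>_. c)" by (simp add: observable_def)
  then show ?thesis by (simp add: finite_entropy_def cell_prob_def prob_space)
qed

lemma obs_entropy_const: "obs_entropy M (\<lambda>_. c) = 0"
  by (simp add: obs_entropy_def cell_prob_def prob_space)

text \<open>The one-point label \<open>()\<close> specialises statements with a third observable to the unconditional
  case.\<close>

lemma finite_entropy_Pair_unit: "finite_entropy M \<xi> \<Longrightarrow> finite_entropy M (\<lambda>x. (\<xi> x, ()))"
  by (erule finite_entropy_finer) (simp add: finer_def)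

lemma finite_entropy_Pair:
  assumes "finite_entropy M \<xi>" "finite_entropy M \<eta>" shows "finite_entropy M (\<lambda>x. (\<xi> x, \<eta> x))"
proof -
  have "finite_entropy M (\<lambda>x. (\<xi> x, ()))" "finite_entropy M (\<lambda>x. (\<eta> x, ()))"
    by (rule finite_entropy_Pair_unit assms)+
  from obs_entropy_submodular(1)[OF this] show ?thesis by (rule finite_entropy_finer) (simp add: finer_def)
qed

lemma finite_entropy_restrict:
  assumes "finite W" "\<And>w. w \<in> W \<Longrightarrow> finite_entropy M (\<xi> w)"
  shows "finite_entropy M (\<lambda>x. \<lambda>w\<in>W. \<xi> w x)"
  using assms
proof (induction W rule: finite_induct)
  case empty
  then show ?case by (simp add: finite_entropy_const)
next
  case (insert w W)
  then have "finite_entropy M (\<xi> w)" "finite_entropy M (\<lambda>x. \<lambda>w\<in>W. \<xi> w x)" by blast+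
  then have "finite_entropy M (\<lambda>x. (\<xi> w x, \<lambda>w\<in>W. \<xi> w x))"
    by (rule finite_entropy_Pair)
  then show ?case
  proof (rule finite_entropy_finer)
    show "finer M (\<lambda>x. (\<xi> w x, \<lambda>w\<in>W. \<xi> w x)) (\<lambda>x. \<lambda>w\<in>insert w W. \<xi> w x)"
      unfolding finer_def by (auto simp: restrict_def fun_eq_iff)
  qed
qed

lemma cond_entropy_le:
  assumes "finite_entropy M \<xi>" "finite_entropy M \<eta>" shows "cond_entropy M \<xi> \<eta> \<le> obs_entropy M \<xi>"
proof -
  have f: "finite_entropy M (\<lambda>x. (\<xi> x, ()))" "finite_entropy M (\<lambda>x. (\<eta> x, ()))"
    by (rule finite_entropy_Pair_unit assms)+
  have "obs_entropy M (\<lambda>x. (\<xi> x, \<eta> x, ())) = obs_entropy M (\<lambda>x. (\<xi> x, \<eta> x))"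
    "obs_entropy M (\<lambda>x. (\<xi> x, ())) = obs_entropy M \<xi>" "obs_entropy M (\<lambda>x. (\<eta> x, ())) = obs_entropy M \<eta>"
    by (auto intro!: obs_entropy_cong simp: finer_def)
  with obs_entropy_submodular(2)[OF f] show ?thesis unfolding cond_entropy_def by (simp add: obs_entropy_const)
qed

lemma cond_entropy_antimono:
  assumes "finite_entropy M \<xi>" "finite_entropy M \<eta>" "finer M \<eta> \<zeta>"
  shows "cond_entropy M \<xi> \<eta> \<le> cond_entropy M \<xi> \<zeta>"
proof -
  have z: "finite_entropy M \<zeta>" using assms(2,3) by (rule finite_entropy_finer)
  have "obs_entropy M (\<lambda>x. (\<xi> x, \<eta> x, \<zeta> x)) + obs_entropy M \<zeta>
       \<le> obs_entropy M (\<lambda>x. (\<xi> x, \<zeta> x)) + obs_entropy M (\<lambda>x. (\<eta> x, \<zeta> x))"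
    using assms z by (intro obs_entropy_submodular finite_entropy_Pair)
  moreover have "obs_entropy M (\<lambda>x. (\<xi> x, \<eta> x, \<zeta> x)) = obs_entropy M (\<lambda>x. (\<xi> x, \<eta> x))"
    by (rule obs_entropy_cong) (use assms(3) in \<open>unfold finer_def prod.inject, blast+\<close>)
  moreover have "obs_entropy M (\<lambda>x. (\<eta> x, \<zeta> x)) = obs_entropy M \<eta>"
    by (rule obs_entropy_cong) (use assms(3) in \<open>unfold finer_def prod.inject, blast+\<close>)
  ultimately show ?thesis unfolding cond_entropy_def by simp
qed

lemma cond_entropy_mono:
  assumes "finite_entropy M \<xi>" "finite_entropy M \<eta>" "finer M \<xi> \<zeta>"
  shows "cond_entropy M \<zeta> \<eta> \<le> cond_entropy M \<xi> \<eta>"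
proof -
  have "finer M (\<lambda>x. (\<xi> x, \<eta> x)) (\<lambda>x. (\<zeta> x, \<eta> x))"
    using assms(3) unfolding finer_def prod.inject by blast
  from obs_entropy_mono[OF finite_entropy_Pair[OF assms(1,2)] this] show ?thesis
    unfolding cond_entropy_def by simp
qed

text \<open>Submodularity, read as subadditivity of conditional entropy.\<close>

lemma cond_entropy_Pair_le:
  assumes "finite_entropy M \<xi>" "finite_entropy M \<eta>" "finite_entropy M \<zeta>"
  shows "cond_entropy M (\<lambda>x. (\<xi> x, \<eta> x)) \<zeta> \<le> cond_entropy M \<xi> \<zeta> + cond_entropy M \<eta> \<zeta>"
proof -
  have "obs_entropy M (\<lambda>x. (\<xi> x, \<eta> x, \<zeta> x)) + obs_entropy M \<zeta>
       \<le> obs_entropy M (\<lambda>x. (\<xi> x, \<zeta> x)) + obs_entropy M (\<lambda>x. (\<eta> x, \<zeta> x))"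
    using assms by (intro obs_entropy_submodular finite_entropy_Pair)
  moreover have "obs_entropy M (\<lambda>x. ((\<xi> x, \<eta> x), \<zeta> x)) = obs_entropy M (\<lambda>x. (\<xi> x, \<eta> x, \<zeta> x))"
    by (auto intro!: obs_entropy_cong simp: finer_def)
  ultimately show ?thesis unfolding cond_entropy_def by simp
qed

lemma cond_entropy_restrict_le:
  assumes "finite W" "\<And>w. w \<in> W \<Longrightarrow> finite_entropy M (\<xi> w)" "finite_entropy M \<zeta>"
  shows "cond_entropy M (\<lambda>x. \<lambda>w\<in>W. \<xi> w x) \<zeta> \<le> (\<Sum>w\<in>W. cond_entropy M (\<xi> w) \<zeta>)"
  using assms
proof (induction W rule: finite_induct)
  case empty
  have "obs_entropy M (\<lambda>x. (\<lambda>w\<in>{}. \<xi> w x, \<zeta> x)) = obs_entropy M \<zeta>"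
    by (rule obs_entropy_cong) (simp_all add: finer_def restrict_def)
  then show ?case unfolding cond_entropy_def by simp
next
  case (insert w W)
  then have f: "finite_entropy M (\<xi> w)" "finite_entropy M (\<lambda>x. \<lambda>w\<in>W. \<xi> w x)"
    by (auto intro: finite_entropy_restrict)
  have "cond_entropy M (\<lambda>x. \<lambda>w\<in>insert w W. \<xi> w x) \<zeta> \<le> cond_entropy M (\<lambda>x. (\<xi> w x, \<lambda>w\<in>W. \<xi> w x)) \<zeta>"
  proof (rule cond_entropy_mono)
    show "finer M (\<lambda>x. (\<xi> w x, \<lambda>w\<in>W. \<xi> w x)) (\<lambda>x. \<lambda>w\<in>insert w W. \<xi> w x)"
      unfolding finer_def by (auto simp: restrict_def fun_eq_iff)
  qed (use f insert.prems in \<open>auto intro: finite_entropy_Pair\<close>)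
  also have "\<dots> \<le> cond_entropy M (\<xi> w) \<zeta> + cond_entropy M (\<lambda>x. \<lambda>w\<in>W. \<xi> w x) \<zeta>"
    using f insert.prems by (intro cond_entropy_Pair_le)
  also have "\<dots> \<le> cond_entropy M (\<xi> w) \<zeta> + (\<Sum>w\<in>W. cond_entropy M (\<xi> w) \<zeta>)"
    using insert.IH insert.prems by (intro add_left_mono) blast
  finally show ?case unfolding sum.insert[OF insert.hyps] .
qed

end

lemma integrable_count_space_has_sum:
  fixes g :: "'a \<Rightarrow> real"
  assumes "integrable (count_space A) g"
  shows "(g has_sum (\<integral>v. g v \<partial>count_space A)) A"
proof -
  have a: "Infinite_Set_Sum.abs_summable_on g A"
    using assms by (simp add: Infinite_Set_Sum.abs_summable_on_def)
  then have "(\<lambda>v. norm (g v)) summable_on A" by (simp only: abs_summable_equivalent)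
  then have "g summable_on A" by (rule abs_summable_summable)
  then have "(g has_sum infsum g A) A" by (rule has_sum_infsum)
  then show ?thesis using infsetsum_infsum[OF a] by (simp add: infsetsum_def)
qed

lemma summable_on_imp_integrable_count_space:
  fixes g :: "'a \<Rightarrow> real"
  assumes "g summable_on A"
  shows "integrable (count_space A) g"
proof -
  have "(\<lambda>v. norm (g v)) summable_on A"
    using assms by (rule summable_on_iff_abs_summable_on_real[THEN iffD1])
  then have "Infinite_Set_Sum.abs_summable_on g A" by (simp only: abs_summable_equivalent)
  then show ?thesis by (simp add: Infinite_Set_Sum.abs_summable_on_def)
qed

definition preserves_measure :: "'x measure \<Rightarrow> ('x \<Rightarrow> 'x) \<Rightarrow> bool" where
  "preserves_measure M T \<longleftrightarrow> T \<in> M \<rightarrow>\<^sub>M M \<and> distr M M T = M"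

lemma observable_comp:
  assumes "T \<in> M \<rightarrow>\<^sub>M M" "observable M \<xi>" shows "observable M (\<lambda>x. \<xi> (T x))"
  unfolding observable_def
proof (intro conjI allI)
  have "(\<lambda>x. \<xi> (T x)) ` space M \<subseteq> \<xi> ` space M" using measurable_space[OF assms(1)] by auto
  then show "countable ((\<lambda>x. \<xi> (T x)) ` space M)"
    using assms(2) by (auto simp: observable_def intro: countable_subset)
  fix v
  have "{x\<in>space M. \<xi> (T x) = v} = T -` {x\<in>space M. \<xi> x = v} \<inter> space M"
    using measurable_space[OF assms(1)] by auto
  also have "\<dots> \<in> sets M" using assms by (intro measurable_sets) (auto simp: observable_def)
  finally show "{x\<in>space M. \<xi> (T x) = v} \<in> sets M" .
qed

lemma cell_prob_comp:
  assumes "preserves_measure M T" "observable M \<xi>"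
  shows "cell_prob M (\<lambda>x. \<xi> (T x)) x = cell_prob M \<xi> (T x)"
proof -
  have T: "T \<in> M \<rightarrow>\<^sub>M M" and d: "distr M M T = M" using assms(1) by (auto simp: preserves_measure_def)
  have "{x'\<in>space M. \<xi> (T x') = \<xi> (T x)} = T -` {x'\<in>space M. \<xi> x' = \<xi> (T x)} \<inter> space M"
    using measurable_space[OF T] by auto
  moreover have "measure M (T -` {x'\<in>space M. \<xi> x' = \<xi> (T x)} \<inter> space M) = measure (distr M M T) {x'\<in>space M. \<xi> x' = \<xi> (T x)}"
    using assms(2) by (intro measure_distr[symmetric] T) (auto simp: observable_def)
  ultimately show ?thesis by (simp add: cell_prob_def d)
qed

context prob_space
begin

lemma obs_entropy_comp:
  assumes "preserves_measure M T" "observable M \<xi>"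
  shows "obs_entropy M (\<lambda>x. \<xi> (T x)) = obs_entropy M \<xi>"
proof -
  have T: "T \<in> M \<rightarrow>\<^sub>M M" and d: "distr M M T = M" using assms(1) by (auto simp: preserves_measure_def)
  have "obs_entropy M (\<lambda>x. \<xi> (T x)) = (\<integral>x. - ln (cell_prob M \<xi> (T x)) \<partial>M)"
    unfolding obs_entropy_def cell_prob_comp[OF assms] ..
  also have "\<dots> = (\<integral>x. - ln (cell_prob M \<xi> x) \<partial>distr M M T)"
    by (rule integral_distr[symmetric, OF T info_measurable[OF assms(2)]])
  finally show ?thesis by (simp add: d obs_entropy_def)
qed

lemma finite_entropy_comp:
  assumes "preserves_measure M T" "finite_entropy M \<xi>"
  shows "finite_entropy M (\<lambda>x. \<xi> (T x))"
proof -
  have T: "T \<in> M \<rightarrow>\<^sub>M M" and d: "distr M M T = M" using assms(1) by (auto simp: preserves_measure_def)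
  have o: "observable M \<xi>" and i: "integrable (distr M M T) (\<lambda>x. - ln (cell_prob M \<xi> x))"
    using assms(2) by (auto simp: finite_entropy_def d)
  have "integrable M (\<lambda>x. - ln (cell_prob M \<xi> (T x)))"
    by (rule integrable_distr[OF T i])
  then show ?thesis unfolding finite_entropy_def cell_prob_comp[OF assms(1) o]
    using observable_comp[OF T o] by simp
qed

lemma cond_entropy_comp:
  assumes "preserves_measure M T" "observable M \<xi>" "observable M \<eta>"
  shows "cond_entropy M (\<lambda>x. \<xi> (T x)) (\<lambda>x. \<eta> (T x)) = cond_entropy M \<xi> \<eta>"
  unfolding cond_entropy_def
  using obs_entropy_comp[OF assms(1) observable_Pair[OF assms(2,3)]] obs_entropy_comp[OF assms(1,3)] by simp

lemma finite_entropy_finite_range: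
  assumes "observable M \<xi>" "finite (\<xi> ` space M)" shows "finite_entropy M \<xi>"
proof -
  let ?g = "\<lambda>v. - ln (law \<xi> v)"
  have "integrable M (\<lambda>x. - ln (cell_prob M \<xi> x))"
  proof (rule integrable_const_bound[where B="\<Sum>v\<in>\<xi> ` space M. \<bar>?g v\<bar>"])
    show "AE x in M. norm (- ln (cell_prob M \<xi> x)) \<le> (\<Sum>v\<in>\<xi> ` space M. \<bar>?g v\<bar>)"
    proof (rule AE_I2)
      fix x assume "x \<in> space M"
      then have "\<bar>?g (\<xi> x)\<bar> \<le> (\<Sum>v\<in>\<xi> ` space M. \<bar>?g v\<bar>)"
        using assms(2) by (intro member_le_sum) auto
      then show "norm (- ln (cell_prob M \<xi> x)) \<le> (\<Sum>v\<in>\<xi> ` space M. \<bar>?g v\<bar>)" by (simp add: cell_prob_def)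
    qed
  qed (rule info_measurable[OF assms(1)])
  then show ?thesis using assms(1) by (simp add: finite_entropy_def)
qed

lemma nn_integral_info:
  assumes "observable M \<xi>"
  shows "(\<integral>\<^sup>+x. ennreal (- ln (cell_prob M \<xi> x)) \<partial>M)
    = (\<integral>\<^sup>+v. ennreal (- (law \<xi> v * ln (law \<xi> v))) \<partial>count_space (\<xi> ` space M))"
proof -
  let ?q = "\<lambda>v. law \<xi> v"
  have "(\<integral>\<^sup>+x. ennreal (- ln (cell_prob M \<xi> x)) \<partial>M) = (\<integral>\<^sup>+x. ennreal (- ln (?q (\<xi> x))) \<partial>M)"
    by (simp add: cell_prob_def)
  also have "\<dots> = (\<integral>\<^sup>+v. ennreal (- ln (?q v)) * emeasure M {x\<in>space M. \<xi> x = v} \<partial>count_space (\<xi> ` space M))"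
    by (rule nn_integral_observable[OF assms, where f="\<lambda>v. ennreal (- ln (?q v))"])
  also have "\<dots> = (\<integral>\<^sup>+v. ennreal (- (?q v * ln (?q v))) \<partial>count_space (\<xi> ` space M))"
  proof (rule nn_integral_cong)
    fix v
    have "0 \<le> - ln (?q v)" by (cases "?q v = 0") (auto simp: ln_le_zero_iff less_le)
    then have "ennreal (- ln (?q v)) * ennreal (?q v) = ennreal (- ln (?q v) * ?q v)"
      by (subst ennreal_mult) auto
    then show "ennreal (- ln (?q v)) * emeasure M {x\<in>space M. \<xi> x = v} = ennreal (- (?q v * ln (?q v)))"
      by (simp add: emeasure_eq_measure mult.commute)
  qed
  finally show ?thesis .
qed

lemma neg_prob_ln_nonneg: "0 \<le> - (prob A * ln (prob A))"
  by (cases "prob A = 0") (auto simp: ln_le_zero_iff less_le mult_nonneg_nonpos)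

lemma obs_entropy_has_sum:
  assumes "finite_entropy M \<xi>" "\<xi> ` space M \<subseteq> I"
  shows "((\<lambda>v. - (law \<xi> v * ln (law \<xi> v))) has_sum obs_entropy M \<xi>) I"
proof -
  let ?g = "\<lambda>v. - (law \<xi> v * ln (law \<xi> v))"
  have o: "observable M \<xi>" and i: "integrable M (\<lambda>x. - ln (cell_prob M \<xi> x))"
    using assms(1) by (auto simp: finite_entropy_def)
  have "(\<integral>\<^sup>+v. ennreal (?g v) \<partial>count_space (\<xi> ` space M)) = ennreal (obs_entropy M \<xi>)"
    unfolding nn_integral_info[OF o, symmetric] obs_entropy_def
    by (intro nn_integral_eq_integral i AE_I2 info_nonneg)
  moreover have "(\<integral>\<^sup>+v. ennreal (?g v) \<partial>count_space (\<xi> ` space M)) = ennreal (obs_entropy M \<xi>)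
     \<longleftrightarrow> integrable (count_space (\<xi> ` space M)) ?g \<and> integral\<^sup>L (count_space (\<xi> ` space M)) ?g = obs_entropy M \<xi>"
    by (intro nn_integral_eq_integrable AE_I2 neg_prob_ln_nonneg obs_entropy_nonneg) simp
  ultimately have gi: "integrable (count_space (\<xi> ` space M)) ?g \<and> integral\<^sup>L (count_space (\<xi> ` space M)) ?g = obs_entropy M \<xi>"
    by (rule rev_iffD1)
  from integrable_count_space_has_sum[OF gi[THEN conjunct1]]
  have "(?g has_sum obs_entropy M \<xi>) (\<xi> ` space M)" unfolding gi[THEN conjunct2] .
  also have "?this \<longleftrightarrow> (?g has_sum obs_entropy M \<xi>) I"
  proof (rule has_sum_cong_neutral)
    fix v assume "v \<in> I - \<xi> ` space M"
    then have "{x\<in>space M. \<xi> x = v} = {}" by auto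
    then show "?g v = 0" by (simp only: measure_empty)
  qed (use assms(2) in auto)
  finally show ?thesis .
qed

lemma finite_entropyI_summable:
  assumes "observable M \<xi>"
    "(\<lambda>v. law \<xi> v * ln (law \<xi> v)) summable_on (\<xi> ` space M)"
  shows "finite_entropy M \<xi>"
proof -
  let ?g = "\<lambda>v. - (law \<xi> v * ln (law \<xi> v))"
  have i: "integrable (count_space (\<xi> ` space M)) ?g"
    using summable_on_imp_integrable_count_space[OF assms(2)] by (rule Bochner_Integration.integrable_minus)
  have "(\<integral>\<^sup>+v. ennreal (?g v) \<partial>count_space (\<xi> ` space M)) = ennreal (\<integral>v. ?g v \<partial>count_space (\<xi> ` space M))"
    by (intro nn_integral_eq_integral[OF i] AE_I2 neg_prob_ln_nonneg)
  then have "(\<integral>\<^sup>+x. ennreal (- ln (cell_prob M \<xi> x)) \<partial>M) < \<infinity>"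
    unfolding nn_integral_info[OF assms(1)] by (simp only: ennreal_less_top infinity_ennreal_def)
  then have "integrable M (\<lambda>x. - ln (cell_prob M \<xi> x))"
    by (intro integrableI_nonneg info_measurable assms(1) AE_I2 info_nonneg)
  then show ?thesis using assms(1) by (simp add: finite_entropy_def)
qed

text \<open>The constant comes from \<open>- q ln q \<le> 2 sqrt q\<close> and \<open>- (1 - q) ln (1 - q) \<le> q \<le> sqrt q\<close>; any bound
  tending to 0 with \<open>q\<close> would serve.\<close>

lemma obs_entropy_event_le:
  assumes "D \<in> sets M" shows "obs_entropy M (\<lambda>x. x \<in> D) \<le> 3 * sqrt (prob D)"
    and "finite_entropy M (\<lambda>x. x \<in> D)"
proof -
  have c: "{x\<in>space M. x \<in> D} = D" "{x\<in>space M. x \<notin> D} = space M - D"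
    using sets.sets_into_space[OF assms] by auto
  have "{x\<in>space M. (x \<in> D) = v} \<in> sets M" for v using assms by (cases v) (auto simp: c)
  moreover have "finite ((\<lambda>x. x \<in> D) ` space M)" by (rule finite_subset[of _ UNIV]) auto
  ultimately show f: "finite_entropy M (\<lambda>x. x \<in> D)"
    by (intro finite_entropy_finite_range) (auto simp: observable_def intro: countable_finite)
  define q where "q = prob D"
  have q: "0 \<le> q" "q \<le> 1" by (auto simp: q_def)
  have "((\<lambda>v. - (prob {x\<in>space M. (x \<in> D) = v} * ln (prob {x\<in>space M. (x \<in> D) = v}))) has_sum obs_entropy M (\<lambda>x. x \<in> D)) {True, False}"
    by (rule obs_entropy_has_sum[OF f]) auto
  then have H: "obs_entropy M (\<lambda>x. x \<in> D) = - (q * ln q) - (1 - q) * ln (1 - q)"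
    by (subst (asm) has_sum_finite_iff) (auto simp: c prob_compl[OF assms] q_def)
  have "- (q * ln q) \<le> 2 * sqrt q"
  proof (cases "q = 0")
    case False
    then have p: "0 < sqrt q" using q by simp
    have "ln (1 / sqrt q) \<le> 1 / sqrt q - 1" using p by (intro ln_le_minus_one) simp
    then have "- ln (sqrt q) \<le> 1 / sqrt q" using p by (simp add: ln_div)
    then have "q * (- ln q) \<le> q * (2 / sqrt q)"
      using q False by (intro mult_left_mono) (auto simp: ln_sqrt)
    also have "\<dots> = 2 * sqrt q" using q False by (simp add: field_simps)
    finally show ?thesis by simp
  qed simp
  moreover have "- ((1 - q) * ln (1 - q)) \<le> q"
  proof (cases "q = 1")
    case False
    then have p: "0 < 1 - q" using q by simp
    have "ln (1 / (1 - q)) \<le> 1 / (1 - q) - 1" using p by (intro ln_le_minus_one) simp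
    then have "- ln (1 - q) \<le> 1 / (1 - q) - 1" using p by (simp add: ln_div)
    then have "(1 - q) * (- ln (1 - q)) \<le> (1 - q) * (1 / (1 - q) - 1)"
      using p by (intro mult_left_mono) auto
    also have "\<dots> = q" using p by (simp add: field_simps)
    finally show ?thesis by simp
  qed simp
  moreover have "sqrt q * sqrt q \<le> 1 * sqrt q"
    using q by (intro mult_right_mono) auto
  ultimately show "obs_entropy M (\<lambda>x. x \<in> D) \<le> 3 * sqrt (prob D)"
    using q H by (simp add: q_def)
qed

text \<open>If \<open>\<zeta>\<close> determines an event \<open>A\<close> close to \<open>B\<close>, then given \<open>A\<close> it remains to decide membership in the
  symmetric difference, an event of small probability and therefore of small entropy.\<close>

lemma cond_entropy_event_le:
  assumes "A \<in> sets M" "B \<in> sets M" "finite_entropy M \<zeta>" "finer M \<zeta> (\<lambda>x. x \<in> A)"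
  shows "cond_entropy M (\<lambda>x. x \<in> B) \<zeta> \<le> 3 * sqrt (prob ((A - B) \<union> (B - A)))"
proof -
  let ?D = "(A - B) \<union> (B - A)"
  have D: "?D \<in> sets M" using assms by auto
  have "cond_entropy M (\<lambda>x. x \<in> B) \<zeta> \<le> cond_entropy M (\<lambda>x. x \<in> B) (\<lambda>x. x \<in> A)"
    using assms by (intro cond_entropy_antimono obs_entropy_event_le)
  also have "\<dots> = cond_entropy M (\<lambda>x. x \<in> ?D) (\<lambda>x. x \<in> A)"
    unfolding cond_entropy_def
    by (rule arg_cong2[where f="(-)"], rule obs_entropy_cong) (auto simp: finer_def)
  also have "\<dots> \<le> obs_entropy M (\<lambda>x. x \<in> ?D)"
    using assms D by (intro cond_entropy_le obs_entropy_event_le)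
  also have "\<dots> \<le> 3 * sqrt (prob ?D)" by (rule obs_entropy_event_le[OF D])
  finally show ?thesis .
qed

text \<open>Finitely many labels already carry almost all of the entropy; the others are lumped together in
  the label \<open>None\<close>.\<close>

lemma finite_coarsening:
  assumes "finite_entropy M \<beta>" "0 < \<epsilon>"
  obtains V where "finite V" "V \<subseteq> \<beta> ` space M" 
    "cond_entropy M \<beta> (\<lambda>x. if \<beta> x \<in> V then Some (\<beta> x) else None) < \<epsilon>"
proof -
  let ?g = "\<lambda>v. - (prob {x\<in>space M. \<beta> x = v} * ln (prob {x\<in>space M. \<beta> x = v}))"
  have "(?g has_sum obs_entropy M \<beta>) (\<beta> ` space M)" by (rule obs_entropy_has_sum[OF assms(1)]) simp
  from has_sum_finite_approximation[OF this, of "\<epsilon> / 2"] assms(2)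
  obtain V where V: "finite V" "V \<subseteq> \<beta> ` space M" "dist (sum ?g V) (obs_entropy M \<beta>) \<le> \<epsilon> / 2"
    by (meson half_gt_zero)
  define \<beta>V where "\<beta>V x = (if \<beta> x \<in> V then Some (\<beta> x) else None)" for x
  have fV: "finite_entropy M \<beta>V" using assms(1) by (rule finite_entropy_finer) (simp add: finer_def \<beta>V_def)
  let ?h = "\<lambda>v. - (prob {x\<in>space M. \<beta>V x = v} * ln (prob {x\<in>space M. \<beta>V x = v}))"
  have "(?h has_sum obs_entropy M \<beta>V) (insert None (Some ` V))"
    by (rule obs_entropy_has_sum[OF fV]) (auto simp: \<beta>V_def)
  then have "obs_entropy M \<beta>V = sum ?h (insert None (Some ` V))"
    using V(1) by (subst (asm) has_sum_finite_iff) auto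
  also have "\<dots> = ?h None + (\<Sum>v\<in>V. ?h (Some v))"
    using V(1) by (subst sum.insert) (auto simp: sum.reindex)
  also have "(\<Sum>v\<in>V. ?h (Some v)) = sum ?g V"
  proof (rule sum.cong)
    fix v assume "v \<in> V"
    then have "{x\<in>space M. \<beta>V x = Some v} = {x\<in>space M. \<beta> x = v}" by (auto simp: \<beta>V_def)
    then show "?h (Some v) = ?g v" by simp
  qed simp
  finally have "sum ?g V \<le> obs_entropy M \<beta>V" using neg_prob_ln_nonneg by simp
  moreover have "obs_entropy M (\<lambda>x. (\<beta> x, \<beta>V x)) = obs_entropy M \<beta>"
    by (rule obs_entropy_cong) (simp_all add: finer_def \<beta>V_def)
  ultimately have "cond_entropy M \<beta> \<beta>V < \<epsilon>"
    using V(3) assms(2) unfolding cond_entropy_def dist_real_def by linarith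
  with V show ?thesis unfolding \<beta>V_def by (intro that)
qed

text \<open>This replaces martingale convergence: a finite coarsening of \<open>\<beta>\<close> loses little entropy, and each of
  its finitely many cells is nearly determined by some \<open>C n\<close>.\<close>

lemma cond_entropy_to_0:
  fixes C :: "nat \<Rightarrow> 'a \<Rightarrow> 'c"
  assumes \<beta>: "finite_entropy M \<beta>" and C: "\<And>n. finite_entropy M (C n)"
    and mono: "\<And>m n. m \<le> n \<Longrightarrow> finer M (C n) (C m)"
    and approx: "\<And>v \<epsilon>. 0 < \<epsilon> \<Longrightarrow> \<exists>n. \<exists>A\<in>sets M. finer M (C n) (\<lambda>x. x \<in> A) \<and>
       prob ((A - {x\<in>space M. \<beta> x = v}) \<union> ({x\<in>space M. \<beta> x = v} - A)) < \<epsilon>"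
    and "0 < \<epsilon>"
  shows "\<exists>n. cond_entropy M \<beta> (C n) < \<epsilon>"
proof -
  have "0 < \<epsilon> / 2" using assms(5) by simp
  with \<beta> obtain V where V: "finite V" "V \<subseteq> \<beta> ` space M"
    "cond_entropy M \<beta> (\<lambda>x. if \<beta> x \<in> V then Some (\<beta> x) else None) < \<epsilon> / 2"
    by (rule finite_coarsening)
  define \<beta>V where "\<beta>V x = (if \<beta> x \<in> V then Some (\<beta> x) else None)" for x
  define E where "E v = {x\<in>space M. \<beta> x = v}" for v
  have E: "E v \<in> sets M" for v using finite_entropy_observable[OF \<beta>] by (simp add: E_def observable_def)
  \<comment> \<open>the \<open>+ 1\<close> keeps the share positive and the total strictly below \<open>\<epsilon> / 2\<close>\<close>
  define \<delta> where "\<delta> = \<epsilon> / (2 * (real (card V) + 1))"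
  have \<delta>: "0 < \<delta>" using \<open>0 < \<epsilon>\<close> by (simp add: \<delta>_def)
  have "\<exists>n. \<exists>A\<in>sets M. finer M (C n) (\<lambda>x. x \<in> A) \<and> prob ((A - E v) \<union> (E v - A)) < (\<delta> / 3)\<^sup>2" for v
    unfolding E_def using \<delta> by (intro approx) simp
  then obtain N A where N: "\<And>v. A v \<in> sets M" "\<And>v. finer M (C (N v)) (\<lambda>x. x \<in> A v)"
    "\<And>v. prob ((A v - E v) \<union> (E v - A v)) < (\<delta> / 3)\<^sup>2" by metis
  \<comment> \<open>one radius that works for all cells kept in the coarsening\<close>
  define n where "n = Max (insert 0 (N ` V))"
  have each: "cond_entropy M (\<lambda>x. x \<in> E v) (C n) \<le> \<delta>" if "v \<in> V" for v
  proof -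
    have "N v \<le> n" using that V(1) by (simp add: n_def)
    then have "finer M (C n) (\<lambda>x. x \<in> A v)" using mono N(2) unfolding finer_def by blast
    then have "cond_entropy M (\<lambda>x. x \<in> E v) (C n) \<le> 3 * sqrt (prob ((A v - E v) \<union> (E v - A v)))"
      by (intro cond_entropy_event_le N E C)
    also have "\<dots> \<le> 3 * sqrt ((\<delta> / 3)\<^sup>2)"
      using N(3)[of v] by (intro mult_left_mono real_sqrt_le_mono) auto
    also have "\<dots> = \<delta>" using \<delta> by simp
    finally show ?thesis .
  qed
  have fV: "finite_entropy M \<beta>V" using \<beta> by (rule finite_entropy_finer) (simp add: finer_def \<beta>V_def)
  have fE: "finite_entropy M (\<lambda>x. \<lambda>v\<in>V. x \<in> E v)"
    using V(1) E by (intro finite_entropy_restrict obs_entropy_event_le)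
  have "cond_entropy M \<beta>V (C n) \<le> cond_entropy M (\<lambda>x. \<lambda>v\<in>V. x \<in> E v) (C n)"
  proof (rule cond_entropy_mono[OF fE C])
    show "finer M (\<lambda>x. \<lambda>v\<in>V. x \<in> E v) \<beta>V"
    proof (rule finerI)
      fix x x' assume x: "x \<in> space M" "x' \<in> space M" and eq: "(\<lambda>v\<in>V. x \<in> E v) = (\<lambda>v\<in>V. x' \<in> E v)"
      have "\<beta> x = v \<longleftrightarrow> \<beta> x' = v" if "v \<in> V" for v
        using fun_cong[OF eq, of v] that x by (simp add: E_def)
      from this[of "\<beta> x"] this[of "\<beta> x'"] show "\<beta>V x = \<beta>V x'"
        unfolding \<beta>V_def by (cases "\<beta> x \<in> V"; cases "\<beta> x' \<in> V") simp_all
    qed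
  qed
  also have "\<dots> \<le> (\<Sum>v\<in>V. cond_entropy M (\<lambda>x. x \<in> E v) (C n))"
    using V(1) E C by (intro cond_entropy_restrict_le obs_entropy_event_le)
  also have "\<dots> \<le> (\<Sum>v\<in>V. \<delta>)" by (intro sum_mono each)
  also have "\<dots> < \<epsilon> / 2" using \<open>0 < \<epsilon>\<close> by (simp add: \<delta>_def field_simps)
  finally have 1: "cond_entropy M \<beta>V (C n) < \<epsilon> / 2" .
  have "cond_entropy M \<beta> (C n) \<le> cond_entropy M \<beta> (\<lambda>x. (\<beta>V x, C n x)) + cond_entropy M \<beta>V (C n)"
  proof -
    have "finer M (\<lambda>x. (\<beta> x, \<beta>V x, C n x)) (\<lambda>x. (\<beta> x, C n x))" by (simp add: finer_def)
    from obs_entropy_mono[OF finite_entropy_Pair[OF \<beta> finite_entropy_Pair[OF fV C]] this]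
    show ?thesis unfolding cond_entropy_def by simp
  qed
  also have "cond_entropy M \<beta> (\<lambda>x. (\<beta>V x, C n x)) \<le> cond_entropy M \<beta> \<beta>V"
    by (intro cond_entropy_antimono \<beta> finite_entropy_Pair fV C) (simp add: finer_def)
  finally show ?thesis using 1 V(3) unfolding \<beta>V_def by (intro exI[of _ n]) linarith
qed

end

lemma (in prob_space) prob_split_has_sum:
  assumes "observable M \<xi>" "A \<in> sets M" "\<xi> ` space M \<subseteq> I"
  shows "((\<lambda>v. prob {x\<in>A. \<xi> x = v}) has_sum prob A) I"
proof -
  let ?g = "\<lambda>v. prob {x\<in>A. \<xi> x = v}"
  have "(\<integral>\<^sup>+v. ennreal (?g v) \<partial>count_space (\<xi> ` space M)) = ennreal (prob A)"
    using emeasure_split_observable[OF assms(1,2)] by (simp add: emeasure_eq_measure)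
  moreover have "(\<integral>\<^sup>+v. ennreal (?g v) \<partial>count_space (\<xi> ` space M)) = ennreal (prob A)
     \<longleftrightarrow> integrable (count_space (\<xi> ` space M)) ?g \<and> integral\<^sup>L (count_space (\<xi> ` space M)) ?g = prob A"
    by (intro nn_integral_eq_integrable AE_I2 measure_nonneg) simp
  ultimately have gi: "integrable (count_space (\<xi> ` space M)) ?g \<and> integral\<^sup>L (count_space (\<xi> ` space M)) ?g = prob A"
    by (rule rev_iffD1)
  from integrable_count_space_has_sum[OF gi[THEN conjunct1]]
  have "(?g has_sum prob A) (\<xi> ` space M)" unfolding gi[THEN conjunct2] .
  also have "?this \<longleftrightarrow> (?g has_sum prob A) I"
  proof (rule has_sum_cong_neutral)
    fix v assume "v \<in> I - \<xi> ` space M"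
    then have "{x\<in>A. \<xi> x = v} = {}" using sets.sets_into_space[OF assms(2)] by auto
    then show "?g v = 0" by (simp only: measure_empty)
  qed (use assms(3) in auto)
  finally show ?thesis .
qed

section \<open>Partitions as fibres of observables\<close>

definition fibres :: "'x measure \<Rightarrow> ('x \<Rightarrow> 'a) \<Rightarrow> 'x set set" where
  "fibres M \<xi> = (\<lambda>x. {x'\<in>space M. \<xi> x' = \<xi> x}) ` space M"

lemma fibres_alt: "fibres M \<xi> = (\<lambda>v. {x\<in>space M. \<xi> x = v}) ` (\<xi> ` space M)"
  unfolding fibres_def image_image ..

text \<open>Transfers between the sums of extended nonnegative reals in the definition of partition entropy and
  real sums.\<close>

lemma infsum_ennreal_nonneg:
  fixes g :: "'a \<Rightarrow> real"
  assumes "\<And>v. 0 \<le> g v"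
  shows "g summable_on A \<Longrightarrow> (\<Sum>\<^sub>\<infinity>v\<in>A. ennreal (g v)) = ennreal (\<Sum>\<^sub>\<infinity>v\<in>A. g v)"
    and "(\<Sum>\<^sub>\<infinity>v\<in>A. ennreal (g v)) < \<infinity> \<Longrightarrow> g summable_on A"
proof -
  have e: "(\<Sum>\<^sub>\<infinity>v\<in>A. ennreal (g v)) = (SUP F\<in>{F. finite F \<and> F \<subseteq> A}. ennreal (sum g F))"
    using assms by (subst nonneg_infsum_complete) (auto simp: sum_ennreal)
  show "(\<Sum>\<^sub>\<infinity>v\<in>A. ennreal (g v)) = ennreal (\<Sum>\<^sub>\<infinity>v\<in>A. g v)" if "g summable_on A"
    unfolding e using that assms by (intro infsum_nonneg_is_SUPREMUM_ennreal[symmetric]) auto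
  assume fin: "(\<Sum>\<^sub>\<infinity>v\<in>A. ennreal (g v)) < \<infinity>"
  then obtain b where b: "(\<Sum>\<^sub>\<infinity>v\<in>A. ennreal (g v)) = ennreal b" "0 \<le> b"
    by (cases "\<Sum>\<^sub>\<infinity>v\<in>A. ennreal (g v)") auto
  have "sum g F \<le> b" if "finite F" "F \<subseteq> A" for F
  proof -
    have "ennreal (sum g F) \<le> ennreal b" unfolding b(1)[symmetric] e using that by (intro SUP_upper) auto
    then show ?thesis using b(2) by (simp add: ennreal_le_iff)
  qed
  then show "g summable_on A" using assms by (intro nonneg_bdd_above_summable_on) (auto intro!: bdd_aboveI)
qed

context prob_space
begin

lemma partition_entropy_fibres_infsum:
  "partition_entropy M (fibres M \<xi>) = enn2ereal (\<Sum>\<^sub>\<infinity>v\<in>\<xi> ` space M.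
     ennreal (- (law \<xi> v * ln (law \<xi> v))))"
proof -
  have "inj_on (\<lambda>v. {x\<in>space M. \<xi> x = v}) (\<xi> ` space M)"
    by (rule inj_onI) blast
  then show ?thesis unfolding partition_entropy_def fibres_alt by (subst infsum_reindex) (auto simp: o_def)
qed

lemma partition_entropy_fibres:
  assumes "finite_entropy M \<xi>" shows "partition_entropy M (fibres M \<xi>) = ereal (obs_entropy M \<xi>)"
proof -
  let ?g = "\<lambda>v. - (law \<xi> v * ln (law \<xi> v))"
  have h: "(?g has_sum obs_entropy M \<xi>) (\<xi> ` space M)" by (rule obs_entropy_has_sum[OF assms order_refl])
  have "(\<Sum>\<^sub>\<infinity>v\<in>\<xi> ` space M. ennreal (?g v)) = ennreal (obs_entropy M \<xi>)"
    unfolding infsumI[OF h, symmetric]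
    by (rule infsum_ennreal_nonneg(1)[OF neg_prob_ln_nonneg]) (rule has_sum_imp_summable[OF h])
  then show ?thesis
    unfolding partition_entropy_fibres_infsum by (simp only: enn2ereal_ennreal[OF obs_entropy_nonneg])
qed

lemma finite_entropy_if_partition_entropy_finite:
  assumes "observable M \<xi>" "partition_entropy M (fibres M \<xi>) < \<infinity>" shows "finite_entropy M \<xi>"
proof (rule finite_entropyI_summable[OF assms(1)])
  let ?g = "\<lambda>v. - (law \<xi> v * ln (law \<xi> v))"
  have "enn2ereal (\<Sum>\<^sub>\<infinity>v\<in>\<xi> ` space M. ennreal (?g v)) < \<infinity>"
    using assms(2) unfolding partition_entropy_fibres_infsum .
  then have "(\<Sum>\<^sub>\<infinity>v\<in>\<xi> ` space M. ennreal (?g v)) < \<infinity>"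
    by (cases "\<Sum>\<^sub>\<infinity>v\<in>\<xi> ` space M. ennreal (?g v)") auto
  then have "?g summable_on \<xi> ` space M" by (rule infsum_ennreal_nonneg(2)[OF neg_prob_ln_nonneg])
  then show "(\<lambda>v. law \<xi> v * ln (law \<xi> v)) summable_on \<xi> ` space M"
    by (simp only: summable_on_uminus)
qed

end

text \<open>Every partition is the fibre partition of the observable that sends a point to its cell.\<close>

definition cell_of :: "'x set set \<Rightarrow> 'x \<Rightarrow> 'x set" where
  "cell_of \<alpha> x = (THE A. A \<in> \<alpha> \<and> x \<in> A)"

lemma cell_of_eq:
  assumes "partition_on \<Omega> \<alpha>" "A \<in> \<alpha>" "x \<in> A" shows "cell_of \<alpha> x = A"
  unfolding cell_of_def
proof (rule the_equality)
  fix B assume "B \<in> \<alpha> \<and> x \<in> B"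
  then show "B = A" using assms partition_onD2[OF assms(1)] unfolding disjoint_def by blast
qed (use assms in blast)

lemma fibres_cell_of:
  assumes "measurable_partition M \<alpha>"
  shows "fibres M (cell_of \<alpha>) = \<alpha>" "observable M (cell_of \<alpha>)"
proof -
  have p: "partition_on (space M) \<alpha>" "countable \<alpha>" "\<alpha> \<subseteq> sets M"
    using assms by (auto simp: measurable_partition_def)
  have sub: "A \<subseteq> space M" if "A \<in> \<alpha>" for A using partition_onD1[OF p(1)] that by blast
  have im: "cell_of \<alpha> ` space M = \<alpha>"
  proof (rule equalityI; rule subsetI)
    fix A assume "A \<in> cell_of \<alpha> ` space M"
    then obtain x where x: "x \<in> space M" "A = cell_of \<alpha> x" by blast
    then obtain B where "B \<in> \<alpha>" "x \<in> B" using partition_onD1[OF p(1)] by blast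
    then show "A \<in> \<alpha>" using cell_of_eq[OF p(1)] x by metis
  next
    fix A assume A: "A \<in> \<alpha>"
    then obtain x where x: "x \<in> A" using partition_onD3[OF p(1)] by (metis ex_in_conv)
    then have "A = cell_of \<alpha> x" "x \<in> space M" using cell_of_eq[OF p(1) A x] sub[OF A] by auto
    then show "A \<in> cell_of \<alpha> ` space M" by blast
  qed
  have fib: "{x\<in>space M. cell_of \<alpha> x = A} = A" if A: "A \<in> \<alpha>" for A
  proof (rule equalityI; rule subsetI)
    fix x assume x: "x \<in> {x\<in>space M. cell_of \<alpha> x = A}"
    then obtain B where B: "B \<in> \<alpha>" "x \<in> B" using partition_onD1[OF p(1)] by blast
    then show "x \<in> A" using cell_of_eq[OF p(1) B] x by simp
  next
    fix x assume "x \<in> A"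
    then show "x \<in> {x\<in>space M. cell_of \<alpha> x = A}" using cell_of_eq[OF p(1) A] sub[OF A] by auto
  qed
  show "fibres M (cell_of \<alpha>) = \<alpha>" unfolding fibres_alt im using fib by (simp cong: image_cong)
  show "observable M (cell_of \<alpha>)" unfolding observable_def
  proof (intro conjI allI)
    show "countable (cell_of \<alpha> ` space M)" unfolding im by (rule p(2))
    fix A
    show "{x\<in>space M. cell_of \<alpha> x = A} \<in> sets M"
    proof (cases "A \<in> \<alpha>")
      case True
      then show ?thesis using fib p(3) by auto
    next
      case False
      then have "{x\<in>space M. cell_of \<alpha> x = A} = {}" using im by blast
      then show ?thesis by (simp only: sets.empty_sets)
    qed
  qed
qed

lemma measurable_partition_fibres:
  assumes "observable M \<xi>" shows "measurable_partition M (fibres M \<xi>)"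
  unfolding measurable_partition_def
proof (intro conjI)
  show "partition_on (space M) (fibres M \<xi>)"
    by (rule partition_onI) (auto simp: fibres_def disjnt_def)
  show "countable (fibres M \<xi>)" unfolding fibres_alt using assms by (auto simp: observable_def)
  show "fibres M \<xi> \<subseteq> sets M" unfolding fibres_alt using assms by (auto simp: observable_def)
qed

lemma pullback_fibres:
  assumes "\<And>x. x \<in> space M \<Longrightarrow> h x \<in> space M"
  shows "pullback M h (fibres M \<xi>) = fibres M (\<lambda>x. \<xi> (h x))"
proof (rule equalityI; rule subsetI)
  fix A assume "A \<in> pullback M h (fibres M \<xi>)"
  then obtain x0 where A: "A = h -` {x'\<in>space M. \<xi> x' = \<xi> x0} \<inter> space M" "A \<noteq> {}"
    unfolding pullback_def fibres_def by blast
  then obtain x where x: "x \<in> space M" "\<xi> (h x) = \<xi> x0" by blast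
  then have "A = {x'\<in>space M. \<xi> (h x') = \<xi> (h x)}" using A(1) assms by auto
  then show "A \<in> fibres M (\<lambda>x. \<xi> (h x))" unfolding fibres_def using x(1) by blast
next
  fix A assume "A \<in> fibres M (\<lambda>x. \<xi> (h x))"
  then obtain x where x: "x \<in> space M" "A = {x'\<in>space M. \<xi> (h x') = \<xi> (h x)}"
    unfolding fibres_def by blast
  then have "A = h -` {x'\<in>space M. \<xi> x' = \<xi> (h x)} \<inter> space M" "x \<in> A" using assms by auto
  moreover have "{x'\<in>space M. \<xi> x' = \<xi> (h x)} \<in> fibres M \<xi>" unfolding fibres_def using assms[OF x(1)] by blast
  ultimately show "A \<in> pullback M h (fibres M \<xi>)" unfolding pullback_def by blast
qed

text \<open>The right-hand side is the fibre partition of the joint observable, whatever encoding is chosen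
  for the joint label.\<close>

lemma common_refinement_fibres:
  fixes \<xi> :: "'j \<Rightarrow> 'x \<Rightarrow> 'a"
  assumes "J \<noteq> {}"
  shows "common_refinement ((\<lambda>j. fibres M (\<xi> j)) ` J) = (\<lambda>x. {x'\<in>space M. \<forall>j\<in>J. \<xi> j x' = \<xi> j x}) ` space M"
proof (rule equalityI; rule subsetI)
  let ?P = "(\<lambda>j. fibres M (\<xi> j)) ` J"
  fix A assume "A \<in> common_refinement ?P"
  then obtain f where f: "\<And>Q. Q \<in> ?P \<Longrightarrow> f Q \<in> Q" "A = \<Inter> (f ` ?P)" "A \<noteq> {}"
    unfolding common_refinement by (auto simp: Pi_iff)
  from f(3) obtain x where x: "x \<in> A" by blast
  have fj: "f (fibres M (\<xi> j)) = {x'\<in>space M. \<xi> j x' = \<xi> j x} \<and> x \<in> space M" if "j \<in> J" for j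
  proof -
    have "f (fibres M (\<xi> j)) \<in> fibres M (\<xi> j)" using f(1) that by blast
    then obtain x0 where "f (fibres M (\<xi> j)) = {x'\<in>space M. \<xi> j x' = \<xi> j x0}" unfolding fibres_def by blast
    moreover have "x \<in> f (fibres M (\<xi> j))" using x f(2) that by blast
    ultimately show ?thesis by auto
  qed
  have "x \<in> space M" using fj assms by blast
  moreover have "A = {x'\<in>space M. \<forall>j\<in>J. \<xi> j x' = \<xi> j x}"
  proof -
    have "A = (\<Inter>j\<in>J. f (fibres M (\<xi> j)))" unfolding f(2) image_image ..
    also have "\<dots> = (\<Inter>j\<in>J. {x'\<in>space M. \<xi> j x' = \<xi> j x})" by (rule INF_cong[OF refl]) (use fj in blast)
    also have "\<dots> = {x'\<in>space M. \<forall>j\<in>J. \<xi> j x' = \<xi> j x}" using assms by blast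
    finally show ?thesis .
  qed
  ultimately show "A \<in> (\<lambda>x. {x'\<in>space M. \<forall>j\<in>J. \<xi> j x' = \<xi> j x}) ` space M" by blast
next
  let ?P = "(\<lambda>j. fibres M (\<xi> j)) ` J"
  fix A assume "A \<in> (\<lambda>x. {x'\<in>space M. \<forall>j\<in>J. \<xi> j x' = \<xi> j x}) ` space M"
  then obtain x where x: "x \<in> space M" "A = {x'\<in>space M. \<forall>j\<in>J. \<xi> j x' = \<xi> j x}" by blast
  define f where "f Q = (SOME B. B \<in> Q \<and> x \<in> B)" for Q :: "'x set set"
  have fj: "f (fibres M (\<xi> j)) = {x'\<in>space M. \<xi> j x' = \<xi> j x}" if "j \<in> J" for j
    unfolding f_def
  proof (rule some_equality)
    show "{x'\<in>space M. \<xi> j x' = \<xi> j x} \<in> fibres M (\<xi> j) \<and> x \<in> {x'\<in>space M. \<xi> j x' = \<xi> j x}"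
      unfolding fibres_def using x(1) by blast
    fix B assume "B \<in> fibres M (\<xi> j) \<and> x \<in> B"
    then show "B = {x'\<in>space M. \<xi> j x' = \<xi> j x}" unfolding fibres_def by auto
  qed
  have "A = (\<Inter>j\<in>J. {x'\<in>space M. \<xi> j x' = \<xi> j x})" unfolding x(2) using assms by blast
  also have "\<dots> = (\<Inter>j\<in>J. f (fibres M (\<xi> j)))" by (rule INF_cong[OF refl]) (use fj in blast)
  also have "\<dots> = \<Inter> (f ` ?P)" unfolding image_image ..
  finally have "A = \<Inter> (f ` ?P)" .
  moreover have "f \<in> (\<Pi> P\<in>?P. P)"
  proof (rule Pi_I)
    fix Q assume "Q \<in> ?P"
    then obtain j where "j \<in> J" "Q = fibres M (\<xi> j)" by blast
    then show "f Q \<in> Q" using fj[of j] x(1) unfolding fibres_def by auto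
  qed
  moreover have "A \<noteq> {}" using x by blast
  ultimately show "A \<in> common_refinement ?P" unfolding common_refinement by blast
qed

lemma fibres_cong:
  assumes "finer M \<xi> \<eta>" "finer M \<eta> \<xi>" shows "fibres M \<xi> = fibres M \<eta>"
  unfolding fibres_def
proof (rule image_cong[OF refl])
  fix x assume x: "x \<in> space M"
  show "{x'\<in>space M. \<xi> x' = \<xi> x} = {x'\<in>space M. \<eta> x' = \<eta> x}"
    using finer_cell_subset[OF assms(1) x] finer_cell_subset[OF assms(2) x] by (rule equalityI)
qed

lemma common_refinement_two_fibres:
  fixes \<xi> \<eta> :: "'x \<Rightarrow> 'a"
  shows "common_refinement {fibres M \<xi>, fibres M \<eta>} = fibres M (\<lambda>x. (\<xi> x, \<eta> x))"
proof -
  have "{fibres M \<xi>, fibres M \<eta>} = (\<lambda>b. fibres M (if b then \<xi> else \<eta>)) ` UNIV"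
    by (auto simp: UNIV_bool)
  then show ?thesis
    by (simp only: common_refinement_fibres[of UNIV] UNIV_not_empty not_False_eq_True)
       (auto simp: fibres_def UNIV_bool intro!: image_cong)
qed

section \<open>Reduced words\<close>

text \<open>A letter \<open>(i, True)\<close> is the \<open>i\<close>-th generator and \<open>(i, False)\<close> its inverse.\<close>

type_synonym letter = "nat \<times> bool"

definition inv_letter :: "letter \<Rightarrow> letter" where
  "inv_letter a = (fst a, \<not> snd a)"

definition reduced_word :: "letter list \<Rightarrow> bool" where
  "reduced_word w \<longleftrightarrow> successively (\<lambda>a b. a \<noteq> inv_letter b) w"

definition word_ball_over :: "letter set \<Rightarrow> nat \<Rightarrow> letter list set" where
  "word_ball_over L n = {w \<in> lists L. reduced_word w \<and> length w \<le> n}"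

definition prefix_closed :: "'b list set \<Rightarrow> bool" where
  "prefix_closed W \<longleftrightarrow> (\<forall>w a. w @ [a] \<in> W \<longrightarrow> w \<in> W)"

lemma finite_word_ball_over: "finite L \<Longrightarrow> finite (word_ball_over L n)"
  by (rule finite_subset[OF _ finite_lists_length_le[of L n]]) (auto simp: word_ball_over_def)

lemma word_ball_over_mono: "m \<le> n \<Longrightarrow> word_ball_over L m \<subseteq> word_ball_over L n"
  by (auto simp: word_ball_over_def)

lemma word_ball_over_subset: "word_ball_over L n \<subseteq> lists L"
  by (auto simp: word_ball_over_def)

lemma Nil_in_word_ball_over: "[] \<in> word_ball_over L n"
  by (simp add: word_ball_over_def reduced_word_def)

lemma prefix_closed_word_ball_over: "prefix_closed (word_ball_over L n)"
  by (auto simp: prefix_closed_def word_ball_over_def reduced_word_def successively_append_iff)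

lemma word_ball_over_0: "word_ball_over L 0 = {[]}"
  by (auto simp: word_ball_over_def reduced_word_def)

definition suffix_closed :: "'b list set \<Rightarrow> bool" where
  "suffix_closed W \<longleftrightarrow> (\<forall>w a. a # w \<in> W \<longrightarrow> w \<in> W)"

text \<open>In the left-Cayley graph, which is a tree, the words with suffix \<open>v\<close> form the branch hanging at
  \<open>v\<close>; so this says that \<open>W\<close> does not meet that branch.\<close>

definition avoids_suffix :: "'b list \<Rightarrow> 'b list set \<Rightarrow> bool" where
  "avoids_suffix v W \<longleftrightarrow> (\<forall>y. y @ v \<notin> W)"

lemma inv_letter_inv_letter [simp]: "inv_letter (inv_letter a) = a"
  by (simp add: inv_letter_def)

lemma inv_letter_neq [simp]: "inv_letter a \<noteq> a" "a \<noteq> inv_letter a"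
  by (auto simp: inv_letter_def prod_eq_iff)

lemma inv_letter_eq_iff: "fst a = fst b \<and> snd a \<noteq> snd b \<longleftrightarrow> a = inv_letter b"
  by (auto simp: inv_letter_def prod_eq_iff)

lemma reduced_Nil [simp]: "reduced_word []"
  by (simp add: reduced_word_def)

lemma reduced_single [simp]: "reduced_word [a]"
  by (simp add: reduced_word_def)

lemma reduced_Cons: "reduced_word (a # w) \<longleftrightarrow> reduced_word w \<and> (w \<noteq> [] \<longrightarrow> a \<noteq> inv_letter (hd w))"
  by (cases w) (auto simp: reduced_word_def successively_Cons)

lemma reduced_append:
  "reduced_word (u @ v) \<longleftrightarrow> reduced_word u \<and> reduced_word v \<and> (u \<noteq> [] \<longrightarrow> v \<noteq> [] \<longrightarrow> last u \<noteq> inv_letter (hd v))"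
  by (auto simp: reduced_word_def successively_append_iff)

lemma reduced_snoc: "reduced_word (w @ [a]) \<longleftrightarrow> reduced_word w \<and> (w \<noteq> [] \<longrightarrow> last w \<noteq> inv_letter a)"
  by (auto simp: reduced_append)

text \<open>Right multiplication by a letter on reduced words; \<open>cons_letter\<close> is left multiplication.\<close>

definition append_letter :: "letter \<Rightarrow> letter list \<Rightarrow> letter list" where
  "append_letter a w = (if w \<noteq> [] \<and> last w = inv_letter a then butlast w else w @ [a])"

definition cons_letter :: "letter \<Rightarrow> letter list \<Rightarrow> letter list" where
  "cons_letter a w = (if w \<noteq> [] \<and> hd w = inv_letter a then tl w else a # w)"

lemma reduced_append_letter: "reduced_word w \<Longrightarrow> reduced_word (append_letter a w)"
  by (cases w rule: rev_cases) (auto simp: append_letter_def reduced_snoc reduced_append reduced_Cons)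

lemma reduced_cons_letter: "reduced_word w \<Longrightarrow> reduced_word (cons_letter a w)"
  by (cases w) (auto simp: cons_letter_def reduced_Cons)

lemma length_append_letter: "length (append_letter a w) \<le> Suc (length w)"
  by (auto simp: append_letter_def)

lemma length_cons_letter: "length (cons_letter a w) \<le> Suc (length w)"
  by (auto simp: cons_letter_def)

lemma append_letter_snoc: "append_letter a (w @ [b]) = (if b = inv_letter a then w else w @ [b, a])"
  by (simp add: append_letter_def)

lemma inj_on_append_letter: "inj_on (append_letter a) {w. reduced_word w}"
proof (rule inj_onI)
  fix u v assume r: "u \<in> {w. reduced_word w}" "v \<in> {w. reduced_word w}" and e: "append_letter a u = append_letter a v"
  show "u = v"
  proof (cases u rule: rev_cases)
    case Nil
    then show ?thesis using r e
      by (cases v rule: rev_cases) (auto simp: append_letter_def reduced_snoc split: if_splits)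
  next
    case (snoc u' b)
    then show ?thesis using r e
      by (cases v rule: rev_cases) (auto simp: append_letter_def reduced_snoc split: if_splits)
  qed
qed

text \<open>Right multiplication commutes with the parent relation of the tree, except across the edge from
  \<open>[]\<close> to \<open>[inv_letter a]\<close>, whose direction it reverses.\<close>

lemma append_letter_Cons:
  assumes "u # w \<noteq> [inv_letter a]" "reduced_word (u # w)"
  shows "append_letter a (u # w) = u # append_letter a w"
  using assms by (cases "w = []") (auto simp: append_letter_def)

text \<open>Right multiplication is injective and carries branches to branches (away from the reversed edge),
  hence keeps sets outside the branch outside its image.\<close>

lemma avoids_suffix_append_letter:
  assumes W: "\<And>w. w \<in> W \<Longrightarrow> reduced_word w" and v: "reduced_word v" "v \<noteq> []" "v \<noteq> [inv_letter a]"
    and av: "avoids_suffix v W"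
  shows "avoids_suffix (append_letter a v) (append_letter a ` W)"
  unfolding avoids_suffix_def
proof (intro allI notI)
  fix y assume "y @ append_letter a v \<in> append_letter a ` W"
  then obtain w where w: "w \<in> W" "y @ append_letter a v = append_letter a w" by blast
  obtain u v' where uv: "v = u # v'" using v(2) by (cases v) auto
  have av': "append_letter a v = u # append_letter a v'" using append_letter_Cons v uv by blast
  have "reduced_word (y @ u # append_letter a v')"
    using reduced_append_letter[OF W[OF w(1)], of a] w(2) av' by simp
  then have yv: "reduced_word (y @ v)" using v(1) uv by (simp add: reduced_append)
  have "append_letter a (y @ v) = y @ append_letter a v"
    using v(2) by (auto simp: append_letter_def butlast_append)
  with w(2) have "append_letter a (y @ v) = append_letter a w" by simp
  then have "y @ v = w" using inj_on_append_letter yv W[OF w(1)] unfolding inj_on_def by blast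
  with av w(1) show False unfolding avoids_suffix_def by blast
qed

lemma longest_word:
  assumes "finite A" "A \<noteq> {}"
  obtains z where "z \<in> A" "\<And>w. w \<in> A \<Longrightarrow> length w \<le> length z"
  using finite_has_maximal[of "length ` A"] assms
  by (metis (no_types, lifting) Max_ge Max_in finite_imageI image_iff image_is_empty)

section \<open>Splittings and the independence of the generator\<close>

text \<open>Abstract setting for the comparison of generators: one measure-preserving map per letter. \<open>L\<close>
  contains all positive letters; it may contain none, some or all of the inverse letters.\<close>

locale letter_action = prob_space M for M :: "'x measure" +
  fixes r :: nat and L :: "letter set" and U :: "letter \<Rightarrow> 'x \<Rightarrow> 'x"
  assumes r_pos: "1 \<le> r"
    and positive_letters: "i \<in> {1..r} \<Longrightarrow> (i, True) \<in> L"
    and letters: "L \<subseteq> {1..r} \<times> UNIV"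
    and preserving: "a \<in> L \<Longrightarrow> preserves_measure M (U a)"
    and inverse_letter: "a \<in> L \<Longrightarrow> inv_letter a \<in> L \<Longrightarrow> x \<in> space M \<Longrightarrow> U (inv_letter a) (U a x) = x"
begin

text \<open>The word \<open>w\<close> acts by \<open>foldr U w\<close>, so the window over \<open>W\<close> is the join of the translates of \<open>\<xi>\<close> by
  the words of \<open>W\<close>.\<close>

definition window :: "('x \<Rightarrow> 'a) \<Rightarrow> letter list set \<Rightarrow> 'x \<Rightarrow> letter list \<Rightarrow> 'a" where
  "window \<xi> W = (\<lambda>x. \<lambda>w\<in>W. \<xi> (foldr U w x))"

definition F_obs :: "('x \<Rightarrow> 'a) \<Rightarrow> real" where
  "F_obs \<xi> = (1 - 2 * real r) * obs_entropy M \<xi> + (\<Sum>i=1..r. obs_entropy M (\<lambda>x. (\<xi> x, \<xi> (U (i, True) x))))"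

abbreviation "ball_window \<xi> n \<equiv> window \<xi> (word_ball_over L n)"

lemma finite_L: "finite L"
  using letters by (rule finite_subset) auto

lemma U_measurable: "a \<in> L \<Longrightarrow> U a \<in> M \<rightarrow>\<^sub>M M"
  using preserving by (simp add: preserves_measure_def)

lemma U_space: "a \<in> L \<Longrightarrow> x \<in> space M \<Longrightarrow> U a x \<in> space M"
  using U_measurable by (rule measurable_space)

lemma preserving_word: "w \<in> lists L \<Longrightarrow> preserves_measure M (foldr U w)"
proof (induction w)
  case Nil
  then show ?case by (simp add: preserves_measure_def id_def distr_id2)
next
  case (Cons a w)
  then have m: "U a \<in> M \<rightarrow>\<^sub>M M" "foldr U w \<in> M \<rightarrow>\<^sub>M M" "distr M M (U a) = M" "distr M M (foldr U w) = M"
    using preserving[of a] by (auto simp: preserves_measure_def)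
  have "distr M M (U a \<circ> foldr U w) = distr (distr M M (foldr U w)) M (U a)"
    using m by (intro distr_distr[symmetric]) auto
  with m measurable_comp[OF m(2,1)] show ?case
    unfolding preserves_measure_def foldr.simps by (simp only:)
qed

lemma word_space: "w \<in> lists L \<Longrightarrow> x \<in> space M \<Longrightarrow> foldr U w x \<in> space M"
  using preserving_word[of w] by (auto simp: preserves_measure_def dest: measurable_space)

lemma finite_entropy_U: "a \<in> L \<Longrightarrow> finite_entropy M \<xi> \<Longrightarrow> finite_entropy M (\<lambda>x. \<xi> (U a x))"
  by (rule finite_entropy_comp[OF preserving])

lemma finite_entropy_window:
  "finite W \<Longrightarrow> W \<subseteq> lists L \<Longrightarrow> finite_entropy M \<xi> \<Longrightarrow> finite_entropy M (window \<xi> W)"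
  unfolding window_def
  by (rule finite_entropy_restrict, assumption, rule finite_entropy_comp[OF preserving_word]) auto

lemma finer_comp_U:
  assumes "finer M \<xi> \<eta>" "a \<in> L" shows "finer M (\<lambda>x. \<xi> (U a x)) (\<lambda>x. \<eta> (U a x))"
  using finerD[OF assms(1)] U_space[OF assms(2)] by (intro finerI) blast

lemma window_eq_iff:
  "window \<xi> W x = window \<xi> W x' \<longleftrightarrow> (\<forall>w\<in>W. \<xi> (foldr U w x) = \<xi> (foldr U w x'))"
  unfolding window_def restrict_def fun_eq_iff by (simp cong: if_cong) metis

lemma finer_window_mono: "W \<subseteq> W' \<Longrightarrow> finer M (window \<xi> W') (window \<xi> W)"
  unfolding finer_def window_eq_iff by blast

lemma finer_window_member: "w \<in> W \<Longrightarrow> finer M (window \<xi> W) (\<lambda>x. \<xi> (foldr U w x))"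
  unfolding finer_def window_eq_iff by blast

lemma F_obs_cong:
  assumes "finer M \<xi> \<eta>" "finer M \<eta> \<xi>" shows "F_obs \<xi> = F_obs \<eta>"
proof -
  have "obs_entropy M (\<lambda>x. (\<xi> x, \<xi> (U (i, True) x))) = obs_entropy M (\<lambda>x. (\<eta> x, \<eta> (U (i, True) x)))" if "i \<in> {1..r}" for i
    using finer_comp_U[OF assms(1) positive_letters[OF that]] finer_comp_U[OF assms(2) positive_letters[OF that]] assms
    by (intro obs_entropy_cong) (unfold finer_def prod.inject, blast+)
  then show ?thesis unfolding F_obs_def obs_entropy_cong[OF assms]
    by (intro arg_cong2[where f="(+)"] sum.cong) simp_all
qed

text \<open>Both \<open>\<xi>\<close> and its translate cost at most \<open>H(\<xi> | \<eta>)\<close>, the latter because the map preserves the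
  measure.\<close>

lemma entropy_add_two:
  assumes "finite_entropy M \<xi>" "finite_entropy M \<eta>" "a \<in> L"
  shows "obs_entropy M (\<lambda>x. ((\<xi> x, \<eta> x), (\<xi> (U a x), \<eta> (U a x))))
    \<le> obs_entropy M (\<lambda>x. (\<eta> x, \<eta> (U a x))) + 2 * cond_entropy M \<xi> \<eta>"
proof -
  note f = finite_entropy_U[OF assms(3)]
  let ?\<eta>2 = "\<lambda>x. (\<eta> x, \<eta> (U a x))"
  have f2: "finite_entropy M ?\<eta>2" using assms f by (intro finite_entropy_Pair)
  have "cond_entropy M (\<lambda>x. (\<xi> x, \<xi> (U a x))) ?\<eta>2 \<le> cond_entropy M \<xi> ?\<eta>2 + cond_entropy M (\<lambda>x. \<xi> (U a x)) ?\<eta>2"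
    using assms f f2 by (intro cond_entropy_Pair_le)
  also have "cond_entropy M \<xi> ?\<eta>2 \<le> cond_entropy M \<xi> \<eta>"
    using assms f2 by (intro cond_entropy_antimono) (auto simp: finer_def)
  also have "cond_entropy M (\<lambda>x. \<xi> (U a x)) ?\<eta>2 \<le> cond_entropy M (\<lambda>x. \<xi> (U a x)) (\<lambda>x. \<eta> (U a x))"
    using assms f f2 by (intro cond_entropy_antimono) (auto simp: finer_def)
  also have "cond_entropy M (\<lambda>x. \<xi> (U a x)) (\<lambda>x. \<eta> (U a x)) = cond_entropy M \<xi> \<eta>"
    by (rule cond_entropy_comp[OF preserving[OF assms(3)] assms(1,2)[THEN finite_entropy_observable]])
  finally have "cond_entropy M (\<lambda>x. (\<xi> x, \<xi> (U a x))) ?\<eta>2 \<le> 2 * cond_entropy M \<xi> \<eta>" by simp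
  moreover have "obs_entropy M (\<lambda>x. ((\<xi> x, \<xi> (U a x)), (\<eta> x, \<eta> (U a x)))) = obs_entropy M (\<lambda>x. ((\<xi> x, \<eta> x), (\<xi> (U a x), \<eta> (U a x))))"
    by (rule obs_entropy_cong) (auto simp: finer_def)
  ultimately show ?thesis unfolding cond_entropy_def[of M "\<lambda>x. (\<xi> x, \<xi> (U a x))"] by simp
qed

text \<open>With \<open>c = H(\<xi> | \<eta>)\<close> the entropy term contributes \<open>(1 - 2 r) c\<close> and each of the \<open>r\<close> pair entropies at
  most \<open>2 c\<close>.\<close>

lemma F_obs_refine_le:
  assumes "finite_entropy M \<xi>" "finite_entropy M \<eta>"
  shows "F_obs (\<lambda>x. (\<xi> x, \<eta> x)) \<le> F_obs \<eta> + cond_entropy M \<xi> \<eta>"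
proof -
  let ?c = "cond_entropy M \<xi> \<eta>"
  have "(\<Sum>i=1..r. obs_entropy M (\<lambda>x. ((\<xi> x, \<eta> x), (\<xi> (U (i, True) x), \<eta> (U (i, True) x)))))
    \<le> (\<Sum>i=1..r. obs_entropy M (\<lambda>x. (\<eta> x, \<eta> (U (i, True) x))) + 2 * ?c)"
    using assms by (intro sum_mono entropy_add_two positive_letters)
  also have "\<dots> = (\<Sum>i=1..r. obs_entropy M (\<lambda>x. (\<eta> x, \<eta> (U (i, True) x)))) + 2 * real r * ?c"
    by (simp add: sum.distrib)
  finally show ?thesis unfolding F_obs_def cond_entropy_def by (simp add: algebra_simps)
qed

text \<open>The pair entropies only grow under refinement, so the entropy term alone can lower \<open>F\<close>.\<close>

lemma F_obs_coarsen_le: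
  assumes "finite_entropy M \<xi>" "finite_entropy M \<eta>"
  shows "F_obs \<eta> \<le> F_obs (\<lambda>x. (\<xi> x, \<eta> x)) + (2 * real r - 1) * cond_entropy M \<xi> \<eta>"
proof -
  have "(\<Sum>i=1..r. obs_entropy M (\<lambda>x. (\<eta> x, \<eta> (U (i, True) x))))
    \<le> (\<Sum>i=1..r. obs_entropy M (\<lambda>x. ((\<xi> x, \<eta> x), (\<xi> (U (i, True) x), \<eta> (U (i, True) x)))))"
  proof (rule sum_mono)
    fix i assume "i \<in> {1..r}"
    then have f: "finite_entropy M (\<lambda>x. \<xi> (U (i, True) x))" "finite_entropy M (\<lambda>x. \<eta> (U (i, True) x))"
      using assms by (auto intro: finite_entropy_U[OF positive_letters])
    show "obs_entropy M (\<lambda>x. (\<eta> x, \<eta> (U (i, True) x))) \<le> obs_entropy M (\<lambda>x. ((\<xi> x, \<eta> x), (\<xi> (U (i, True) x), \<eta> (U (i, True) x))))"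
      by (rule obs_entropy_mono) (intro finite_entropy_Pair assms f, simp add: finer_def)
  qed
  then show ?thesis unfolding F_obs_def cond_entropy_def by (simp add: algebra_simps)
qed

text \<open>Adjoining \<open>\<beta> \<circ> U a\<close> costs entropy \<open>h\<close>. For the generator \<open>k\<close> underlying \<open>a\<close> one of the two new
  coordinates of the pair is redundant, because \<open>\<beta>\<close> is a coarsening of \<open>\<gamma>\<close>: for \<open>a = k\<close> the
  observable \<open>\<beta> \<circ> U k\<close> is determined by \<open>\<gamma> \<circ> U k\<close>, and for \<open>a\<close> the inverse of \<open>k\<close> the translate
  \<open>\<beta> \<circ> U a \<circ> U k\<close> is \<open>\<beta>\<close> itself. So the pair entropies grow by at most \<open>(2 r - 1) h\<close> in total,
  which the term \<open>(1 - 2 r) h\<close> compensates.\<close>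

lemma F_obs_split_le:
  assumes \<gamma>: "finite_entropy M \<gamma>" and \<beta>: "finer M \<gamma> \<beta>" and a: "a \<in> L"
  shows "F_obs (\<lambda>x. (\<gamma> x, \<beta> (U a x))) \<le> F_obs \<gamma>"
proof -
  obtain k b where kb: "a = (k, b)" by (cases a)
  have k: "k \<in> {1..r}" using a letters kb by auto
  have kL: "(k, True) \<in> L" using k by (rule positive_letters)
  let ?\<beta> = "\<lambda>x. \<beta> (U a x)"
  have f\<beta>: "finite_entropy M \<beta>" using \<gamma> \<beta> by (rule finite_entropy_finer)
  have f\<beta>a: "finite_entropy M ?\<beta>" using a f\<beta> by (rule finite_entropy_U)
  define h where "h = cond_entropy M ?\<beta> \<gamma>"
  define \<sigma> where "\<sigma> = (\<lambda>x. (\<gamma> x, ?\<beta> x))"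
  have f\<sigma>: "finite_entropy M \<sigma>" unfolding \<sigma>_def by (intro finite_entropy_Pair \<gamma> f\<beta>a)
  have H\<sigma>: "obs_entropy M \<sigma> = obs_entropy M \<gamma> + h"
  proof -
    have "obs_entropy M \<sigma> = obs_entropy M (\<lambda>x. (?\<beta> x, \<gamma> x))"
      unfolding \<sigma>_def by (rule obs_entropy_cong) (auto simp: finer_def)
    then show ?thesis by (simp add: h_def cond_entropy_def)
  qed
  let ?E = "\<lambda>\<xi> i. obs_entropy M (\<lambda>x. (\<xi> x, \<xi> (U (i, True) x)))"
  have other: "obs_entropy M (\<lambda>x. (\<sigma> x, \<sigma> (U (i, True) x))) \<le> obs_entropy M (\<lambda>x. (\<gamma> x, \<gamma> (U (i, True) x))) + 2 * h" if "i \<in> {1..r}" for i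
  proof -
    have "obs_entropy M (\<lambda>x. (\<sigma> x, \<sigma> (U (i, True) x))) = obs_entropy M (\<lambda>x. ((?\<beta> x, \<gamma> x), (?\<beta> (U (i, True) x), \<gamma> (U (i, True) x))))"
      unfolding \<sigma>_def by (rule obs_entropy_cong) (auto simp: finer_def)
    also have "\<dots> \<le> obs_entropy M (\<lambda>x. (\<gamma> x, \<gamma> (U (i, True) x))) + 2 * h"
      unfolding h_def by (rule entropy_add_two[OF f\<beta>a \<gamma> positive_letters[OF that]])
    finally show ?thesis .
  qed
  have self: "obs_entropy M (\<lambda>x. (\<sigma> x, \<sigma> (U (k, True) x))) \<le> obs_entropy M (\<lambda>x. (\<gamma> x, \<gamma> (U (k, True) x))) + h"
  proof -
    let ?\<gamma>2 = "\<lambda>x. (\<gamma> x, \<gamma> (U (k, True) x))"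
    have f\<gamma>k: "finite_entropy M (\<lambda>x. \<gamma> (U (k, True) x))" using kL \<gamma> by (rule finite_entropy_U)
    have f2: "finite_entropy M ?\<gamma>2" using \<gamma> f\<gamma>k by (rule finite_entropy_Pair)
    have \<beta>k: "finer M (\<lambda>x. \<gamma> (U (k, True) x)) (\<lambda>x. \<beta> (U (k, True) x))" using \<beta> kL by (rule finer_comp_U)
    show ?thesis
    proof (cases b)
      case True
      then have ak: "a = (k, True)" using kb by simp
      have "obs_entropy M (\<lambda>x. (\<sigma> x, \<sigma> (U (k, True) x))) = obs_entropy M (\<lambda>x. (?\<beta> (U (k, True) x), ?\<gamma>2 x))"
        unfolding \<sigma>_def using \<beta>k unfolding ak
        by (intro obs_entropy_cong) (unfold finer_def prod.inject, blast+)
      also have "\<dots> = obs_entropy M ?\<gamma>2 + cond_entropy M (\<lambda>x. ?\<beta> (U (k, True) x)) ?\<gamma>2"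
        by (simp add: cond_entropy_def)
      also have "cond_entropy M (\<lambda>x. ?\<beta> (U (k, True) x)) ?\<gamma>2 \<le> cond_entropy M (\<lambda>x. ?\<beta> (U (k, True) x)) (\<lambda>x. \<gamma> (U (k, True) x))"
        using f2 finite_entropy_U[OF kL f\<beta>a] by (intro cond_entropy_antimono) (auto simp: finer_def)
      also have "\<dots> = h"
        unfolding h_def by (rule cond_entropy_comp[OF preserving[OF kL] f\<beta>a[THEN finite_entropy_observable] \<gamma>[THEN finite_entropy_observable]])
      finally show ?thesis by simp
    next
      case False
      then have ak: "a = (k, \<not> True)" using kb by simp
      then have cancel: "\<beta> (U a (U (k, True) x)) = \<beta> x" if "x \<in> space M" for x
        using inverse_letter[of "(k, True)" x] kL a that by (simp add: inv_letter_def)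
      have "obs_entropy M (\<lambda>x. (\<sigma> x, \<sigma> (U (k, True) x))) = obs_entropy M (\<lambda>x. (?\<beta> x, ?\<gamma>2 x))"
      proof (rule obs_entropy_cong)
        show "finer M (\<lambda>x. (\<sigma> x, \<sigma> (U (k, True) x))) (\<lambda>x. (?\<beta> x, ?\<gamma>2 x))"
          by (auto simp: finer_def \<sigma>_def)
        show "finer M (\<lambda>x. (?\<beta> x, ?\<gamma>2 x)) (\<lambda>x. (\<sigma> x, \<sigma> (U (k, True) x)))"
        proof (rule finerI)
          fix x x' assume x: "x \<in> space M" "x' \<in> space M" "(?\<beta> x, ?\<gamma>2 x) = (?\<beta> x', ?\<gamma>2 x')"
          moreover from this have "\<beta> x = \<beta> x'" using finerD[OF \<beta> x(1,2)] by simp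
          ultimately show "(\<sigma> x, \<sigma> (U (k, True) x)) = (\<sigma> x', \<sigma> (U (k, True) x'))"
            by (simp add: \<sigma>_def cancel)
        qed
      qed
      also have "\<dots> = obs_entropy M ?\<gamma>2 + cond_entropy M ?\<beta> ?\<gamma>2"
        by (simp add: cond_entropy_def)
      also have "cond_entropy M ?\<beta> ?\<gamma>2 \<le> h"
        unfolding h_def using f2 f\<beta>a by (intro cond_entropy_antimono) (auto simp: finer_def)
      finally show ?thesis by simp
    qed
  qed
  have "(\<Sum>i=1..r. ?E \<sigma> i) = ?E \<sigma> k + (\<Sum>i\<in>{1..r} - {k}. ?E \<sigma> i)"
    using k by (intro sum.remove) auto
  also have "\<dots> \<le> (?E \<gamma> k + h) + (\<Sum>i\<in>{1..r} - {k}. ?E \<gamma> i + 2 * h)"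
    using self other by (intro add_mono sum_mono) auto
  also have "\<dots> = (?E \<gamma> k + (\<Sum>i\<in>{1..r} - {k}. ?E \<gamma> i)) + (2 * real (r - 1) + 1) * h"
    using k by (simp add: sum.distrib algebra_simps)
  also have "?E \<gamma> k + (\<Sum>i\<in>{1..r} - {k}. ?E \<gamma> i) = (\<Sum>i=1..r. ?E \<gamma> i)"
    using k by (intro sum.remove[symmetric]) auto
  finally have "(\<Sum>i=1..r. ?E \<sigma> i) \<le> (\<Sum>i=1..r. ?E \<gamma> i) + (2 * real r - 1) * h"
    using r_pos by (simp add: of_nat_diff)
  then show ?thesis
    unfolding F_obs_def \<sigma>_def[symmetric] H\<sigma> by (simp add: algebra_simps)
qed

text \<open>A longest word of \<open>W' - W\<close> is \<open>w @ [a]\<close> with \<open>w\<close> still in the window without it, so putting it back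
  is a splitting by the letter \<open>a\<close>. The observable \<open>\<eta>\<close> is carried along for the comparison of two
  generators.\<close>

lemma F_obs_window_antimono:
  assumes "finite W'" "W' \<subseteq> lists L" "prefix_closed W'" "prefix_closed W" "W \<subseteq> W'" "[] \<in> W"
    and \<xi>: "finite_entropy M \<xi>" and \<eta>: "finite_entropy M \<eta>"
  shows "F_obs (\<lambda>x. (window \<xi> W' x, \<eta> x)) \<le> F_obs (\<lambda>x. (window \<xi> W x, \<eta> x))"
  using assms(1-3,5)
proof (induction "card (W' - W)" arbitrary: W')
  case 0
  then have "W' = W" by auto
  then show ?case by simp
next
  case (Suc n)
  then have "finite (W' - W)" "W' - W \<noteq> {}" by (auto simp: card_eq_0_iff)
  then obtain v where v: "v \<in> W' - W" and vmax: "\<And>u. u \<in> W' - W \<Longrightarrow> length u \<le> length v"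
    using Max_in[of "length ` (W' - W)"] Max_ge[of "length ` (W' - W)"]
    by (metis (no_types, lifting) finite_imageI image_iff image_is_empty imageI)
  have "v \<noteq> []" using v assms(6) by auto
  then obtain w a where wa: "v = w @ [a]" by (metis rev_exhaust)
  define W'' where "W'' = W' - {v}"
  have "w \<in> W'" using Suc.prems(3) v wa unfolding prefix_closed_def by blast
  then have w: "w \<in> W''" unfolding W''_def wa by simp
  have a: "a \<in> L" using v Suc.prems(2) wa by auto
  have fin: "finite W''" "W'' \<subseteq> lists L" "W \<subseteq> W''" using Suc.prems v by (auto simp: W''_def)
  have pc: "prefix_closed W''"
    unfolding prefix_closed_def
  proof (intro allI impI)
    fix u b assume ub: "u @ [b] \<in> W''"
    then have "u \<in> W'" using Suc.prems(3) unfolding prefix_closed_def W''_def by blast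
    moreover have "u \<noteq> v"
    proof
      assume "u = v"
      with vmax[of "u @ [b]"] ub have "u @ [b] \<in> W" by (auto simp: W''_def)
      then have "u \<in> W" using assms(4) unfolding prefix_closed_def by blast
      with v \<open>u = v\<close> show False by simp
    qed
    ultimately show "u \<in> W''" by (simp add: W''_def)
  qed
  have card: "n = card (W'' - W)"
  proof -
    have "W'' - W = (W' - W) - {v}" by (auto simp: W''_def)
    then show ?thesis using Suc.hyps(2) v \<open>finite (W' - W)\<close> by simp
  qed
  let ?\<gamma> = "\<lambda>x. (window \<xi> W'' x, \<eta> x)" and ?\<beta> = "\<lambda>x. \<xi> (foldr U w x)"
  have fg: "finite_entropy M ?\<gamma>" using fin \<xi> \<eta> by (intro finite_entropy_Pair finite_entropy_window)
  have gb: "finer M ?\<gamma> ?\<beta>" using finer_window_member[OF w, of \<xi>] unfolding finer_def prod.inject by blast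
  have "F_obs (\<lambda>x. (window \<xi> W' x, \<eta> x)) = F_obs (\<lambda>x. (?\<gamma> x, ?\<beta> (U a x)))"
  proof (rule F_obs_cong)
    have e: "W' = insert v W''" using v by (auto simp: W''_def)
    show "finer M (\<lambda>x. (window \<xi> W' x, \<eta> x)) (\<lambda>x. (?\<gamma> x, ?\<beta> (U a x)))"
      unfolding e finer_def prod.inject window_eq_iff by (auto simp: wa)
    show "finer M (\<lambda>x. (?\<gamma> x, ?\<beta> (U a x))) (\<lambda>x. (window \<xi> W' x, \<eta> x))"
      unfolding e finer_def prod.inject window_eq_iff by (auto simp: wa)
  qed
  also have "\<dots> \<le> F_obs ?\<gamma>" using fg gb a by (rule F_obs_split_le)
  also have "\<dots> \<le> F_obs (\<lambda>x. (window \<xi> W x, \<eta> x))"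
    using Suc.hyps(1)[OF card fin(1,2) pc fin(3)] .
  finally show ?case .
qed

definition f_obs :: "('x \<Rightarrow> 'a) \<Rightarrow> ereal" where
  "f_obs \<xi> = (INF n\<in>{0<..}. ereal (F_obs (ball_window \<xi> n)))"

text \<open>The events that are limits, in the measure algebra, of events visible in finite windows of \<open>\<xi>\<close>.\<close>

definition word_approximable :: "('x \<Rightarrow> 'a) \<Rightarrow> 'x set set" where
  "word_approximable \<xi> = {E \<in> sets M. \<forall>\<epsilon>>0. \<exists>n. \<exists>A\<in>sets M.
     finer M (ball_window \<xi> n) (\<lambda>x. x \<in> A) \<and> prob ((A - E) \<union> (E - A)) < \<epsilon>}"

text \<open>The form in which the assumption that a partition is generating is used.\<close>

definition approximates :: "('x \<Rightarrow> 'a) \<Rightarrow> bool" where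
  "approximates \<xi> \<longleftrightarrow> sets M \<subseteq> word_approximable \<xi>"

lemma finite_entropy_ball: "finite_entropy M \<xi> \<Longrightarrow> finite_entropy M (ball_window \<xi> n)"
  by (intro finite_entropy_window finite_word_ball_over finite_L word_ball_over_subset)

lemma cond_entropy_ball_to_0:
  assumes "finite_entropy M \<xi>" "approximates \<xi>" "finite_entropy M \<beta>" "0 < \<epsilon>"
  shows "\<exists>n\<ge>m. cond_entropy M \<beta> (ball_window \<xi> n) < \<epsilon>"
proof -
  have "\<exists>n. cond_entropy M \<beta> (ball_window \<xi> n) < \<epsilon>"
  proof (rule cond_entropy_to_0[OF assms(3) finite_entropy_ball[OF assms(1)] _ _ assms(4)])
    show "finer M (ball_window \<xi> n) (ball_window \<xi> m)" if "m \<le> n" for m n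
      by (intro finer_window_mono word_ball_over_mono that)
    fix v and \<epsilon> :: real assume "0 < \<epsilon>"
    moreover have "{x\<in>space M. \<beta> x = v} \<in> sets M"
      using finite_entropy_observable[OF assms(3)] by (simp add: observable_def)
    ultimately show "\<exists>n. \<exists>A\<in>sets M. finer M (ball_window \<xi> n) (\<lambda>x. x \<in> A) \<and>
       prob ((A - {x\<in>space M. \<beta> x = v}) \<union> ({x\<in>space M. \<beta> x = v} - A)) < \<epsilon>"
      using assms(2) unfolding approximates_def word_approximable_def by blast
  qed
  then obtain n where "cond_entropy M \<beta> (ball_window \<xi> n) < \<epsilon>" by blast
  moreover have "cond_entropy M \<beta> (ball_window \<xi> (max m n)) \<le> cond_entropy M \<beta> (ball_window \<xi> n)"
    using assms by (intro cond_entropy_antimono finite_entropy_ball finer_window_mono word_ball_over_mono) auto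
  ultimately show ?thesis by (intro exI[of _ "max m n"]) auto
qed

lemma F_obs_ball_antimono:
  assumes "finite_entropy M \<xi>" "m \<le> n"
  shows "F_obs (ball_window \<xi> n) \<le> F_obs (ball_window \<xi> m)"
proof -
  have u: "F_obs (\<lambda>x. (window \<xi> W x, ())) = F_obs (window \<xi> W)" for W
    by (rule F_obs_cong) (simp_all add: finer_def)
  have "F_obs (\<lambda>x. (ball_window \<xi> n x, ())) \<le> F_obs (\<lambda>x. (ball_window \<xi> m x, ()))"
    using assms by (intro F_obs_window_antimono finite_word_ball_over finite_L word_ball_over_subset
        prefix_closed_word_ball_over word_ball_over_mono Nil_in_word_ball_over finite_entropy_const)
  then show ?thesis by (simp only: u)
qed

text \<open>The chain of inequalities explained at the beginning, with the radius \<open>m\<close> chosen first to make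
  \<open>H(\<alpha> | \<beta>\<^sup>m)\<close> small and then the radius \<open>n\<close> to make \<open>H(\<beta>\<^sup>m | \<alpha>\<^sup>n)\<close> small.\<close>

lemma f_obs_le:
  assumes \<alpha>: "finite_entropy M \<alpha>" "approximates \<alpha>" and \<beta>: "finite_entropy M \<beta>" "approximates \<beta>"
  shows "f_obs \<alpha> \<le> f_obs \<beta>"
  unfolding f_obs_def[of \<beta>]
proof (rule INF_greatest)
  fix m\<^sub>0 :: nat assume "m\<^sub>0 \<in> {0<..}"
  let ?B = "word_ball_over L"
  show "f_obs \<alpha> \<le> ereal (F_obs (window \<beta> (?B m\<^sub>0)))"
  proof (rule ereal_le_epsilon2)
    fix \<epsilon> :: real assume \<epsilon>: "0 < \<epsilon>"
    obtain m where m: "m\<^sub>0 \<le> m" "cond_entropy M \<alpha> (window \<beta> (?B m)) < \<epsilon> / 2"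
      using cond_entropy_ball_to_0[OF \<beta> \<alpha>(1), of "\<epsilon> / 2" m\<^sub>0] \<epsilon> by auto
    define \<beta>m where "\<beta>m = window \<beta> (?B m)"
    have f\<beta>: "finite_entropy M \<beta>m" unfolding \<beta>m_def by (rule finite_entropy_ball[OF \<beta>(1)])
    have r: "0 < 2 * real r - 1" using r_pos by simp
    have half: "c * (\<epsilon> / (2 * c)) = \<epsilon> / 2" if "0 < c" for c :: real using that by simp
    obtain n where n: "1 \<le> n" "cond_entropy M \<beta>m (window \<alpha> (?B n)) < \<epsilon> / (2 * (2 * real r - 1))"
      using cond_entropy_ball_to_0[OF \<alpha> f\<beta>, of "\<epsilon> / (2 * (2 * real r - 1))" 1] \<epsilon> r by auto
    have f\<alpha>: "finite_entropy M (window \<alpha> (?B n))" by (rule finite_entropy_ball[OF \<alpha>(1)])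
    have "F_obs (window \<alpha> (?B n)) \<le> F_obs (\<lambda>x. (\<beta>m x, window \<alpha> (?B n) x)) + (2 * real r - 1) * cond_entropy M \<beta>m (window \<alpha> (?B n))"
      by (rule F_obs_coarsen_le[OF f\<beta> f\<alpha>])
    also have "(2 * real r - 1) * cond_entropy M \<beta>m (window \<alpha> (?B n)) \<le> (2 * real r - 1) * (\<epsilon> / (2 * (2 * real r - 1)))"
      using n(2) r by (intro mult_left_mono) auto
    also have "\<dots> = \<epsilon> / 2" by (rule half[OF r])
    also have "F_obs (\<lambda>x. (\<beta>m x, window \<alpha> (?B n) x)) = F_obs (\<lambda>x. (window \<alpha> (?B n) x, \<beta>m x))"
      by (rule F_obs_cong) (auto simp: finer_def)
    also have "\<dots> \<le> F_obs (\<lambda>x. (window \<alpha> (?B 0) x, \<beta>m x))"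
      using \<alpha>(1) f\<beta> by (intro F_obs_window_antimono finite_word_ball_over finite_L word_ball_over_subset
        prefix_closed_word_ball_over word_ball_over_mono Nil_in_word_ball_over) auto
    also have "\<dots> = F_obs (\<lambda>x. (\<alpha> x, \<beta>m x))"
      by (rule F_obs_cong) (auto simp: finer_def window_def word_ball_over_0 fun_eq_iff restrict_def)
    also have "\<dots> \<le> F_obs \<beta>m + cond_entropy M \<alpha> \<beta>m" by (rule F_obs_refine_le[OF \<alpha>(1) f\<beta>])
    also have "F_obs \<beta>m \<le> F_obs (window \<beta> (?B m\<^sub>0))"
      unfolding \<beta>m_def by (rule F_obs_ball_antimono[OF \<beta>(1) m(1)])
    finally have "F_obs (window \<alpha> (?B n)) \<le> F_obs (window \<beta> (?B m\<^sub>0)) + \<epsilon>"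
      using m(2) by (simp add: \<beta>m_def)
    moreover have "f_obs \<alpha> \<le> ereal (F_obs (window \<alpha> (?B n)))"
      unfolding f_obs_def using n(1) by (intro INF_lower) auto
    ultimately show "f_obs \<alpha> \<le> ereal (F_obs (window \<beta> (?B m\<^sub>0))) + ereal \<epsilon>"
      by (metis ereal_less_eq(3) order_trans plus_ereal.simps(1))
  qed
qed

end

context letter_action
begin

lemma word_approximableI:
  assumes "E \<in> sets M"
    "\<And>\<epsilon>. 0 < \<epsilon> \<Longrightarrow> \<exists>n. \<exists>A\<in>sets M. finer M (ball_window \<xi> n) (\<lambda>x. x \<in> A) \<and> prob ((A - E) \<union> (E - A)) < \<epsilon>"
  shows "E \<in> word_approximable \<xi>"
  using assms unfolding word_approximable_def by blast

lemma word_approximableE: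
  assumes "E \<in> word_approximable \<xi>" "0 < \<epsilon>"
  obtains n A where "A \<in> sets M" "finer M (ball_window \<xi> n) (\<lambda>x. x \<in> A)" "prob ((A - E) \<union> (E - A)) < \<epsilon>"
  using assms unfolding word_approximable_def by blast

lemma word_approximable_sets: "E \<in> word_approximable \<xi> \<Longrightarrow> E \<in> sets M"
  unfolding word_approximable_def by blast

text \<open>For a countable union, continuity of the measure reduces to finitely many sets, whose
  approximations are all visible in the largest of finitely many balls.\<close>

lemma sigma_algebra_word_approximable: "sigma_algebra (space M) (word_approximable \<xi>)"
  unfolding sigma_algebra_iff2
proof (intro conjI ballI allI impI)
  show "word_approximable \<xi> \<subseteq> Pow (space M)"
    using word_approximable_sets sets.sets_into_space by blast
  show "{} \<in> word_approximable \<xi>"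
    by (rule word_approximableI) (auto intro!: exI[of _ 0] bexI[of _ "{}"] simp: finer_def)
  fix E assume E: "E \<in> word_approximable \<xi>"
  show "space M - E \<in> word_approximable \<xi>"
  proof (rule word_approximableI)
    show "space M - E \<in> sets M" using word_approximable_sets[OF E] by auto
    fix \<epsilon> :: real assume "0 < \<epsilon>"
    with E obtain n A where A: "A \<in> sets M" "finer M (ball_window \<xi> n) (\<lambda>x. x \<in> A)" "prob ((A - E) \<union> (E - A)) < \<epsilon>"
      by (rule word_approximableE)
    have "finer M (ball_window \<xi> n) (\<lambda>x. x \<in> space M - A)"
      using A(2) unfolding finer_def by blast
    moreover have "(space M - A - (space M - E)) \<union> (space M - E - (space M - A)) = (A - E) \<union> (E - A)"
      using sets.sets_into_space[OF A(1)] sets.sets_into_space[OF word_approximable_sets[OF E]] by blast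
    ultimately show "\<exists>n. \<exists>A\<in>sets M. finer M (ball_window \<xi> n) (\<lambda>x. x \<in> A) \<and>
        prob ((A - (space M - E)) \<union> (space M - E - A)) < \<epsilon>"
      using A(1,3) by (intro exI[of _ n] bexI[of _ "space M - A"]) auto
  qed
next
  fix E :: "nat \<Rightarrow> 'x set" assume r: "range E \<subseteq> word_approximable \<xi>"
  then have E: "E i \<in> word_approximable \<xi>" for i by blast
  then have Es: "E i \<in> sets M" for i by (rule word_approximable_sets)
  show "(\<Union>i. E i) \<in> word_approximable \<xi>"
  proof (rule word_approximableI)
    show "(\<Union>i. E i) \<in> sets M" using Es by auto
    fix \<epsilon> :: real assume \<epsilon>: "0 < \<epsilon>"
    let ?D = "\<lambda>N. (\<Union>i<N. E i)" and ?E = "\<Union>i. E i"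
    have "(\<lambda>N. prob (?D N)) \<longlonglongrightarrow> prob (\<Union>N. ?D N)"
      using Es by (intro finite_Lim_measure_incseq) (auto simp: incseq_def intro: order.strict_trans2)
    also have "(\<Union>N. ?D N) = ?E" by blast
    finally have "\<forall>\<^sub>F N in sequentially. dist (prob (?D N)) (prob ?E) < \<epsilon> / 2"
      using \<epsilon> by (intro tendstoD) auto
    then obtain N where N: "dist (prob (?D N)) (prob ?E) < \<epsilon> / 2"
      unfolding eventually_sequentially by blast
    have "0 < \<epsilon> / (2 * (real N + 1))" using \<epsilon> by simp
    then have "\<exists>n A. A \<in> sets M \<and> finer M (ball_window \<xi> n) (\<lambda>x. x \<in> A) \<and> prob ((A - E i) \<union> (E i - A)) < \<epsilon> / (2 * (real N + 1))" for i
      using word_approximableE[OF E] by metis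
    then obtain n A where A: "\<And>i. A i \<in> sets M" "\<And>i. finer M (ball_window \<xi> (n i)) (\<lambda>x. x \<in> A i)"
      "\<And>i. prob ((A i - E i) \<union> (E i - A i)) < \<epsilon> / (2 * (real N + 1))" by metis
    define m where "m = Max (insert 0 (n ` {..<N}))"
    define B where "B = (\<Union>i<N. A i)"
    have Bs: "B \<in> sets M" using A(1) by (auto simp: B_def)
    have fi: "finer M (ball_window \<xi> m) (\<lambda>x. x \<in> A i)" if "i < N" for i
    proof -
      have "n i \<le> m" unfolding m_def using that by (intro Max_ge) auto
      then show ?thesis by (intro finer_trans[OF finer_window_mono[OF word_ball_over_mono] A(2)])
    qed
    have "finer M (ball_window \<xi> m) (\<lambda>x. x \<in> B)"
    proof (rule finerI)
      fix x x' assume x: "x \<in> space M" "x' \<in> space M" "ball_window \<xi> m x = ball_window \<xi> m x'"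
      have "(x \<in> A i) = (x' \<in> A i)" if "i < N" for i using finerD[OF fi[OF that] x] .
      then show "(x \<in> B) = (x' \<in> B)" by (auto simp: B_def)
    qed
    moreover have "prob ((B - ?E) \<union> (?E - B)) < \<epsilon>"
    proof -
      have "(B - ?E) \<union> (?E - B) \<subseteq> (\<Union>i<N. (A i - E i) \<union> (E i - A i)) \<union> (?E - ?D N)"
        by (auto simp: B_def)
      then have "prob ((B - ?E) \<union> (?E - B)) \<le> prob ((\<Union>i<N. (A i - E i) \<union> (E i - A i)) \<union> (?E - ?D N))"
        using A(1) Es by (intro finite_measure_mono) auto
      also have "\<dots> \<le> prob (\<Union>i<N. (A i - E i) \<union> (E i - A i)) + prob (?E - ?D N)"
        using A(1) Es by (intro measure_Un_le) auto
      also have "prob (\<Union>i<N. (A i - E i) \<union> (E i - A i)) \<le> (\<Sum>i<N. prob ((A i - E i) \<union> (E i - A i)))"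
        using A(1) Es by (intro measure_UNION_le) auto
      also have "\<dots> \<le> (\<Sum>i<N. \<epsilon> / (2 * (real N + 1)))"
        using A(3) by (intro sum_mono) (simp add: less_imp_le)
      also have "\<dots> \<le> \<epsilon> / 2" using \<epsilon> by (simp add: field_simps)
      also have "prob (?E - ?D N) = prob ?E - prob (?D N)"
        using Es by (intro finite_measure_Diff) auto
      also have "\<dots> < \<epsilon> / 2" using N unfolding dist_real_def by linarith
      finally show ?thesis by simp
    qed
    ultimately show "\<exists>n. \<exists>A\<in>sets M. finer M (ball_window \<xi> n) (\<lambda>x. x \<in> A) \<and>
        prob ((A - ?E) \<union> (?E - A)) < \<epsilon>" using Bs by blast
  qed
qed

lemma fibres_word_approximable:
  assumes "observable M \<xi>" "A \<in> fibres M \<xi>" shows "A \<in> word_approximable \<xi>"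
proof (rule word_approximableI)
  show A: "A \<in> sets M" using assms unfolding fibres_alt observable_def by blast
  obtain v where "A = {x\<in>space M. \<xi> x = v}" using assms(2) unfolding fibres_alt by blast
  then have "finer M \<xi> (\<lambda>x. x \<in> A)" unfolding finer_def by auto
  moreover have "finer M (ball_window \<xi> 0) \<xi>"
    using finer_window_member[OF Nil_in_word_ball_over, where \<xi>=\<xi>] by simp
  ultimately have "finer M (ball_window \<xi> 0) (\<lambda>x. x \<in> A)" using finer_trans by blast
  then show "\<exists>n. \<exists>B\<in>sets M. finer M (ball_window \<xi> n) (\<lambda>x. x \<in> B) \<and> prob ((B - A) \<union> (A - B)) < \<epsilon>"
    if "0 < \<epsilon>" for \<epsilon> using A that by (intro exI[of _ 0] bexI[of _ A]) auto
qed

lemma approximates_if_dense: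
  assumes "\<And>E. E \<in> sets M \<Longrightarrow> \<exists>B\<in>word_approximable \<xi>. emeasure M ((E - B) \<union> (B - E)) = 0"
  shows "approximates \<xi>"
  unfolding approximates_def
proof (rule subsetI, rule word_approximableI)
  fix E assume E: "E \<in> sets M"
  then show "E \<in> sets M" .
  fix \<epsilon> :: real assume \<epsilon>: "0 < \<epsilon>"
  obtain B where B: "B \<in> word_approximable \<xi>" "emeasure M ((E - B) \<union> (B - E)) = 0" using assms[OF E] by blast
  obtain n A where A: "A \<in> sets M" "finer M (ball_window \<xi> n) (\<lambda>x. x \<in> A)" "prob ((A - B) \<union> (B - A)) < \<epsilon>"
    using B(1) \<epsilon> by (rule word_approximableE)
  note Bs = word_approximable_sets[OF B(1)]
  have "prob ((A - E) \<union> (E - A)) \<le> prob (((A - B) \<union> (B - A)) \<union> ((E - B) \<union> (B - E)))"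
    using A(1) Bs E by (intro finite_measure_mono) auto
  also have "\<dots> \<le> prob ((A - B) \<union> (B - A)) + prob ((E - B) \<union> (B - E))"
    using A(1) Bs E by (intro measure_Un_le) auto
  also have "prob ((E - B) \<union> (B - E)) = 0" using B(2) by (simp add: emeasure_eq_measure)
  finally have "prob ((A - E) \<union> (E - A)) < \<epsilon>" using A(3) by simp
  then show "\<exists>n. \<exists>A\<in>sets M. finer M (ball_window \<xi> n) (\<lambda>x. x \<in> A) \<and> prob ((A - E) \<union> (E - A)) < \<epsilon>"
    using A by blast
qed

end

section \<open>Free groups and free semigroups as sets of reduced words\<close>

text \<open>The common description of both cases. For a free group \<open>L\<close> consists of all letters; for a free
  semigroup of the positive ones, so that the inverse axiom is vacuous and every word is reduced.\<close>

locale free_words =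
  fixes G :: "('g, 'm) monoid_scheme" (structure) and s :: "nat \<Rightarrow> 'g" and r :: nat and L :: "letter set"
  assumes monoid: "monoid G"
    and r_ge_1: "1 \<le> r"
    and pos_letters: "i \<in> {1..r} \<Longrightarrow> (i, True) \<in> L"
    and L_subset: "L \<subseteq> {1..r} \<times> UNIV"
    and letter_closed: "a \<in> L \<Longrightarrow> letter_value G s a \<in> carrier G"
    and letter_inverse: "a \<in> L \<Longrightarrow> inv_letter a \<in> L \<Longrightarrow>
          letter_value G s (inv_letter a) \<otimes> letter_value G s a = \<one>"
    and ev_bij: "bij_betw (\<lambda>w. list_mult G (map (letter_value G s) w)) {w \<in> lists L. reduced_word w} (carrier G)"
    and gen_set_eq: "gen_set G s r = letter_value G s ` L"
begin

sublocale monoid G by (rule monoid)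

abbreviation "lv \<equiv> letter_value G s"

definition ev :: "letter list \<Rightarrow> 'g" where
  "ev w = list_mult G (map lv w)"

definition RW :: "letter list set" where
  "RW = {w \<in> lists L. reduced_word w}"

lemma ev_Nil [simp]: "ev [] = \<one>"
  by (simp add: ev_def list_mult_def)

lemma ev_Cons: "ev (a # w) = lv a \<otimes> ev w"
  by (simp add: ev_def list_mult_def)

lemma ev_closed [simp]: "w \<in> lists L \<Longrightarrow> ev w \<in> carrier G"
  by (induction w) (auto simp: ev_Cons letter_closed)

lemma ev_append: "u \<in> lists L \<Longrightarrow> v \<in> lists L \<Longrightarrow> ev (u @ v) = ev u \<otimes> ev v"
  by (induction u) (auto simp: ev_Cons letter_closed m_assoc)

lemma ev_single [simp]: "a \<in> L \<Longrightarrow> ev [a] = lv a"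
  by (simp add: ev_Cons letter_closed)

lemma RW_lists: "w \<in> RW \<Longrightarrow> w \<in> lists L"
  and RW_reduced: "w \<in> RW \<Longrightarrow> reduced_word w"
  by (auto simp: RW_def)

lemma ev_inj: "u \<in> RW \<Longrightarrow> v \<in> RW \<Longrightarrow> ev u = ev v \<Longrightarrow> u = v"
  using ev_bij unfolding RW_def ev_def by (auto simp: bij_betw_def inj_on_def)

lemma ev_surj:
  assumes "g \<in> carrier G" shows "\<exists>w\<in>RW. ev w = g"
proof -
  have "g \<in> (\<lambda>w. list_mult G (map lv w)) ` {w \<in> lists L. reduced_word w}"
    using assms by (simp only: bij_betw_imp_surj_on[OF ev_bij])
  then show ?thesis unfolding RW_def ev_def by (rule imageE) blast
qed

lemma ev_image: "ev ` RW = carrier G"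
  using ev_surj RW_lists by auto

lemma word_ball_over_RW: "word_ball_over L n \<subseteq> RW"
  by (auto simp: word_ball_over_def RW_def)

lemma cons_letter_RW:
  assumes "a \<in> L" "w \<in> RW"
  shows "cons_letter a w \<in> RW" "ev (cons_letter a w) = lv a \<otimes> ev w"
proof -
  have w: "w \<in> lists L" "reduced_word w" using assms(2) by (auto simp: RW_def)
  show "cons_letter a w \<in> RW"
    using w assms(1) reduced_cons_letter[OF w(2), of a] by (cases w) (auto simp: RW_def cons_letter_def)
  show "ev (cons_letter a w) = lv a \<otimes> ev w"
  proof (cases "w \<noteq> [] \<and> hd w = inv_letter a")
    case True
    then obtain w' where w': "w = inv_letter a # w'" by (cases w) auto
    then have l: "inv_letter a \<in> L" "w' \<in> lists L" using w by auto
    have "lv a \<otimes> ev w = (lv a \<otimes> lv (inv_letter a)) \<otimes> ev w'"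
      using l assms(1) by (simp add: w' ev_Cons m_assoc letter_closed)
    also have "lv a \<otimes> lv (inv_letter a) = \<one>"
      using letter_inverse[of "inv_letter a"] l assms(1) by simp
    finally show ?thesis using l by (simp add: cons_letter_def w')
  qed (auto simp: cons_letter_def ev_Cons)
qed

lemma append_letter_RW:
  assumes "a \<in> L" "w \<in> RW"
  shows "append_letter a w \<in> RW" "ev (append_letter a w) = ev w \<otimes> lv a"
proof -
  have w: "w \<in> lists L" "reduced_word w" using assms(2) by (auto simp: RW_def)
  show "append_letter a w \<in> RW"
    using w assms(1) reduced_append_letter[OF w(2), of a] 
    by (cases w rule: rev_cases) (auto simp: RW_def append_letter_def)
  show "ev (append_letter a w) = ev w \<otimes> lv a"
  proof (cases "w \<noteq> [] \<and> last w = inv_letter a")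
    case True
    then obtain w' where w': "w = w' @ [inv_letter a]" by (cases w rule: rev_cases) auto
    then have l: "inv_letter a \<in> L" "w' \<in> lists L" using w by auto
    have "ev w \<otimes> lv a = ev w' \<otimes> (lv (inv_letter a) \<otimes> lv a)"
      using l assms(1) by (simp add: w' ev_append m_assoc letter_closed)
    also have "lv (inv_letter a) \<otimes> lv a = \<one>"
      using letter_inverse[of a] l assms(1) by simp
    finally show ?thesis using l by (simp add: append_letter_def w')
  next
    case False
    then show ?thesis using w assms(1) by (auto simp: append_letter_def ev_append)
  qed
qed

lemma reduce_word: "w \<in> lists L \<Longrightarrow> \<exists>w'\<in>RW. ev w' = ev w \<and> length w' \<le> length w"
proof (induction w)
  case Nil
  then show ?case by (intro bexI[of _ "[]"]) (auto simp: RW_def)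
next
  case (Cons a w)
  then obtain w' where w': "w' \<in> RW" "ev w' = ev w" "length w' \<le> length w" by auto
  then show ?case using Cons.prems cons_letter_RW[of a w'] length_cons_letter[of a w']
    by (intro bexI[of _ "cons_letter a w'"]) (auto simp: ev_Cons)
qed

lemma word_length_ev:
  assumes "w \<in> RW" shows "word_length G (gen_set G s r) (ev w) = length w"
  unfolding word_length_def
proof (rule Least_equality)
  have "map lv w \<in> lists (gen_set G s r)" using RW_lists[OF assms] unfolding gen_set_eq lists_image by blast
  then show "\<exists>ws\<in>lists (gen_set G s r). length ws = length w \<and> list_mult G ws = ev w"
    by (intro bexI[of _ "map lv w"]) (auto simp: ev_def)
  fix n assume "\<exists>ws\<in>lists (gen_set G s r). length ws = n \<and> list_mult G ws = ev w"
  then obtain ws where ws: "ws \<in> lists (gen_set G s r)" "length ws = n" "list_mult G ws = ev w" by blast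
  from ws(1) obtain ls where ls: "ls \<in> lists L" "ws = map lv ls"
    unfolding gen_set_eq lists_image by auto
  obtain w' where "w' \<in> RW" "ev w' = ev ls" "length w' \<le> length ls" using reduce_word[OF ls(1)] by blast
  moreover from this have "w' = w" using ws(3) ls(2) assms by (intro ev_inj) (auto simp: ev_def)
  ultimately show "length w \<le> n" using ws(2) ls(2) by simp
qed

lemma word_ball_eq: "word_ball G (gen_set G s r) n = ev ` word_ball_over L n"
proof -
  have "word_ball G (gen_set G s r) n = {g \<in> ev ` RW. word_length G (gen_set G s r) g \<le> n}"
    by (simp add: word_ball_def ev_image)
  also have "\<dots> = ev ` {w \<in> RW. length w \<le> n}"
    using word_length_ev by force
  also have "{w \<in> RW. length w \<le> n} = word_ball_over L n"
    by (auto simp: word_ball_over_def RW_def)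
  finally show ?thesis .
qed

text \<open>The only edge of the left-Cayley graph leaving the branch of words with suffix \<open>a # v\<close> is the one
  between \<open>a # v\<close> and \<open>v\<close>: any other left multiplication by a letter stays inside the branch.\<close>

lemma path_meets_branch_point:
  assumes v: "a # v \<in> RW"
    and "set p \<subseteq> carrier G" "successively (cayley_adj G (gen_set G s r)) p" "p \<noteq> []"
    and "last p \<in> ev ` {f \<in> RW. \<exists>y. f = y @ a # v}" "hd p \<notin> ev ` {f \<in> RW. \<exists>y. f = y @ a # v}"
  shows "ev v \<in> set p"
  using assms(2-)
proof (induction p rule: induct_list012)
  case (3 x y q)
  let ?D = "{f \<in> RW. \<exists>y. f = y @ a # v}"
  show ?case
  proof (cases "y \<in> ev ` ?D")
    case False
    then have "ev v \<in> set (y # q)" using 3 by (intro "3.IH"(2)) auto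
    then show ?thesis by simp
  next
    case True
    then obtain z where z: "z @ a # v \<in> RW" "y = ev (z @ a # v)" by blast
    let ?g = "z @ a # v"
    obtain f where f: "f \<in> RW" "x = ev f" using "3.prems"(1) ev_surj[of x] by auto
    have fD: "f \<notin> ?D" using "3.prems"(5) f by auto
    have "cayley_adj G (gen_set G s r) x y" using "3.prems"(2) by simp
    then obtain t where t: "t \<in> L" "y = lv t \<otimes> x \<or> x = lv t \<otimes> y"
      unfolding cayley_adj_def gen_set_eq by auto
    have "?g = cons_letter t f \<or> f = cons_letter t ?g"
      using t f z ev_inj cons_letter_RW by metis
    then have "f = v"
    proof
      assume g: "?g = cons_letter t f"
      show "f = v"
      proof (cases "f \<noteq> [] \<and> hd f = inv_letter t")
        case True
        then have "f = inv_letter t # ?g" using g by (cases f) (auto simp: cons_letter_def)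
        then have "f = (inv_letter t # z) @ a # v" by simp
        with fD f(1) show ?thesis by blast
      next
        case False
        then have "z @ a # v = t # f" using g by (auto simp: cons_letter_def)
        then show ?thesis using fD f(1) by (cases z) auto
      qed
    next
      assume g: "f = cons_letter t ?g"
      show "f = v"
      proof (cases "hd ?g = inv_letter t")
        case True
        then have "f = tl ?g" using g by (auto simp: cons_letter_def)
        then show ?thesis using fD f(1) by (cases z) auto
      next
        case False
        then have "f = (t # z) @ a # v" using g by (auto simp: cons_letter_def)
        with fD f(1) show ?thesis by blast
      qed
    qed
    then show ?thesis using f by simp
  qed
qed auto

lemma avoids_suffix_past:
  assumes "a # v \<in> RW" "f \<in> RW" "\<And>y. f \<noteq> y @ a # v"
  shows "ev f \<in> past G (gen_set G s r) (ev (a # v)) (ev v)"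
  unfolding past_def cayley_path_def
proof (intro CollectI conjI allI impI)
  show "ev f \<in> carrier G" using assms(2) by (simp add: RW_lists)
  fix p
  assume p: "p \<noteq> [] \<and> set p \<subseteq> carrier G \<and> hd p = ev f \<and> last p = ev (a # v) \<and>
    successively (cayley_adj G (gen_set G s r)) p"
  show "ev v \<in> set p"
  proof (rule path_meets_branch_point[OF assms(1)])
    show "last p \<in> ev ` {f \<in> RW. \<exists>y. f = y @ a # v}"
      using p assms(1) by (auto intro!: imageI exI[of _ "[]"])
    show "hd p \<notin> ev ` {f \<in> RW. \<exists>y. f = y @ a # v}"
      using p assms(2,3) ev_inj by auto
  qed (use p in auto)
qed

end

lemma free_words_group:
  assumes "1 \<le> r" "free_group_on G s r"
  shows "free_words G s r ({1..r} \<times> UNIV)"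
proof -
  have g: "group G" and s: "s \<in> {1..r} \<rightarrow> carrier G"
    and b: "bij_betw (\<lambda>w. list_mult G (map (letter_value G s) w)) (reduced_words r) (carrier G)"
    using assms(2) by (auto simp: free_group_on_def)
  interpret group G by (rule g)
  have c: "letter_value G s a \<in> carrier G" if "a \<in> {1..r} \<times> UNIV" for a
    using that s by (cases a) auto
  have e: "gen_set G s r = letter_value G s ` ({1..r} \<times> UNIV)"
  proof -
    have "{1..r} \<times> (UNIV :: bool set) = (\<lambda>i. (i, True)) ` {1..r} \<union> (\<lambda>i. (i, False)) ` {1..r}"
      by (auto simp: image_iff)
    then show ?thesis using g by (simp add: gen_set_def image_Un image_image)
  qed
  show ?thesis
  proof
    show "letter_value G s (inv_letter a) \<otimes>\<^bsub>G\<^esub> letter_value G s a = \<one>\<^bsub>G\<^esub>" if "a \<in> {1..r} \<times> UNIV" for a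
      using that s by (cases a) (auto simp: inv_letter_def Pi_iff)
    show "bij_betw (\<lambda>w. list_mult G (map (letter_value G s) w)) {w \<in> lists ({1..r} \<times> UNIV). reduced_word w} (carrier G)"
      using b unfolding reduced_words_def reduced_word_def inv_letter_eq_iff by (simp only: mem_Collect_eq)
  qed (use assms(1) c e in auto)
qed

text \<open>An inverse of the first generator would be a word \<open>w\<close> with \<open>1 # w\<close> equal to the empty word.\<close>

lemma free_semigroup_not_group:
  assumes "1 \<le> r" "free_semigroup_on G s r" shows "\<not> group G"
proof
  assume "group G"
  then interpret group G .
  have s: "s \<in> {1..r} \<rightarrow> carrier G"
    and b: "bij_betw (\<lambda>w. list_mult G (map s w)) (lists {1..r}) (carrier G)"
    using assms(2) by (auto simp: free_semigroup_on_def)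
  have s1: "s 1 \<in> carrier G" using s assms(1) by auto
  then obtain w where w: "w \<in> lists {1..r}" "list_mult G (map s w) = inv\<^bsub>G\<^esub> (s 1)"
    using b unfolding bij_betw_def by (metis (no_types, lifting) image_iff inv_closed)
  have "list_mult G (map s (1 # w)) = list_mult G (map s [])"
    using w s1 by (simp add: list_mult_def)
  moreover have "1 # w \<in> lists {1..r}" "[] \<in> lists {1..r}" using w(1) assms(1) by auto
  ultimately have "1 # w = []" by (rule inj_onD[OF bij_betw_imp_inj_on[OF b]])
  then show False by simp
qed

lemma free_words_semigroup:
  assumes "1 \<le> r" "free_semigroup_on G s r"
  shows "free_words G s r ({1..r} \<times> {True})"
proof -
  have m: "monoid G" and s: "s \<in> {1..r} \<rightarrow> carrier G"
    and b: "bij_betw (\<lambda>w. list_mult G (map s w)) (lists {1..r}) (carrier G)"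
    using assms(2) by (auto simp: free_semigroup_on_def)
  have ng: "\<not> group G" by (rule free_semigroup_not_group[OF assms])
  have red: "reduced_word w" if "w \<in> lists ({1..r} \<times> {True})" for w
    using that
  proof (induction w)
    case (Cons a w)
    then show ?case by (cases w) (auto simp: reduced_Cons inv_letter_def)
  qed simp
  have "bij_betw (map fst) (lists ({1..r} \<times> {True})) (lists {1..r})"
  proof (rule bij_betw_byWitness[where f'="map (\<lambda>i. (i, True))"])
    show "\<forall>w\<in>lists ({1..r} \<times> {True}). map (\<lambda>i. (i, True)) (map fst w) = w"
      by (auto intro!: map_idI)
    show "\<forall>w\<in>lists {1..r}. map fst (map (\<lambda>i. (i, True)) w) = w" by (simp add: comp_def)
    show "map fst ` lists ({1..r} \<times> {True}) \<subseteq> lists {1..r}"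
      unfolding lists_image[symmetric] by (rule lists_mono) auto
    show "map (\<lambda>i. (i, True)) ` lists {1..r} \<subseteq> lists ({1..r} \<times> {True})"
      unfolding lists_image[symmetric] by (rule lists_mono) auto
  qed
  from bij_betw_trans[OF this b]
  have "bij_betw (\<lambda>w. list_mult G (map s (map fst w))) (lists ({1..r} \<times> {True})) (carrier G)"
    by (simp add: comp_def)
  also have "?this \<longleftrightarrow> bij_betw (\<lambda>w. list_mult G (map (letter_value G s) w)) (lists ({1..r} \<times> {True})) (carrier G)"
  proof (rule bij_betw_cong)
    fix w assume w: "w \<in> lists ({1..r} \<times> {True})"
    have "map s (map fst w) = map (letter_value G s) w"
      unfolding map_map using w by (intro map_cong refl) force
    then show "list_mult G (map s (map fst w)) = list_mult G (map (letter_value G s) w)"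
      by (rule arg_cong)
  qed
  also have "lists ({1..r} \<times> {True}) = {w \<in> lists ({1..r} \<times> {True}). reduced_word w}" using red by blast
  finally have bij: "bij_betw (\<lambda>w. list_mult G (map (letter_value G s) w)) {w \<in> lists ({1..r} \<times> {True}). reduced_word w} (carrier G)" .
  show ?thesis
  proof (rule free_words.intro)
    show "monoid G" "1 \<le> r" by (fact m assms(1))+
    show "bij_betw (\<lambda>w. list_mult G (map (letter_value G s) w)) {w \<in> lists ({1..r} \<times> {True}). reduced_word w} (carrier G)"
      by (rule bij)
    show "letter_value G s (inv_letter a) \<otimes>\<^bsub>G\<^esub> letter_value G s a = \<one>\<^bsub>G\<^esub>"
      if "a \<in> {1..r} \<times> {True}" "inv_letter a \<in> {1..r} \<times> {True}" for a
      using that by (auto simp: inv_letter_def)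
    show "letter_value G s a \<in> carrier G" if "a \<in> {1..r} \<times> {True}" for a
      using that s by auto
    show "gen_set G s r = letter_value G s ` ({1..r} \<times> {True})"
    proof -
      have "{1..r} \<times> {True} = (\<lambda>i. (i, True)) ` {1..r}" by auto
      then show ?thesis using ng by (simp only: gen_set_def if_False image_image letter_value.simps if_True)
    qed
  qed auto
qed

section \<open>The process as a Markov chain on the tree of words\<close>

text \<open>The last assumption says that inverse letters occur only for groups, where the reversibility part
  of invariance is available.\<close>

locale markov_process = free_words G s r L + prob_space \<mu>
  for G :: "('g, 'm) monoid_scheme" (structure) and s r L and \<mu> :: "('g \<Rightarrow> 'k) measure" +
  fixes K :: "'k set" and P :: "'g \<Rightarrow> 'k \<Rightarrow> 'k \<Rightarrow> real" and p :: "'k \<Rightarrow> real"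
  assumes countable_K: "countable K"
    and invariant: "invariant_system G (gen_set G s r) K P p"
    and induced: "induced_measure G (gen_set G s r) K P p \<mu>"
    and inv_letter_group: "a \<in> L \<Longrightarrow> inv_letter a \<in> L \<Longrightarrow> group G"
begin

definition cyl :: "letter list set \<Rightarrow> (letter list \<Rightarrow> 'k) \<Rightarrow> ('g \<Rightarrow> 'k) set" where
  "cyl W c = {x \<in> space \<mu>. \<forall>w\<in>W. x (ev w) = c w}"

definition U :: "letter \<Rightarrow> ('g \<Rightarrow> 'k) \<Rightarrow> 'g \<Rightarrow> 'k" where
  "U a = shift_action G (lv a)"

lemma sets_mu: "sets \<mu> = sigma_sets (carrier G \<rightarrow>\<^sub>E K) {V. openin (config_topology G K) V}"
  using induced by (simp add: induced_measure_def)

lemma topspace_config: "topspace (config_topology G K) = carrier G \<rightarrow>\<^sub>E K"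
  by (simp add: config_topology_def)

lemma space_mu: "space \<mu> = carrier G \<rightarrow>\<^sub>E K"
proof (rule equalityI)
  have sub: "{V. openin (config_topology G K) V} \<subseteq> Pow (carrier G \<rightarrow>\<^sub>E K)"
    using openin_subset topspace_config by blast
  have "space \<mu> \<in> sigma_sets (carrier G \<rightarrow>\<^sub>E K) {V. openin (config_topology G K) V}"
    unfolding sets_mu[symmetric] by (rule sets.top)
  then show "space \<mu> \<subseteq> carrier G \<rightarrow>\<^sub>E K" by (rule sigma_sets_into_sp[OF sub])
  have "(carrier G \<rightarrow>\<^sub>E K) \<in> sets \<mu>" unfolding sets_mu by (rule sigma_sets_top)
  then show "(carrier G \<rightarrow>\<^sub>E K) \<subseteq> space \<mu>" by (rule sets.sets_into_space)
qed

lemma coordinate_event: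
  assumes "g \<in> carrier G" shows "{x \<in> space \<mu>. x g = k} \<in> sets \<mu>"
proof -
  have "openin (config_topology G K) {x \<in> topspace (config_topology G K). x g \<in> {k} \<inter> K}"
    unfolding config_topology_def
    by (rule openin_continuous_map_preimage[OF continuous_map_product_projection[OF assms]]) auto
  also have "{x \<in> topspace (config_topology G K). x g \<in> {k} \<inter> K} = {x \<in> space \<mu>. x g = k}"
    unfolding topspace_config space_mu using assms by (auto simp: PiE_iff)
  finally show ?thesis unfolding sets_mu by (intro sigma_sets.Basic) simp
qed

lemma coordinate_in_K: "x \<in> space \<mu> \<Longrightarrow> g \<in> carrier G \<Longrightarrow> x g \<in> K"
  by (auto simp: space_mu PiE_iff)

lemma observable_coordinate: "g \<in> carrier G \<Longrightarrow> observable \<mu> (\<lambda>x. x g)"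
  unfolding observable_def
  using coordinate_event coordinate_in_K countable_K by (auto intro: countable_subset[of _ K])

lemma cyl_sets: "finite W \<Longrightarrow> W \<subseteq> lists L \<Longrightarrow> cyl W c \<in> sets \<mu>"
  unfolding cyl_def by (intro sets.sets_Collect_finite_All coordinate_event ev_closed) blast+

lemma shift_in_space: "g \<in> carrier G \<Longrightarrow> x \<in> space \<mu> \<Longrightarrow> shift_action G g x \<in> space \<mu>"
  by (auto simp: space_mu shift_action_def PiE_iff)

lemma shift_in_cylinder:
  "g \<in> carrier G \<Longrightarrow> x \<in> space \<mu> \<Longrightarrow> shift_action G g x \<in> cylinder G K k \<longleftrightarrow> x g = k"
  using shift_in_space[of g x] by (auto simp: cylinder_def space_mu shift_action_def)

lemma prob_coordinate_one:
  assumes "k \<in> K" shows "prob {x \<in> space \<mu>. x \<one> = k} = p k"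
  using induced assms by (simp add: induced_measure_def cylinder_def space_mu)

text \<open>The Markov property in terms of words. The words of \<open>W\<close> other than \<open>v\<close> serve as the points of the
  past in the conditional probability defining the process; null conditioning events are covered
  because then both sides vanish.\<close>

lemma prob_cyl_insert:
  assumes v: "u # v \<in> RW" and W: "finite W" "W \<subseteq> RW" "v \<in> W" "avoids_suffix (u # v) W"
    and cK: "c (u # v) \<in> K"
  shows "prob (cyl (insert (u # v) W) c) = P (lv u) (c v) (c (u # v)) * prob (cyl W c)"
proof (cases "\<forall>w\<in>W. c w \<in> K")
  case False
  then obtain w where w: "w \<in> W" "c w \<notin> K" by blast
  then have "ev w \<in> carrier G" using W(2) by (intro ev_closed RW_lists) auto
  then have "x (ev w) \<noteq> c w" if "x \<in> space \<mu>" for x using coordinate_in_K[OF that] w(2) by metis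
  then have "cyl W c = {}" "cyl (insert (u # v) W) c = {}" using w(1) unfolding cyl_def by auto
  then show ?thesis by simp
next
  case True
  define S where "S = gen_set G s r"
  define F where "F = ev ` (W - {v})"
  define d where "d = (\<lambda>g. c (inv_into RW ev g))"
  have u: "u \<in> L" and vR: "v \<in> RW" using v W by (auto simp: RW_def)
  have inj: "inj_on ev RW" by (rule inj_onI) (rule ev_inj)
  have d: "d (ev w) = c w" if "w \<in> RW" for w unfolding d_def using inv_into_f_f[OF inj that] by simp
  have evu: "lv u \<otimes> ev v = ev (u # v)" by (simp add: ev_Cons)
  have uS: "lv u \<in> S" using u by (simp add: S_def gen_set_eq)
  have len: "word_length G S (lv u \<otimes> ev v) = word_length G S (ev v) + 1"
    unfolding evu S_def using word_length_ev[OF v] word_length_ev[OF vR] by simp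
  have F: "finite F" "F \<subseteq> past G S (lv u \<otimes> ev v) (ev v) - {ev v}"
  proof -
    show "finite F" using W(1) by (simp add: F_def)
    have in_past: "ev w \<in> past G S (lv u \<otimes> ev v) (ev v)" if "w \<in> W" for w
      unfolding evu S_def using that W by (intro avoids_suffix_past v) (auto simp: avoids_suffix_def)
    have neq: "ev w \<noteq> ev v" if "w \<in> W - {v}" for w
      using that W(2) vR ev_inj[of w v] by auto
    show "F \<subseteq> past G S (lv u \<otimes> ev v) (ev v) - {ev v}"
    proof
      fix f assume "f \<in> F"
      then obtain w where "w \<in> W - {v}" "f = ev w" by (auto simp: F_def)
      then show "f \<in> past G S (lv u \<otimes> ev v) (ev v) - {ev v}" using in_past neq by simp
    qed
  qed
  have dF: "d \<in> F \<rightarrow> K" using True W(2) d by (auto simp: F_def)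
  have car: "ev w \<in> carrier G" if "w \<in> insert (u # v) W" for w
    using that v W(2) by (intro ev_closed RW_lists) auto
  have Q: "{x \<in> space \<mu>. shift_action G (ev v) x \<in> cylinder G K (c v) \<and> (\<forall>f\<in>F. shift_action G f x \<in> cylinder G K (d f))} = cyl W c" (is "?Q = _")
  proof -
    have "?Q = {x \<in> space \<mu>. x (ev v) = c v \<and> (\<forall>w\<in>W - {v}. x (ev w) = c w)}"
      using W(2,3) car d unfolding F_def by (auto simp: shift_in_cylinder subset_iff)
    also have "\<dots> = cyl W c" unfolding cyl_def using W(3) by blast
    finally show ?thesis .
  qed
  have PQ: "{x \<in> space \<mu>. shift_action G (lv u \<otimes> ev v) x \<in> cylinder G K (c (u # v)) \<and>
      (shift_action G (ev v) x \<in> cylinder G K (c v) \<and> (\<forall>f\<in>F. shift_action G f x \<in> cylinder G K (d f)))} = cyl (insert (u # v) W) c" (is "?PQ = _")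
  proof -
    have "?PQ = {x \<in> ?Q. x (ev (u # v)) = c (u # v)}"
      using car[of "u # v"] unfolding evu by (auto simp: shift_in_cylinder)
    then show ?thesis unfolding Q cyl_def by auto
  qed
  show ?thesis
  proof (cases "prob (cyl W c) > 0")
    case False
    then have "prob (cyl W c) = 0" using measure_nonneg[of \<mu> "cyl W c"] by linarith
    moreover have "prob (cyl (insert (u # v) W) c) \<le> prob (cyl W c)"
      using W RW_lists by (intro finite_measure_mono cyl_sets) (auto simp: cyl_def)
    ultimately show ?thesis using measure_nonneg[of \<mu> "cyl (insert (u # v) W) c"] by simp
  next
    case pos: True
    have "\<P>(x in \<mu>. shift_action G (lv u \<otimes> ev v) x \<in> cylinder G K (c (u # v)) \<bar>
         shift_action G (ev v) x \<in> cylinder G K (c v) \<and> (\<forall>f\<in>F. shift_action G f x \<in> cylinder G K (d f)))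
       = P (lv u) (c v) (c (u # v))"
    proof -
      have "\<forall>g\<in>carrier G. \<forall>t\<in>S. word_length G S (t \<otimes> g) = word_length G S g + 1 \<longrightarrow>
       (\<forall>F c k k0. finite F \<and> F \<subseteq> past G S (t \<otimes> g) g - {g} \<and> c \<in> F \<rightarrow> K \<and> k \<in> K \<and> k0 \<in> K \<longrightarrow>
         \<P>(x in \<mu>. shift_action G g x \<in> cylinder G K k0 \<and> (\<forall>f\<in>F. shift_action G f x \<in> cylinder G K (c f))) > 0 \<longrightarrow>
         \<P>(x in \<mu>. shift_action G (t \<otimes> g) x \<in> cylinder G K k \<bar>
                   shift_action G g x \<in> cylinder G K k0 \<and> (\<forall>f\<in>F. shift_action G f x \<in> cylinder G K (c f)))
           = P t k0 k)"
        using induced unfolding induced_measure_def S_def[symmetric] by (elim conjE)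
      from this[rule_format, OF car[of v] uS len, of F d "c (u # v)" "c v"]
      show ?thesis using F dF cK True W(3) pos unfolding Q by simp
    qed
    then show ?thesis unfolding cond_prob_def Q PQ using pos by (simp add: field_simps)
  qed
qed

lemma prob_transition:
  assumes "u \<in> L" "i \<in> K" "j \<in> K"
  shows "prob {x \<in> space \<mu>. x \<one> = i \<and> x (lv u) = j} = p i * P (lv u) i j"
proof -
  define c where "c w = (if w = [] then i else j)" for w :: "letter list"
  have "prob (cyl (insert [u] {[]}) c) = P (lv u) (c []) (c [u]) * prob (cyl {[]} c)"
    by (rule prob_cyl_insert) (use assms in \<open>auto simp: RW_def avoids_suffix_def c_def\<close>)
  moreover have "cyl {[]} c = {x \<in> space \<mu>. x \<one> = i}" by (auto simp: cyl_def c_def)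
  moreover have "cyl (insert [u] {[]}) c = {x \<in> space \<mu>. x \<one> = i \<and> x (lv u) = j}"
    using assms by (auto simp: cyl_def c_def)
  ultimately show ?thesis using prob_coordinate_one[OF assms(2)] by (simp add: c_def)
qed

text \<open>The invariance condition for inverses, with the group inverse of a letter expressed as a letter.\<close>

lemma reversibility:
  assumes "a \<in> L" "inv_letter a \<in> L" "i \<in> K" "j \<in> K"
  shows "p i * P (lv (inv_letter a)) i j = p j * P (lv a) j i"
proof -
  have g: "group G" using assms by (intro inv_letter_group)
  interpret group G by (rule g)
  have "inv (lv a) = lv (inv_letter a)"
    using assms letter_inverse letter_closed by (intro inv_equality) auto
  moreover have "p i * P (inv (lv a)) i j = p j * P (lv a) j i"
    using invariant g assms unfolding invariant_system_def gen_set_eq by blast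
  ultimately show ?thesis by simp
qed

lemma prob_coordinate_letter:
  assumes "t \<in> L" "k \<in> K" shows "prob {x \<in> space \<mu>. x (lv t) = k} = p k"
proof -
  have "((\<lambda>i. prob {x \<in> {x \<in> space \<mu>. x (lv t) = k}. x \<one> = i}) has_sum prob {x \<in> space \<mu>. x (lv t) = k}) K"
    using assms coordinate_in_K
    by (intro prob_split_has_sum observable_coordinate coordinate_event letter_closed) auto
  moreover have "prob {x \<in> {x \<in> space \<mu>. x (lv t) = k}. x \<one> = i} = p i * P (lv t) i k" if "i \<in> K" for i
  proof -
    have "{x \<in> {x \<in> space \<mu>. x (lv t) = k}. x \<one> = i} = {x \<in> space \<mu>. x \<one> = i \<and> x (lv t) = k}" by auto
    then show ?thesis using prob_transition[OF assms(1) that assms(2)] by simp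
  qed
  ultimately have "((\<lambda>i. p i * P (lv t) i k) has_sum prob {x \<in> space \<mu>. x (lv t) = k}) K"
    by (simp cong: has_sum_cong)
  moreover have "((\<lambda>i. p i * P (lv t) i k) has_sum p k) K"
    using invariant assms unfolding invariant_system_def gen_set_eq by blast
  ultimately show ?thesis by (rule has_sum_unique)
qed

end

section \<open>Shift invariance of the measure\<close>

context markov_process
begin

lemma cyl_notin: "w \<in> W \<Longrightarrow> w \<in> RW \<Longrightarrow> c w \<notin> K \<Longrightarrow> cyl W c = {}"
  using coordinate_in_K[OF _ ev_closed[OF RW_lists]] unfolding cyl_def by fastforce

text \<open>The endpoints of the edge whose direction right multiplication by \<open>t\<close> reverses; without an inverse
  of \<open>t\<close> only the root remains.\<close>

definition invariance_base :: "letter \<Rightarrow> letter list set" where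
  "invariance_base t = insert [] (if inv_letter t \<in> L then {[inv_letter t]} else {})"

text \<open>On the reversed edge the two cylinder probabilities agree by reversibility. If \<open>t\<close> has no inverse,
  only the law at the letter \<open>t\<close> is concerned, which is \<open>p\<close> because \<open>p\<close> is stationary.\<close>

lemma prob_shift_cyl_base:
  assumes t: "t \<in> L" and W: "W = invariance_base t"
    and d: "\<And>w. w \<in> RW \<Longrightarrow> d (append_letter t w) = c w"
  shows "prob (cyl (append_letter t ` W) d) = prob (cyl W c)"
proof (cases "inv_letter t \<in> L")
  case False
  then have "W = {[]}" by (auto simp: W invariance_base_def split: if_splits)
  moreover have "d [t] = c []" using d[of "[]"] by (simp add: RW_def append_letter_def)
  ultimately have e: "cyl (append_letter t ` W) d = {x \<in> space \<mu>. x (lv t) = c []}" "cyl W c = {x \<in> space \<mu>. x \<one> = c []}"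
    using t by (auto simp: cyl_def append_letter_def)
  show ?thesis
  proof (cases "c [] \<in> K")
    case True
    then show ?thesis unfolding e using prob_coordinate_letter[OF t True] prob_coordinate_one[OF True] by simp
  next
    case False
    then have "cyl (append_letter t ` W) d = {}" "cyl W c = {}"
      unfolding e using coordinate_in_K[OF _ letter_closed[OF t]] coordinate_in_K[OF _ one_closed] by fastforce+
    then show ?thesis by simp
  qed
next
  case True
  then have WW: "W = {[], [inv_letter t]}" by (auto simp: W invariance_base_def split: if_splits)
  define i where "i = c []"
  define j where "j = c [inv_letter t]"
  have "d [t] = i" using d[of "[]"] by (simp add: RW_def append_letter_def i_def)
  moreover have "d [] = j" using d[of "[inv_letter t]"] True by (simp add: RW_def append_letter_def j_def)
  ultimately have e: "cyl (append_letter t ` W) d = {x \<in> space \<mu>. x \<one> = j \<and> x (lv t) = i}"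
    "cyl W c = {x \<in> space \<mu>. x \<one> = i \<and> x (lv (inv_letter t)) = j}"
    using t True by (auto simp: cyl_def append_letter_def WW i_def j_def)
  show ?thesis
  proof (cases "i \<in> K \<and> j \<in> K")
    case ij: True
    have "p i * P (lv (inv_letter t)) i j = p j * P (lv t) j i"
      using ij by (intro reversibility t True) auto
    then show ?thesis unfolding e using prob_transition[OF t, of j i] prob_transition[OF True, of i j] ij by simp
  next
    case False
    then have "cyl (append_letter t ` W) d = {}" "cyl W c = {}"
      unfolding e using coordinate_in_K[OF _ letter_closed[OF t]] coordinate_in_K[OF _ letter_closed[OF True]] coordinate_in_K[OF _ one_closed]
      by fastforce+
    then show ?thesis by simp
  qed
qed

text \<open>For a longest word \<open>u # v\<close> outside the base, both probabilities contain the same transition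
  probability as a factor: right multiplication by \<open>t\<close> maps the edge from \<open>v\<close> to \<open>u # v\<close> to an edge with the same
  letter \<open>u\<close>.\<close>

lemma prob_shift_cyl:
  assumes t: "t \<in> L" and "finite W" "W \<subseteq> RW" "suffix_closed W" "invariance_base t \<subseteq> W"
    and d: "\<And>w. w \<in> RW \<Longrightarrow> d (append_letter t w) = c w"
  shows "prob (cyl (append_letter t ` W) d) = prob (cyl W c)"
  using assms(2-5)
proof (induction "card (W - invariance_base t)" arbitrary: W)
  case 0
  then have "W = invariance_base t" by auto
  then show ?case using prob_shift_cyl_base[where d=d and c=c, OF t _ d] by simp
next
  case (Suc n)
  let ?B = "invariance_base t" and ?\<rho> = "append_letter t"
  have "card (W - ?B) \<noteq> 0" using Suc.hyps(2) by simp
  then have fin: "finite (W - ?B)" "W - ?B \<noteq> {}" unfolding card_eq_0_iff by blast+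
  obtain z where z: "z \<in> W - ?B" and zmax: "\<And>w. w \<in> W - ?B \<Longrightarrow> length w \<le> length z"
    using longest_word[OF fin] by blast
  have "z \<noteq> []" using z by (auto simp: invariance_base_def split: if_splits)
  then obtain u v where uv: "z = u # v" by (cases z) auto
  have zR: "u # v \<in> RW" using z Suc.prems(2) uv by auto
  have zt: "u # v \<noteq> [inv_letter t]"
  proof
    assume e: "u # v = [inv_letter t]"
    then have "inv_letter t \<in> L" using zR by (auto simp: RW_def)
    with e z uv show False by (auto simp: invariance_base_def split: if_splits)
  qed
  define V where "V = W - {z}"
  have "v \<in> W" using Suc.prems(3) z unfolding suffix_closed_def uv by blast
  then have vV: "v \<in> V" by (simp add: V_def uv)
  have V: "finite V" "V \<subseteq> RW" "?B \<subseteq> V" using Suc.prems z by (auto simp: V_def)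
  have WV: "W = insert (u # v) V" using z uv by (auto simp: V_def)
  have av: "avoids_suffix (u # v) V"
    unfolding avoids_suffix_def
  proof (intro allI notI)
    fix y assume y: "y @ u # v \<in> V"
    show False
    proof (cases "y @ u # v \<in> ?B")
      case True
      then have "y = [] \<and> u # v = [inv_letter t]" by (auto simp: invariance_base_def append_eq_Cons_conv split: if_splits)
      with zt show False by simp
    next
      case False
      with y have "length (y @ u # v) \<le> length z" by (intro zmax) (auto simp: V_def)
      then have "y = []" using uv by simp
      with y uv show False by (simp add: V_def)
    qed
  qed
  have sc: "suffix_closed V"
    unfolding suffix_closed_def
  proof (intro allI impI)
    fix w a assume aw: "a # w \<in> V"
    then have "w \<in> W" using Suc.prems(3) unfolding suffix_closed_def V_def by blast
    moreover have "w \<noteq> z" using av aw uv unfolding avoids_suffix_def by (metis append_Cons append_Nil)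
    ultimately show "w \<in> V" by (simp add: V_def)
  qed
  have card: "n = card (V - ?B)"
  proof -
    have "V - ?B = (W - ?B) - {z}" by (auto simp: V_def)
    then show ?thesis using Suc.hyps(2) z fin by simp
  qed
  have IH: "prob (cyl (?\<rho> ` V) d) = prob (cyl V c)"
    by (rule Suc.hyps(1)[OF card V(1,2) sc V(3)])
  have uL: "u \<in> L" and vR: "v \<in> RW" using zR V(2) vV by (auto simp: RW_def)
  have \<rho>z: "?\<rho> (u # v) = u # ?\<rho> v" using zt RW_reduced[OF zR] by (rule append_letter_Cons)
  have \<rho>R: "?\<rho> w \<in> RW" if "w \<in> RW" for w using append_letter_RW(1)[OF t that] .
  have dz: "d (u # ?\<rho> v) = c (u # v)" using d[OF zR] \<rho>z by simp
  show ?case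
  proof (cases "c (u # v) \<in> K")
    case False
    have "cyl W c = {}" using False zR WV by (intro cyl_notin[of "u # v"]) auto
    moreover have "cyl (?\<rho> ` W) d = {}"
      using False \<rho>R[OF zR] WV dz \<rho>z by (intro cyl_notin[of "u # ?\<rho> v"]) auto
    ultimately show ?thesis by simp
  next
    case True
    have 1: "prob (cyl W c) = P (lv u) (c v) (c (u # v)) * prob (cyl V c)"
      unfolding WV by (rule prob_cyl_insert[OF zR V(1,2) vV av]) (rule True)
    have "avoids_suffix (?\<rho> (u # v)) (?\<rho> ` V)"
      using V(2) RW_reduced zR zt av by (intro avoids_suffix_append_letter) auto
    then have "prob (cyl (insert (u # ?\<rho> v) (?\<rho> ` V)) d) = P (lv u) (d (?\<rho> v)) (d (u # ?\<rho> v)) * prob (cyl (?\<rho> ` V) d)"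
      using V(1,2) \<rho>R \<rho>R[OF zR] vV True dz unfolding \<rho>z by (intro prob_cyl_insert) auto
    then have "prob (cyl (?\<rho> ` W) d) = P (lv u) (c v) (c (u # v)) * prob (cyl V c)"
      unfolding WV image_insert \<rho>z dz d[OF vR] IH .
    with 1 show ?thesis by simp
  qed
qed

text \<open>Balls of radius 0 are left out, since they do not contain the invariance base.\<close>

definition ball_cylinders :: "('g \<Rightarrow> 'k) set set" where
  "ball_cylinders = {{}, space \<mu>} \<union> {cyl (word_ball_over L (Suc n)) c |n c. True}"

lemma finite_letters: "finite L"
  using L_subset by (rule finite_subset) auto

lemma finite_ball: "finite (word_ball_over L n)"
  by (rule finite_word_ball_over[OF finite_letters])

lemma cyl_ball_sets: "cyl (word_ball_over L n) c \<in> sets \<mu>"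
  by (intro cyl_sets finite_ball word_ball_over_subset)

lemma cyl_ball_Int:
  assumes "m \<le> n"
  shows "cyl (word_ball_over L m) c \<inter> cyl (word_ball_over L n) d \<in> {{}, cyl (word_ball_over L n) d}"
proof (cases "\<forall>w\<in>word_ball_over L m. c w = d w")
  case True
  then have "cyl (word_ball_over L n) d \<subseteq> cyl (word_ball_over L m) c"
    using word_ball_over_mono[OF assms] unfolding cyl_def by auto
  then show ?thesis by auto
next
  case False
  then obtain w where w: "w \<in> word_ball_over L m" "c w \<noteq> d w" by blast
  moreover have "w \<in> word_ball_over L n" using w word_ball_over_mono[OF assms] by blast
  ultimately have "cyl (word_ball_over L m) c \<inter> cyl (word_ball_over L n) d = {}" unfolding cyl_def by fastforce
  then show ?thesis by simp
qed

lemma Int_stable_ball_cylinders: "Int_stable ball_cylinders"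
proof (rule Int_stableI)
  fix A B assume A: "A \<in> ball_cylinders" and B: "B \<in> ball_cylinders"
  have sub: "C \<subseteq> space \<mu>" if "C \<in> ball_cylinders" for C
    using that by (auto simp: ball_cylinders_def cyl_def)
  show "A \<inter> B \<in> ball_cylinders"
  proof (cases "A \<in> {{}, space \<mu>} \<or> B \<in> {{}, space \<mu>}")
    case True
    then have "A \<inter> B \<in> {{}, A, B}" using sub[OF A] sub[OF B] by blast
    with A B show ?thesis by (auto simp: ball_cylinders_def)
  next
    case False
    then obtain m c n d where mn: "A = cyl (word_ball_over L (Suc m)) c" "B = cyl (word_ball_over L (Suc n)) d"
      using A B unfolding ball_cylinders_def by auto
    have "A \<inter> B \<in> {{}, A, B}"
    proof (cases "m \<le> n")
      case True
      then have "A \<inter> B \<in> {{}, B}" unfolding mn by (intro cyl_ball_Int) simp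
      then show ?thesis by blast
    next
      case False
      then have "B \<inter> A \<in> {{}, A}" unfolding mn by (intro cyl_ball_Int) simp
      then show ?thesis by (simp only: Int_commute) blast
    qed
    with A B show ?thesis by (auto simp: ball_cylinders_def)
  qed
qed

text \<open>There are only countably many ball cylinders, so an open set, being a union of some of them, is a
  countable union.\<close>

lemma sets_eq_ball_cylinders: "sets \<mu> = sigma_sets (space \<mu>) ball_cylinders"
proof (rule equalityI)
  show "sigma_sets (space \<mu>) ball_cylinders \<subseteq> sets \<mu>"
    by (intro sets.sigma_sets_subset) (use cyl_ball_sets in \<open>auto simp: ball_cylinders_def\<close>)
  let ?\<C> = "(\<Union>n. (\<lambda>c. cyl (word_ball_over L (Suc n)) c) ` (word_ball_over L (Suc n) \<rightarrow>\<^sub>E K))"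
  have cC: "countable ?\<C>"
    using countable_PiE[OF finite_ball] countable_K by (intro countable_UN countable_image) auto
  have "V \<in> sigma_sets (space \<mu>) ball_cylinders" if V: "openin (config_topology G K) V" for V
  proof -
    \<comment> \<open>an open set restricts finitely many coordinates, all of which lie in some ball\<close>
    have VS: "V = \<Union>{C \<in> ?\<C>. C \<subseteq> V}"
    proof (rule equalityI; rule subsetI)
      fix x assume x: "x \<in> V"
      have xs: "x \<in> space \<mu>" using x openin_subset[OF V] topspace_config space_mu by auto
      obtain N where N: "finite {g \<in> carrier G. N g \<noteq> K}" "x \<in> Pi\<^sub>E (carrier G) N" "Pi\<^sub>E (carrier G) N \<subseteq> V"
        using V x unfolding config_topology_def openin_product_topology_alt by auto
      define Z where "Z = {w \<in> RW. N (ev w) \<noteq> K}"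
      have fZ: "finite Z"
      proof (rule finite_imageD)
        show "finite (ev ` Z)" using N(1) by (rule finite_subset[rotated]) (auto simp: Z_def RW_lists)
        show "inj_on ev Z" by (rule inj_onI) (auto simp: Z_def intro: ev_inj)
      qed
      define n where "n = Max (insert 0 (length ` Z))"
      have n: "w \<in> word_ball_over L (Suc n)" if "w \<in> Z" for w
      proof -
        have "length w \<le> n" unfolding n_def using that fZ by (intro Max_ge) auto
        then show ?thesis using that by (auto simp: word_ball_over_def Z_def RW_def)
      qed
      let ?c = "\<lambda>w\<in>word_ball_over L (Suc n). x (ev w)"
      have sub: "cyl (word_ball_over L (Suc n)) ?c \<subseteq> Pi\<^sub>E (carrier G) N"
      proof
        fix y assume y: "y \<in> cyl (word_ball_over L (Suc n)) ?c"
        then have ys: "y \<in> space \<mu>" and ye: "\<And>w. w \<in> word_ball_over L (Suc n) \<Longrightarrow> y (ev w) = x (ev w)"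
          by (auto simp: cyl_def)
        show "y \<in> Pi\<^sub>E (carrier G) N"
        proof (rule PiE_I)
          fix g assume g: "g \<in> carrier G"
          then obtain w where w: "w \<in> RW" "ev w = g" using ev_surj by blast
          show "y g \<in> N g"
          proof (cases "w \<in> Z")
            case True
            then have "y g = x g" using ye[OF n[OF True]] w by simp
            then show ?thesis using N(2) g by auto
          next
            case False
            then have "N g = K" using w by (auto simp: Z_def)
            then show ?thesis using coordinate_in_K[OF ys g] by simp
          qed
        qed (use ys in \<open>auto simp: space_mu PiE_iff extensional_def\<close>)
      qed
      have mem: "x \<in> cyl (word_ball_over L (Suc n)) ?c" using xs by (simp add: cyl_def)
      have cE: "?c \<in> word_ball_over L (Suc n) \<rightarrow>\<^sub>E K"
      proof (rule PiE_I)
        fix w assume w: "w \<in> word_ball_over L (Suc n)"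
        have "x (ev w) \<in> K"
          by (rule coordinate_in_K[OF xs ev_closed[OF subsetD[OF word_ball_over_subset w]]])
        with w show "?c w \<in> K" by simp
      qed simp
      have "cyl (word_ball_over L (Suc n)) ?c \<in> ?\<C>" 
        by (rule UN_I[of n], simp, rule imageI, rule cE)
      moreover have "cyl (word_ball_over L (Suc n)) ?c \<subseteq> V" using sub N(3) by (rule subset_trans)
      ultimately show "x \<in> \<Union>{C \<in> ?\<C>. C \<subseteq> V}" by (intro UnionI[OF _ mem] CollectI conjI)
    next
      fix x assume "x \<in> \<Union>{C \<in> ?\<C>. C \<subseteq> V}"
      then show "x \<in> V" by (elim UnionE CollectE conjE) (rule subsetD)
    qed
    have "\<Union>{C \<in> ?\<C>. C \<subseteq> V} \<in> sigma_sets (space \<mu>) ball_cylinders"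
    proof (rule sigma_sets_UNION)
      show "countable {C \<in> ?\<C>. C \<subseteq> V}" by (rule countable_subset[OF _ cC]) blast
      fix C assume "C \<in> {C \<in> ?\<C>. C \<subseteq> V}"
      then show "C \<in> sigma_sets (space \<mu>) ball_cylinders"
        by (intro sigma_sets.Basic) (auto simp: ball_cylinders_def)
    qed
    then show ?thesis unfolding VS[symmetric] .
  qed
  then have "{V. openin (config_topology G K) V} \<subseteq> sigma_sets (space \<mu>) ball_cylinders" by blast
  then show "sets \<mu> \<subseteq> sigma_sets (space \<mu>) ball_cylinders"
    unfolding sets_mu space_mu
    by (intro sigma_sets_mono) 
qed

lemma ball_cylinders_subset: "ball_cylinders \<subseteq> sets \<mu>"
  unfolding sets_eq_ball_cylinders by (rule sigma_sets_superset_generator)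

lemma U_vimage_cyl:
  assumes "t \<in> L" "W \<subseteq> RW" "\<And>w. w \<in> RW \<Longrightarrow> d (append_letter t w) = c w"
  shows "U t -` cyl W c \<inter> space \<mu> = cyl (append_letter t ` W) d"
proof -
  have "U t x (ev w) = x (ev (append_letter t w))" if "w \<in> W" for x w
    using append_letter_RW(2)[OF assms(1), of w] that assms(2) ev_closed[OF RW_lists, of w]
    by (auto simp: U_def shift_action_def)
  moreover have "U t x \<in> space \<mu>" if "x \<in> space \<mu>" for x
    unfolding U_def using assms(1) that by (intro shift_in_space letter_closed)
  ultimately show ?thesis using assms(2,3) by (auto simp: cyl_def subset_iff)
qed

lemma U_preserves:
  assumes t: "t \<in> L" shows "preserves_measure \<mu> (U t)"
proof -
  have inj: "inj_on (append_letter t) RW"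
    using inj_on_append_letter by (rule inj_on_subset) (auto simp: RW_def)
  define d where "d c = (\<lambda>z. c (inv_into RW (append_letter t) z))" for c :: "letter list \<Rightarrow> 'k"
  have d: "d c (append_letter t w) = c w" if "w \<in> RW" for c w
    unfolding d_def using inv_into_f_f[OF inj that] by simp
  have vimage: "U t -` cyl (word_ball_over L n) c \<inter> space \<mu> = cyl (append_letter t ` word_ball_over L n) (d c)" for n c
    by (intro U_vimage_cyl t word_ball_over_RW d)
  have Usp: "U t \<in> space \<mu> \<rightarrow> space \<mu>"
    unfolding U_def using t by (auto intro!: shift_in_space letter_closed)
  have imL: "append_letter t ` word_ball_over L n \<subseteq> lists L" for n
    using append_letter_RW(1)[OF t] word_ball_over_RW RW_lists by blast
  have m: "U t \<in> \<mu> \<rightarrow>\<^sub>M \<mu>"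
  proof (rule measurable_sigma_sets[OF sets_eq_ball_cylinders _ Usp])
    show "ball_cylinders \<subseteq> Pow (space \<mu>)" using ball_cylinders_subset sets.space_closed by blast
    fix A assume "A \<in> ball_cylinders"
    then show "U t -` A \<inter> space \<mu> \<in> sets \<mu>"
    proof (unfold ball_cylinders_def, elim UnE)
      assume "A \<in> {{}, space \<mu>}"
      moreover have "U t -` space \<mu> \<inter> space \<mu> = space \<mu>" using Usp by auto
      ultimately show ?thesis by auto
    next
      assume "A \<in> {cyl (word_ball_over L (Suc n)) c |n c. True}"
      then obtain n c where "A = cyl (word_ball_over L (Suc n)) c" by blast
      then show ?thesis using vimage imL by (simp add: cyl_sets finite_ball)
    qed
  qed
  have "distr \<mu> \<mu> (U t) = \<mu>"
  proof (rule measure_eqI_generator_eq[OF Int_stable_ball_cylinders, where \<Omega>="space \<mu>" and A="\<lambda>_. space \<mu>"])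
    show "ball_cylinders \<subseteq> Pow (space \<mu>)" using ball_cylinders_subset sets.space_closed by blast
    show "sets (distr \<mu> \<mu> (U t)) = sigma_sets (space \<mu>) ball_cylinders" "sets \<mu> = sigma_sets (space \<mu>) ball_cylinders"
      by (simp_all add: sets_eq_ball_cylinders[symmetric])
    show "range (\<lambda>_. space \<mu>) \<subseteq> ball_cylinders" by (auto simp: ball_cylinders_def)
    show "emeasure (distr \<mu> \<mu> (U t)) (space \<mu>) \<noteq> \<infinity>" for i :: nat
      using m by (simp add: emeasure_distr)
    fix A assume A: "A \<in> ball_cylinders"
    have "emeasure (distr \<mu> \<mu> (U t)) A = emeasure \<mu> (U t -` A \<inter> space \<mu>)"
      using A ball_cylinders_subset m by (intro emeasure_distr) auto
    also have "\<dots> = emeasure \<mu> A"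
    proof (cases "A \<in> {{}, space \<mu>}")
      case True
      moreover have "U t -` space \<mu> \<inter> space \<mu> = space \<mu>" using Usp by auto
      ultimately show ?thesis by auto
    next
      case False
      then obtain n c where nc: "A = cyl (word_ball_over L (Suc n)) c"
        using A by (auto simp: ball_cylinders_def)
      have "prob (cyl (append_letter t ` word_ball_over L (Suc n)) (d c)) = prob (cyl (word_ball_over L (Suc n)) c)"
      proof (rule prob_shift_cyl[OF t finite_ball word_ball_over_RW])
        show "suffix_closed (word_ball_over L (Suc n))"
          by (auto simp: suffix_closed_def word_ball_over_def reduced_Cons)
        show "invariance_base t \<subseteq> word_ball_over L (Suc n)"
          by (auto simp: invariance_base_def word_ball_over_def split: if_splits)
      qed (rule d)
      then show ?thesis unfolding nc vimage by (simp add: emeasure_eq_measure)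
    qed
    finally show "emeasure (distr \<mu> \<mu> (U t)) A = emeasure \<mu> A" .
  qed auto
  with m show ?thesis by (simp add: preserves_measure_def)
qed

end

sublocale markov_process \<subseteq> letter_action \<mu> r L U
proof
  show "U (inv_letter a) (U a x) = x" if a: "a \<in> L" "inv_letter a \<in> L" and x: "x \<in> space \<mu>" for a x
  proof (rule ext)
    fix g
    show "U (inv_letter a) (U a x) g = x g"
    proof (cases "g \<in> carrier G")
      case True
      have "(g \<otimes>\<^bsub>G\<^esub> lv (inv_letter a)) \<otimes>\<^bsub>G\<^esub> lv a = g"
        using True a letter_inverse[OF a] by (simp add: m_assoc letter_closed)
      then show ?thesis using True a by (simp add: U_def shift_action_def letter_closed)
    next
      case False
      then show ?thesis using x by (simp add: U_def shift_action_def space_mu PiE_iff extensional_def)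
    qed
  qed
qed (use r_ge_1 pos_letters L_subset U_preserves in auto)

section \<open>Entropy of windows of the canonical partition\<close>

lemma avoids_suffix_if_longest:
  assumes "v \<notin> V" "\<And>w. w \<in> V \<Longrightarrow> length w \<le> length v" shows "avoids_suffix v V"
  unfolding avoids_suffix_def
proof (intro allI notI)
  fix y assume y: "y @ v \<in> V"
  then have "length (y @ v) \<le> length v" by (rule assms(2))
  then have "y = []" by simp
  with y assms(1) show False by simp
qed

text \<open>The canonical partition consists of the fibres of the coordinate at the identity, called \<open>origin\<close>.\<close>

locale finite_entropy_process = markov_process +
  assumes summable_p: "(\<lambda>i. p i * ln (p i)) summable_on K"
begin

abbreviation "origin \<equiv> (\<lambda>x :: 'a \<Rightarrow> 'c. x \<one>)"

lemma foldr_U: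
  "w \<in> lists L \<Longrightarrow> x \<in> space \<mu> \<Longrightarrow> g \<in> carrier G \<Longrightarrow> foldr U w x g = x (g \<otimes> ev w)"
proof (induction w arbitrary: g)
  case (Cons a w)
  then have "a \<in> L" "w \<in> lists L" by auto
  then show ?case using Cons
    by (simp add: U_def shift_action_def letter_closed ev_Cons m_assoc)
qed simp

lemma window_origin_eq_iff:
  assumes "W \<subseteq> lists L" "x \<in> space \<mu>" "y \<in> space \<mu>"
  shows "window origin W x = window origin W y \<longleftrightarrow> (\<forall>w\<in>W. x (ev w) = y (ev w))"
proof -
  have "foldr U w z \<one> = z (ev w)" if "w \<in> W" "z \<in> space \<mu>" for w z
  proof -
    have "w \<in> lists L" using assms(1) that(1) by blast
    then show ?thesis using foldr_U[of w z \<one>] that(2) by simp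
  qed
  then show ?thesis using assms(2,3) by (simp add: window_eq_iff)
qed

lemma cell_prob_window_origin:
  assumes "W \<subseteq> lists L" "x \<in> space \<mu>"
  shows "cell_prob \<mu> (window origin W) x = prob (cyl W (\<lambda>w. x (ev w)))"
proof -
  have "{y \<in> space \<mu>. window origin W y = window origin W x} = cyl W (\<lambda>w. x (ev w))"
    using window_origin_eq_iff[OF assms(1) _ assms(2)] unfolding cyl_def by blast
  then show ?thesis by (simp add: cell_prob_def)
qed

lemma finite_entropy_origin: "finite_entropy \<mu> origin"
proof (rule finite_entropyI_summable[OF observable_coordinate[OF one_closed]])
  have sub: "origin ` space \<mu> \<subseteq> K" using coordinate_in_K[OF _ one_closed] by blast
  have "(\<lambda>i. p i * ln (p i)) summable_on origin ` space \<mu>"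
    using summable_p sub by (rule summable_on_subset_banach)
  then show "(\<lambda>v. prob {x \<in> space \<mu>. x \<one> = v} * ln (prob {x \<in> space \<mu>. x \<one> = v})) summable_on origin ` space \<mu>"
    using sub prob_coordinate_one by (subst summable_on_cong[where g="\<lambda>i. p i * ln (p i)"]) auto
qed

text \<open>The conditional entropy of the coordinate at \<open>u\<close> given the coordinate at the identity.\<close>

definition step_entropy :: "letter \<Rightarrow> real" where
  "step_entropy u = (\<integral>x. - ln (P (lv u) (x \<one>) (x (lv u))) \<partial>\<mu>)"

lemma step_entropy_shifted:
  assumes "u # v \<in> RW"
  shows "(\<integral>x. - ln (P (lv u) (x (ev v)) (x (ev (u # v)))) \<partial>\<mu>) = step_entropy u"
proof -
  have u: "u \<in> L" and v: "v \<in> lists L" using assms by (auto simp: RW_def)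
  have T: "foldr U v \<in> \<mu> \<rightarrow>\<^sub>M \<mu>" "distr \<mu> \<mu> (foldr U v) = \<mu>"
    using preserving_word[OF v] by (auto simp: preserves_measure_def)
  let ?g = "\<lambda>x. - ln (P (lv u) (x \<one>) (x (lv u)))"
  have "observable \<mu> (\<lambda>x. (x \<one>, x (lv u)))"
    using u by (intro observable_Pair observable_coordinate letter_closed one_closed)
  from observable_measurable[OF this, of "\<lambda>(i, j). - ln (P (lv u) i j)"]
  have gm: "?g \<in> borel_measurable \<mu>" by simp
  have "step_entropy u = (\<integral>x. ?g x \<partial>distr \<mu> \<mu> (foldr U v))" by (simp add: step_entropy_def T(2))
  also have "\<dots> = (\<integral>x. ?g (foldr U v x) \<partial>\<mu>)" by (rule integral_distr[OF T(1) gm])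
  also have "\<dots> = (\<integral>x. - ln (P (lv u) (x (ev v)) (x (ev (u # v)))) \<partial>\<mu>)"
    using u v by (intro Bochner_Integration.integral_cong refl) (simp add: foldr_U letter_closed ev_Cons)
  finally show ?thesis by simp
qed

text \<open>By \<open>prob_cyl_insert\<close> the information functions of the two windows differ by the logarithm of one
  transition probability, and invariance makes its mean independent of \<open>v\<close>.\<close>

lemma entropy_insert:
  assumes uv: "u # v \<in> RW" and V: "finite V" "V \<subseteq> RW" "v \<in> V" "avoids_suffix (u # v) V"
  shows "obs_entropy \<mu> (window origin (insert (u # v) V)) = obs_entropy \<mu> (window origin V) + step_entropy u"
proof -
  let ?V' = "insert (u # v) V"
  have VL: "V \<subseteq> lists L" "?V' \<subseteq> lists L" using V(2) uv RW_lists by blast+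
  have f: "finite_entropy \<mu> (window origin V)" "finite_entropy \<mu> (window origin ?V')"
    using V(1) VL by (auto intro!: finite_entropy_window finite_entropy_origin)
  let ?I = "\<lambda>W x. - ln (cell_prob \<mu> (window origin W) x)"
  have i: "integrable \<mu> (?I V)" "integrable \<mu> (?I ?V')" using f by (auto simp: finite_entropy_def)
  have uL: "u \<in> L" "v \<in> lists L" using uv by (auto simp: RW_def)
  have meas: "(\<lambda>x. - ln (P (lv u) (x (ev v)) (x (ev (u # v))))) \<in> borel_measurable \<mu>"
  proof -
    have "observable \<mu> (\<lambda>x. (x (ev v), x (ev (u # v))))"
      using uL by (intro observable_Pair observable_coordinate ev_closed) auto
    from observable_measurable[OF this, of "\<lambda>(i, j). - ln (P (lv u) i j)"] show ?thesis by simp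
  qed
  have "obs_entropy \<mu> (window origin ?V') - obs_entropy \<mu> (window origin V) = (\<integral>x. ?I ?V' x - ?I V x \<partial>\<mu>)"
    unfolding obs_entropy_def by (rule Bochner_Integration.integral_diff[OF i(2,1), symmetric])
  also have "\<dots> = (\<integral>x. - ln (P (lv u) (x (ev v)) (x (ev (u # v)))) \<partial>\<mu>)"
  proof (rule integral_cong_AE)
    show "AE x in \<mu>. ?I ?V' x - ?I V x = - ln (P (lv u) (x (ev v)) (x (ev (u # v))))"
      using AE_cell_prob_pos[OF finite_entropy_observable[OF f(1)]]
        AE_cell_prob_pos[OF finite_entropy_observable[OF f(2)]] AE_space
    proof eventually_elim
      case (elim x)
      have "x (ev (u # v)) \<in> K" using elim(3) uv by (intro coordinate_in_K ev_closed RW_lists)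
      then have "cell_prob \<mu> (window origin ?V') x = P (lv u) (x (ev v)) (x (ev (u # v))) * cell_prob \<mu> (window origin V) x"
        unfolding cell_prob_window_origin[OF VL(1) elim(3)] cell_prob_window_origin[OF VL(2) elim(3)]
        by (rule prob_cyl_insert[OF uv V])
      moreover from this have "P (lv u) (x (ev v)) (x (ev (u # v))) > 0"
        using elim(1,2) by (simp add: zero_less_mult_iff)
      ultimately show ?case using elim(1) by (simp add: ln_mult)
    qed
  qed (use i meas in auto)
  also have "\<dots> = step_entropy u" by (rule step_entropy_shifted[OF uv])
  finally show ?thesis by simp
qed

text \<open>The set of words whose window is the join of the window over \<open>W\<close> with its translate by the \<open>i\<close>-th
  generator.\<close>

definition doubled :: "nat \<Rightarrow> letter list set \<Rightarrow> letter list set" where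
  "doubled i W = W \<union> append_letter (i, True) ` W"

lemma entropy_doubled:
  assumes "W \<subseteq> RW" "i \<in> {1..r}"
  shows "obs_entropy \<mu> (\<lambda>x. (window origin W x, window origin W (U (i, True) x))) = obs_entropy \<mu> (window origin (doubled i W))"
proof -
  let ?t = "(i, True)"
  have t: "?t \<in> L" using assms(2) by (rule pos_letters)
  have WL: "W \<subseteq> lists L" using assms(1) RW_lists by blast
  have DL: "doubled i W \<subseteq> lists L"
    using assms(1) WL append_letter_RW(1)[OF t] RW_lists unfolding doubled_def by blast
  have "U ?t x (ev w) = x (ev (append_letter ?t w))" if "w \<in> W" for x w
  proof -
    have "w \<in> RW" using that assms(1) by blast
    then show ?thesis using append_letter_RW(2)[OF t, of w] ev_closed[OF RW_lists, of w] by (simp add: U_def shift_action_def)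
  qed
  then have "(window origin W x, window origin W (U ?t x)) = (window origin W y, window origin W (U ?t y))
      \<longleftrightarrow> window origin (doubled i W) x = window origin (doubled i W) y"
    if "x \<in> space \<mu>" "y \<in> space \<mu>" for x y
    using that window_origin_eq_iff[OF WL that] window_origin_eq_iff[OF DL that]
      window_origin_eq_iff[OF WL U_space[OF t that(1)] U_space[OF t that(2)]]
    by (simp add: doubled_def ball_Un)
  then show ?thesis by (intro obs_entropy_cong) (simp_all add: finer_def)
qed

text \<open>Inserting \<open>z = u # v = w @ [t]\<close> into \<open>V\<close> inserts \<open>z\<close> and \<open>z i\<close> into the doubled set. If \<open>t\<close> is the
  generator \<open>i\<close>, then \<open>z = w i\<close> was present before; if \<open>t\<close> is its inverse, then \<open>z i = w\<close> was present
  before; otherwise both are new. Every new word begins with \<open>u\<close> and its tail, \<open>v\<close> or \<open>v i\<close>, was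
  present, so it adds \<open>step_entropy u\<close>.\<close>

lemma entropy_doubled_insert:
  assumes uv: "u # v \<in> RW" and V: "finite V" "V \<subseteq> RW" "v \<in> V" "u # v \<notin> V"
    and longest: "\<And>w. w \<in> V \<Longrightarrow> length w \<le> length (u # v)"
    and wt: "u # v = w @ [t]" "w \<in> V" and i: "i \<in> {1..r}"
  shows "obs_entropy \<mu> (window origin (doubled i (insert (u # v) V)))
    = obs_entropy \<mu> (window origin (doubled i V)) + (if fst t = i then 1 else 2) * step_entropy u"
proof -
  let ?a = "(i, True)" and ?z = "u # v"
  let ?\<rho> = "append_letter ?a"
  have a: "?a \<in> L" using i by (rule pos_letters)
  have \<rho>R: "?\<rho> y \<in> RW" if "y \<in> RW" for y using append_letter_RW(1)[OF a that] .
  have inj: "y = y'" if "?\<rho> y = ?\<rho> y'" "y \<in> RW" "y' \<in> RW" for y y'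
    using that inj_on_append_letter[of ?a] RW_reduced unfolding inj_on_def by blast
  let ?A = "doubled i V"
  have A: "finite ?A" "?A \<subseteq> RW" "v \<in> ?A" "?\<rho> v \<in> ?A" using V \<rho>R by (auto simp: doubled_def)
  have lenA: "length y \<le> Suc (length ?z)" if "y \<in> ?A" for y
  proof -
    have "length (?\<rho> y') \<le> Suc (length ?z)" if "y' \<in> V" for y'
      using length_append_letter[of ?a y'] longest[OF that] by simp
    moreover have "length y' \<le> Suc (length ?z)" if "y' \<in> V" for y' using longest[OF that] by simp
    ultimately show ?thesis using that unfolding doubled_def by blast
  qed
  have wR: "w \<in> RW" "reduced_word (w @ [t])" using wt V(2) RW_reduced[OF uv] by auto
  have D: "doubled i (insert ?z V) = insert ?z (insert (?\<rho> ?z) ?A)" by (auto simp: doubled_def)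
  have out: "?\<rho> ?z \<notin> ?A" if "?\<rho> ?z = ?z @ [?a]"
  proof
    assume "?\<rho> ?z \<in> ?A"
    then consider "?\<rho> ?z \<in> V" | y where "y \<in> V" "?\<rho> ?z = ?\<rho> y" by (auto simp: doubled_def)
    then show False
    proof cases
      case 1
      have "length (?\<rho> ?z) \<le> length ?z" by (rule longest[OF 1])
      then show False unfolding that by simp
    next
      case 2
      have "?z = y" by (rule inj[OF 2(2) uv subsetD[OF V(2) 2(1)]])
      with 2 V(4) show False by simp
    qed
  qed
  \<comment> \<open>a product \<open>y i\<close> at least as long as \<open>z\<close> ends with \<open>i\<close>, unlike \<open>z\<close>; a shorter one cannot have the suffix \<open>z\<close>\<close>
  have z_new: "avoids_suffix ?z ?A" if "t \<noteq> ?a"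
    unfolding avoids_suffix_def
  proof (intro allI notI)
    fix q assume "q @ ?z \<in> ?A"
    then consider "q @ ?z \<in> V" | y where "y \<in> V" "q @ ?z = ?\<rho> y" by (auto simp: doubled_def)
    then show False
    proof cases
      case 1
      then have "q = []" using longest[OF 1] by simp
      with 1 V(4) show False by simp
    next
      case 2
      have "last (?\<rho> y) = t" using 2(2)[symmetric] wt(1) by simp
      then have "?\<rho> y = butlast y" "y \<noteq> []" using that by (auto simp: append_letter_def split: if_splits)
      then have "length (?\<rho> y) < length y" by simp
      moreover have "length ?z \<le> length (?\<rho> y)" unfolding 2(2)[symmetric] by simp
      ultimately show False using longest[OF 2(1)] by linarith
    qed
  qed
  show ?thesis
  proof (cases "t = inv_letter ?a")
    case True
    have "?\<rho> ?z = w" unfolding wt(1) using True by (simp add: append_letter_snoc)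
    then have "doubled i (insert ?z V) = insert ?z ?A" unfolding D using wt(2) by (auto simp: doubled_def)
    moreover have "fst t = i" "t \<noteq> ?a" using True by (auto simp: inv_letter_def)
    ultimately show ?thesis using entropy_insert[OF uv A(1-3) z_new] by simp
  next
    case False
    have \<rho>z: "?\<rho> ?z = ?z @ [?a]" unfolding wt(1) using False by (simp add: append_letter_snoc)
    have "?z \<noteq> [inv_letter ?a]" using False wt(1) by auto
    then have \<rho>uv: "?\<rho> ?z = u # ?\<rho> v" using RW_reduced[OF uv] by (rule append_letter_Cons)
    have uR: "u # ?\<rho> v \<in> RW" using \<rho>R[OF uv] \<rho>uv by simp
    show ?thesis
    proof (cases "t = ?a")
      case True
      have "?z = ?\<rho> w" unfolding wt(1) using True wR(2) by (auto simp: append_letter_def reduced_snoc)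
      then have "doubled i (insert ?z V) = insert (u # ?\<rho> v) ?A"
        unfolding D \<rho>uv using wt(2) by (auto simp: doubled_def)
      moreover have "avoids_suffix (u # ?\<rho> v) ?A"
        unfolding \<rho>uv[symmetric] using out[OF \<rho>z] lenA \<rho>z by (intro avoids_suffix_if_longest) auto
      ultimately show ?thesis using entropy_insert[OF uR A(1,2,4)] True by simp
    next
      case other: False
      have "fst t \<noteq> i" using False other by (auto simp: inv_letter_def prod_eq_iff)
      have B: "finite (insert ?z ?A)" "insert ?z ?A \<subseteq> RW" "?\<rho> v \<in> insert ?z ?A" using A uv by auto
      have "avoids_suffix (u # ?\<rho> v) (insert ?z ?A)"
        unfolding \<rho>uv[symmetric] using out[OF \<rho>z] lenA \<rho>z by (intro avoids_suffix_if_longest) auto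
      from entropy_insert[OF uR B this] entropy_insert[OF uv A(1-3) z_new[OF other]]
      have "obs_entropy \<mu> (window origin (insert (u # ?\<rho> v) (insert ?z ?A))) = obs_entropy \<mu> (window origin ?A) + 2 * step_entropy u"
        by simp
      then show ?thesis unfolding D \<rho>uv insert_commute[of ?z] using \<open>fst t \<noteq> i\<close> by simp
    qed
  qed
qed

text \<open>Removing a longest word leaves a window of the same kind, and the changes cancel because exactly
  one of the \<open>r\<close> generators underlies the last letter of that word.\<close>

lemma F_obs_window_origin:
  assumes "finite W" "W \<subseteq> RW" "prefix_closed W" "suffix_closed W" "[] \<in> W"
  shows "F_obs (window origin W) = F_obs origin"
  using assms
proof (induction "card (W - {[]})" arbitrary: W)
  case 0
  then have "W - {[]} = {}" by (metis card_0_eq finite_Diff)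
  with 0 have W: "W = {[]}" by blast
  show ?case unfolding W by (rule F_obs_cong) (auto simp: finer_def window_eq_iff)
next
  case (Suc n)
  have "card (W - {[]}) \<noteq> 0" using Suc.hyps(2) by simp
  then have fin: "finite (W - {[]})" "W - {[]} \<noteq> {}" unfolding card_eq_0_iff by blast+
  obtain z where z: "z \<in> W - {[]}" and zmax: "\<And>w. w \<in> W - {[]} \<Longrightarrow> length w \<le> length z"
    using longest_word[OF fin] by blast
  then obtain u v where uv: "z = u # v" by (cases z) auto
  obtain w t where wt: "z = w @ [t]" using z by (cases z rule: rev_cases) auto
  define V where "V = W - {z}"
  have WV: "W = insert (u # v) V" using z uv by (auto simp: V_def)
  have zR: "u # v \<in> RW" using z Suc.prems(2) uv by auto
  have "v \<in> W" using Suc.prems(4) z unfolding suffix_closed_def uv by blast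
  then have vV: "v \<in> V" by (simp add: V_def uv)
  have "w \<in> W" using Suc.prems(3) z unfolding prefix_closed_def wt by blast
  then have wV: "w \<in> V" by (simp add: V_def wt)
  have V: "finite V" "V \<subseteq> RW" "[] \<in> V" "u # v \<notin> V" using Suc.prems z uv by (auto simp: V_def)
  have longest: "length y \<le> length (u # v)" if "y \<in> V" for y
  proof (cases "y = []")
    case False
    then show ?thesis using zmax[of y] that uv by (auto simp: V_def)
  qed simp
  have pc: "prefix_closed V"
    unfolding prefix_closed_def
  proof (intro allI impI)
    fix y b assume y: "y @ [b] \<in> V"
    then have "y \<in> W" using Suc.prems(3) unfolding prefix_closed_def V_def by blast
    moreover have "y \<noteq> z" using longest[OF y] uv by auto
    ultimately show "y \<in> V" by (simp add: V_def)
  qed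
  have sc: "suffix_closed V"
    unfolding suffix_closed_def
  proof (intro allI impI)
    fix y b assume y: "b # y \<in> V"
    then have "y \<in> W" using Suc.prems(4) unfolding suffix_closed_def V_def by blast
    moreover have "y \<noteq> z" using longest[OF y] uv by auto
    ultimately show "y \<in> V" by (simp add: V_def)
  qed
  have card: "n = card (V - {[]})"
  proof -
    have "V - {[]} = (W - {[]}) - {z}" by (auto simp: V_def)
    then show ?thesis using Suc.hyps(2) z fin by simp
  qed
  have IH: "F_obs (window origin V) = F_obs origin"
    by (rule Suc.hyps(1)[OF card V(1,2) pc sc V(3)])
  let ?h = "step_entropy u"
  have H: "obs_entropy \<mu> (window origin W) = obs_entropy \<mu> (window origin V) + ?h"
    unfolding WV using longest V(4) by (intro entropy_insert zR V vV avoids_suffix_if_longest)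
  have E: "obs_entropy \<mu> (\<lambda>x. (window origin W x, window origin W (U (i, True) x)))
      = obs_entropy \<mu> (\<lambda>x. (window origin V x, window origin V (U (i, True) x))) + (if fst t = i then 1 else 2) * ?h"
    if "i \<in> {1..r}" for i
    unfolding entropy_doubled[OF Suc.prems(2) that] entropy_doubled[OF V(2) that]
    unfolding WV using wt uv
    by (intro entropy_doubled_insert[OF zR V(1,2) vV V(4) longest _ wV that]) simp_all
  have "t \<in> L" using z Suc.prems(2) wt RW_lists[of z] by auto
  then have ft: "fst t \<in> {1..r}" using L_subset by auto
  have "(\<Sum>i=1..r. (if fst t = i then 1 else 2) * ?h) = (\<Sum>i=1..r. 2 * ?h - (if i = fst t then ?h else 0))"
    by (rule sum.cong) auto
  also have "\<dots> = (2 * real r - 1) * ?h"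
    using ft by (simp add: sum_subtractf sum.delta algebra_simps)
  finally have "(\<Sum>i=1..r. (if fst t = i then 1 else 2) * ?h) = (2 * real r - 1) * ?h" .
  moreover have "(\<Sum>i=1..r. obs_entropy \<mu> (\<lambda>x. (window origin W x, window origin W (U (i, True) x))))
     = (\<Sum>i=1..r. obs_entropy \<mu> (\<lambda>x. (window origin V x, window origin V (U (i, True) x))) + (if fst t = i then 1 else 2) * ?h)"
    by (rule sum.cong) (use E in auto)
  ultimately have "F_obs (window origin W) = F_obs (window origin V)"
    unfolding F_obs_def H by (simp add: sum.distrib algebra_simps)
  with IH show ?case by simp
qed

lemma f_obs_origin: "f_obs origin = ereal (F_obs origin)"
proof -
  have "F_obs (ball_window origin n) = F_obs origin" for n
    by (intro F_obs_window_origin finite_ball word_ball_over_RW prefix_closed_word_ball_over Nil_in_word_ball_over)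
       (auto simp: suffix_closed_def word_ball_over_def reduced_Cons)
  then show ?thesis unfolding f_obs_def by simp
qed

lemma F_obs_origin:
  "F_obs origin = (2 * real r - 1) * (\<Sum>\<^sub>\<infinity>i\<in>K. p i * ln (p i))
     - (\<Sum>t\<in>s ` {1..r}. \<Sum>\<^sub>\<infinity>(i, j)\<in>K \<times> K. p i * P t i j * ln (p i * P t i j))"
proof -
  have "origin ` space \<mu> \<subseteq> K" using coordinate_in_K[OF _ one_closed] by blast
  from obs_entropy_has_sum[OF finite_entropy_origin this]
  have "((\<lambda>i. - (p i * ln (p i))) has_sum obs_entropy \<mu> origin) K"
    by (rule has_sum_cong[THEN iffD1, rotated]) (simp add: prob_coordinate_one)
  then have "obs_entropy \<mu> origin = (\<Sum>\<^sub>\<infinity>i\<in>K. - (p i * ln (p i)))" by (rule infsumI[symmetric])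
  then have H: "obs_entropy \<mu> origin = - (\<Sum>\<^sub>\<infinity>i\<in>K. p i * ln (p i))" by (simp only: infsum_uminus)
  have E: "obs_entropy \<mu> (\<lambda>x. (x \<one>, U (k, True) x \<one>)) = - (\<Sum>\<^sub>\<infinity>(i, j)\<in>K \<times> K. p i * P (s k) i j * ln (p i * P (s k) i j))"
    if k: "k \<in> {1..r}" for k
  proof -
    have kL: "(k, True) \<in> L" using k by (rule pos_letters)
    have sk: "s k \<in> carrier G" using letter_closed[OF kL] by simp
    have U1: "U (k, True) x \<one> = x (s k)" for x using sk by (simp add: U_def shift_action_def)
    have f: "finite_entropy \<mu> (\<lambda>x. (x \<one>, U (k, True) x \<one>))"
      using finite_entropy_Pair[OF finite_entropy_origin finite_entropy_U[OF kL finite_entropy_origin]] .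
    have "(\<lambda>x. (x \<one>, U (k, True) x \<one>)) ` space \<mu> \<subseteq> K \<times> K"
      unfolding U1 using coordinate_in_K[OF _ one_closed] coordinate_in_K[OF _ sk] by blast
    from obs_entropy_has_sum[OF f this]
    have "((\<lambda>ij. - (case ij of (i, j) \<Rightarrow> p i * P (s k) i j * ln (p i * P (s k) i j))) has_sum obs_entropy \<mu> (\<lambda>x. (x \<one>, U (k, True) x \<one>))) (K \<times> K)"
    proof (rule has_sum_cong[THEN iffD1, rotated])
      fix ij assume "ij \<in> K \<times> K"
      then obtain i j where ij: "ij = (i, j)" "i \<in> K" "j \<in> K" by blast
      have "{x \<in> space \<mu>. (x \<one>, U (k, True) x \<one>) = ij} = {x \<in> space \<mu>. x \<one> = i \<and> x (lv (k, True)) = j}"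
        unfolding U1 ij by auto
      then show "- (prob {x \<in> space \<mu>. (x \<one>, U (k, True) x \<one>) = ij} * ln (prob {x \<in> space \<mu>. (x \<one>, U (k, True) x \<one>) = ij}))
          = - (case ij of (i, j) \<Rightarrow> p i * P (s k) i j * ln (p i * P (s k) i j))"
        using prob_transition[OF kL ij(2,3)] ij(1) by simp
    qed
    from infsumI[OF this, symmetric] show ?thesis by (simp only: infsum_uminus)
  qed
  have "inj_on s {1..r}"
  proof (rule inj_onI)
    fix i j assume ij: "i \<in> {1..r}" "j \<in> {1..r}" "s i = s j"
    then have L: "(i, True) \<in> L" "(j, True) \<in> L" using pos_letters by blast+
    then have "[(i, True)] = [(j, True)]" using ij(3) by (intro ev_inj) (auto simp: RW_def)
    then show "i = j" by simp
  qed
  then have "(\<Sum>t\<in>s ` {1..r}. \<Sum>\<^sub>\<infinity>(i, j)\<in>K \<times> K. p i * P t i j * ln (p i * P t i j))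
    = (\<Sum>k=1..r. \<Sum>\<^sub>\<infinity>(i, j)\<in>K \<times> K. p i * P (s k) i j * ln (p i * P (s k) i j))"
    by (simp add: sum.reindex)
  moreover have "(\<Sum>k=1..r. obs_entropy \<mu> (\<lambda>x. (x \<one>, U (k, True) x \<one>)))
     = (\<Sum>k=1..r. - (\<Sum>\<^sub>\<infinity>(i, j)\<in>K \<times> K. p i * P (s k) i j * ln (p i * P (s k) i j)))"
    by (rule sum.cong) (use E in auto)
  ultimately show ?thesis unfolding F_obs_def H by (simp add: sum_negf algebra_simps)
qed

end

section \<open>The f-invariant\<close>

context finite_entropy_process
begin

lemma shift_ev:
  assumes "w \<in> lists L" "x \<in> space \<mu>" shows "shift_action G (ev w) x = foldr U w x"
proof
  fix g
  show "shift_action G (ev w) x g = foldr U w x g"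
  proof (cases "g \<in> carrier G")
    case True
    then show ?thesis using foldr_U[OF assms] by (simp add: shift_action_def)
  next
    case False
    then show ?thesis using word_space[OF assms] by (auto simp: shift_action_def space_mu PiE_iff extensional_def)
  qed
qed

text \<open>A word of the ball of radius \<open>n\<close> followed by \<open>w\<close> acts like a reduced word of length at most
  \<open>n + length w\<close>, so translates of visible events are visible in larger balls.\<close>

lemma word_approximable_vimage:
  assumes g: "g \<in> carrier G" and E: "E \<in> word_approximable \<xi>"
  shows "shift_action G g -` E \<inter> space \<mu> \<in> word_approximable \<xi>"
proof -
  obtain w where w: "w \<in> RW" "g = ev w" using ev_surj[OF g] by blast
  then have wL: "w \<in> lists L" by (simp add: RW_lists)
  let ?T = "foldr U w"
  have T: "?T \<in> \<mu> \<rightarrow>\<^sub>M \<mu>" "distr \<mu> \<mu> ?T = \<mu>" using preserving_word[OF wL] by (auto simp: preserves_measure_def)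
  have vi: "shift_action G g -` C \<inter> space \<mu> = ?T -` C \<inter> space \<mu>" for C
    using shift_ev[OF wL] w(2) by auto
  show ?thesis unfolding vi
  proof (rule word_approximableI)
    show "?T -` E \<inter> space \<mu> \<in> sets \<mu>" using T(1) word_approximable_sets[OF E] by (rule measurable_sets)
    fix \<epsilon> :: real assume "0 < \<epsilon>"
    with E obtain n A where A: "A \<in> sets \<mu>" "finer \<mu> (ball_window \<xi> n) (\<lambda>\<omega>. \<omega> \<in> A)" "prob ((A - E) \<union> (E - A)) < \<epsilon>"
      by (rule word_approximableE)
    let ?A = "?T -` A \<inter> space \<mu>"
    have "?A \<in> sets \<mu>" using T(1) A(1) by (rule measurable_sets)
    moreover have "finer \<mu> (ball_window \<xi> (n + length w)) (\<lambda>\<omega>. \<omega> \<in> ?A)"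
    proof (rule finerI)
      fix x y assume x: "x \<in> space \<mu>" and y: "y \<in> space \<mu>"
        and eq: "ball_window \<xi> (n + length w) x = ball_window \<xi> (n + length w) y"
      have "ball_window \<xi> n (?T x) = ball_window \<xi> n (?T y)"
        unfolding window_eq_iff
      proof
        fix v assume v: "v \<in> word_ball_over L n"
        then have vw: "v @ w \<in> lists L" "length v \<le> n" using wL by (auto simp: word_ball_over_def)
        obtain z where z: "z \<in> RW" "ev z = ev (v @ w)" "length z \<le> length (v @ w)" using reduce_word[OF vw(1)] by blast
        then have zb: "z \<in> word_ball_over L (n + length w)" using vw(2) by (auto simp: word_ball_over_def RW_def)
        have "foldr U v (?T x') = foldr U z x'" if "x' \<in> space \<mu>" for x'
          using shift_ev[OF vw(1) that] shift_ev[OF RW_lists[OF z(1)] that] z(2) by simp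
        then show "\<xi> (foldr U v (?T x)) = \<xi> (foldr U v (?T y))"
          using eq zb x y by (simp add: window_eq_iff)
      qed
      then have "(?T x \<in> A) = (?T y \<in> A)"
        using finerD[OF A(2) word_space[OF wL x] word_space[OF wL y]] by simp
      then show "(x \<in> ?A) = (y \<in> ?A)" using x y by simp
    qed
    moreover have "prob ((?A - (?T -` E \<inter> space \<mu>)) \<union> ((?T -` E \<inter> space \<mu>) - ?A)) < \<epsilon>"
    proof -
      have "(?A - (?T -` E \<inter> space \<mu>)) \<union> ((?T -` E \<inter> space \<mu>) - ?A) = ?T -` ((A - E) \<union> (E - A)) \<inter> space \<mu>" by blast
      moreover have "prob (?T -` ((A - E) \<union> (E - A)) \<inter> space \<mu>) = measure (distr \<mu> \<mu> ?T) ((A - E) \<union> (E - A))"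
        using A(1) word_approximable_sets[OF E] by (intro measure_distr[symmetric] T(1)) auto
      ultimately show ?thesis using A(3) T(2) by simp
    qed
    ultimately show "\<exists>n. \<exists>A\<in>sets \<mu>. finer \<mu> (ball_window \<xi> n) (\<lambda>\<omega>. \<omega> \<in> A) \<and>
      prob ((A - (?T -` E \<inter> space \<mu>)) \<union> ((?T -` E \<inter> space \<mu>) - A)) < \<epsilon>" by blast
  qed
qed

text \<open>The approximable events form one of the invariant sigma-algebras in the definition of a generating
  partition.\<close>

lemma approximates_if_generating:
  assumes "observable \<mu> \<xi>" "generating G \<mu> (shift_action G) (fibres \<mu> \<xi>)"
  shows "approximates \<xi>"
proof (rule approximates_if_dense)
  fix E assume E: "E \<in> sets \<mu>"
  let ?\<F> = "{\<A>. sigma_algebra (space \<mu>) \<A> \<and> fibres \<mu> \<xi> \<subseteq> \<A> \<and>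
      (\<forall>g\<in>carrier G. \<forall>C\<in>\<A>. shift_action G g -` C \<inter> space \<mu> \<in> \<A>)}"
  have "word_approximable \<xi> \<in> ?\<F>"
    using sigma_algebra_word_approximable[of \<xi>] fibres_word_approximable[OF assms(1)] word_approximable_vimage by blast
  moreover obtain B where "B \<in> \<Inter>?\<F>" "emeasure \<mu> ((E - B) \<union> (B - E)) = 0"
    using assms(2) E unfolding generating_def by blast
  ultimately show "\<exists>B\<in>word_approximable \<xi>. emeasure \<mu> ((E - B) \<union> (B - E)) = 0" by blast
qed

text \<open>The ball cylinders, which generate the measurable sets, are finite intersections of translates of
  the canonical cells.\<close>

lemma generating_origin: "generating G \<mu> (shift_action G) (fibres \<mu> origin)"
  unfolding generating_def
proof (intro ballI bexI InterI)
  fix E assume E: "E \<in> sets \<mu>"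
  show "emeasure \<mu> ((E - E) \<union> (E - E)) = 0" by simp
  fix \<A> assume "\<A> \<in> {\<A>. sigma_algebra (space \<mu>) \<A> \<and> fibres \<mu> origin \<subseteq> \<A> \<and>
      (\<forall>g\<in>carrier G. \<forall>C\<in>\<A>. shift_action G g -` C \<inter> space \<mu> \<in> \<A>)}"
  then have sa: "sigma_algebra (space \<mu>) \<A>" and fib: "fibres \<mu> origin \<subseteq> \<A>"
    and inv: "\<And>g C. g \<in> carrier G \<Longrightarrow> C \<in> \<A> \<Longrightarrow> shift_action G g -` C \<inter> space \<mu> \<in> \<A>" by blast+
  interpret sa: sigma_algebra "space \<mu>" \<A> by (rule sa)
  have coord: "{x \<in> space \<mu>. x g = k} \<in> \<A>" if g: "g \<in> carrier G" for g k
  proof -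
    have "{x \<in> space \<mu>. x \<one> = k} \<in> \<A>"
    proof (cases "\<exists>x\<in>space \<mu>. x \<one> = k")
      case True
      then show ?thesis using fib unfolding fibres_alt by blast
    next
      case False
      then have "{x \<in> space \<mu>. x \<one> = k} = {}" by blast
      then show ?thesis by (simp only: sa.empty_sets)
    qed
    from inv[OF g this] have "shift_action G g -` {x \<in> space \<mu>. x \<one> = k} \<inter> space \<mu> \<in> \<A>" .
    also have "shift_action G g -` {x \<in> space \<mu>. x \<one> = k} \<inter> space \<mu> = {x \<in> space \<mu>. x g = k}"
      using g shift_in_space[OF g] by (auto simp: shift_action_def)
    finally show ?thesis .
  qed
  have "cyl (word_ball_over L n) c \<in> \<A>" for n c
    unfolding cyl_def
  proof (rule sa.sets_Collect_finite_All[OF _ finite_ball])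
    fix w assume "w \<in> word_ball_over L n"
    then show "{x \<in> space \<mu>. x (ev w) = c w} \<in> \<A>"
      by (rule coord[OF ev_closed[OF subsetD[OF word_ball_over_subset]]])
  qed
  then have "ball_cylinders \<subseteq> \<A>" by (auto simp: ball_cylinders_def)
  then have "sigma_sets (space \<mu>) ball_cylinders \<subseteq> \<A>" by (rule sa.sigma_sets_subset)
  then show "E \<in> \<A>" using E unfolding sets_eq_ball_cylinders by blast
qed

lemma ball_refinement_fibres:
  "ball_refinement G (gen_set G s r) \<mu> (shift_action G) (fibres \<mu> \<xi>) n = fibres \<mu> (ball_window \<xi> n)"
proof -
  let ?B = "word_ball_over L n"
  have "(\<lambda>g. pullback \<mu> (shift_action G g) (fibres \<mu> \<xi>)) ` word_ball G (gen_set G s r) n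
      = (\<lambda>w. fibres \<mu> (\<lambda>x. \<xi> (foldr U w x))) ` ?B"
    unfolding word_ball_eq image_image
  proof (rule image_cong[OF refl])
    fix w assume "w \<in> ?B"
    then have wL: "w \<in> lists L" using word_ball_over_subset by blast
    have "pullback \<mu> (shift_action G (ev w)) (fibres \<mu> \<xi>) = fibres \<mu> (\<lambda>x. \<xi> (shift_action G (ev w) x))"
      by (rule pullback_fibres) (rule shift_in_space[OF ev_closed[OF wL]])
    also have "\<dots> = fibres \<mu> (\<lambda>x. \<xi> (foldr U w x))"
      by (rule fibres_cong) (auto simp: finer_def shift_ev[OF wL])
    finally show "pullback \<mu> (shift_action G (ev w)) (fibres \<mu> \<xi>) = fibres \<mu> (\<lambda>x. \<xi> (foldr U w x))" .
  qed
  then have "ball_refinement G (gen_set G s r) \<mu> (shift_action G) (fibres \<mu> \<xi>) n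
      = common_refinement ((\<lambda>w. fibres \<mu> (\<lambda>x. \<xi> (foldr U w x))) ` ?B)"
    by (simp add: ball_refinement_def)
  also have "\<dots> = (\<lambda>\<omega>. {\<omega>'\<in>space \<mu>. \<forall>w\<in>?B. \<xi> (foldr U w \<omega>') = \<xi> (foldr U w \<omega>)}) ` space \<mu>"
    using Nil_in_word_ball_over by (intro common_refinement_fibres) blast
  also have "\<dots> = fibres \<mu> (window \<xi> ?B)" unfolding fibres_def window_eq_iff ..
  finally show ?thesis .
qed

lemma F_functional_fibres:
  assumes "finite_entropy \<mu> \<xi>"
  shows "F_functional s r \<mu> (shift_action G) (fibres \<mu> \<xi>) = ereal (F_obs \<xi>)"
proof -
  have "partition_entropy \<mu> (common_refinement {fibres \<mu> \<xi>, pullback \<mu> (shift_action G (s i)) (fibres \<mu> \<xi>)})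
    = ereal (obs_entropy \<mu> (\<lambda>x. (\<xi> x, \<xi> (U (i, True) x))))" if i: "i \<in> {1..r}" for i
  proof -
    have iL: "(i, True) \<in> L" using i by (rule pos_letters)
    have "pullback \<mu> (shift_action G (s i)) (fibres \<mu> \<xi>) = fibres \<mu> (\<lambda>x. \<xi> (U (i, True) x))"
      using pullback_fibres[of \<mu> "U (i, True)" \<xi>] U_space[OF iL] by (simp add: U_def)
    then show ?thesis
      using partition_entropy_fibres[OF finite_entropy_Pair[OF assms finite_entropy_U[OF iL assms]]]
      by (simp add: common_refinement_two_fibres)
  qed
  then have "(\<Sum>i=1..r. partition_entropy \<mu> (common_refinement {fibres \<mu> \<xi>, pullback \<mu> (shift_action G (s i)) (fibres \<mu> \<xi>)}))
    = (\<Sum>i=1..r. ereal (obs_entropy \<mu> (\<lambda>x. (\<xi> x, \<xi> (U (i, True) x)))))"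
    by (rule sum.cong[OF refl])
  then show ?thesis unfolding F_functional_def partition_entropy_fibres[OF assms] F_obs_def by simp
qed

lemma f_partition_fibres:
  assumes "finite_entropy \<mu> \<xi>"
  shows "f_partition G s r \<mu> (shift_action G) (fibres \<mu> \<xi>) = f_obs \<xi>"
  unfolding f_partition_def f_obs_def ball_refinement_fibres
  using F_functional_fibres[OF finite_entropy_ball[OF assms]] by simp

lemma f_invariant_eq: "f_invariant G s r \<mu> (shift_action G) = ereal (F_obs origin)"
proof -
  let ?T = "shift_action G"
  let ?ok = "\<lambda>\<alpha>. measurable_partition \<mu> \<alpha> \<and> generating G \<mu> ?T \<alpha> \<and> partition_entropy \<mu> \<alpha> < \<infinity>"
  have o: "?ok (fibres \<mu> origin)"
    using measurable_partition_fibres[OF observable_coordinate[OF one_closed]] generating_origin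
      partition_entropy_fibres[OF finite_entropy_origin] by simp
  have ap: "approximates origin"
    by (rule approximates_if_generating[OF observable_coordinate[OF one_closed] generating_origin])
  have v: "f_partition G s r \<mu> ?T \<alpha> = ereal (F_obs origin)" if \<alpha>: "?ok \<alpha>" for \<alpha>
  proof -
    let ?\<xi> = "cell_of \<alpha>"
    have fib: "fibres \<mu> ?\<xi> = \<alpha>" "observable \<mu> ?\<xi>" using fibres_cell_of \<alpha> by blast+
    have fin: "finite_entropy \<mu> ?\<xi>" using \<alpha> fib by (intro finite_entropy_if_partition_entropy_finite) auto
    have ap\<alpha>: "approximates ?\<xi>" using \<alpha> fib by (intro approximates_if_generating) auto
    have "f_obs ?\<xi> = f_obs origin"
      by (rule antisym) (intro f_obs_le fin ap\<alpha> finite_entropy_origin ap)+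
    then show ?thesis using f_partition_fibres[OF fin] fib(1) f_obs_origin by simp
  qed
  show ?thesis unfolding f_invariant_def
  proof (rule the_equality)
    show "(\<exists>\<alpha>. ?ok \<alpha>) \<and> (\<forall>\<alpha>. ?ok \<alpha> \<longrightarrow> f_partition G s r \<mu> ?T \<alpha> = ereal (F_obs origin))"
      using o v by blast
    fix u assume u: "(\<exists>\<alpha>. ?ok \<alpha>) \<and> (\<forall>\<alpha>. ?ok \<alpha> \<longrightarrow> f_partition G s r \<mu> ?T \<alpha> = u)"
    then have "f_partition G s r \<mu> ?T (fibres \<mu> origin) = u" using o by blast
    then show "u = ereal (F_obs origin)" using v[OF o] by simp
  qed
qed

end

theorem corollary7p6:
  fixes G :: "('g, 'm) monoid_scheme"
    and s :: "nat \<Rightarrow> 'g"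
    and r :: nat
    and K :: "'k set"
    and P :: "'g \<Rightarrow> 'k \<Rightarrow> 'k \<Rightarrow> real"
    and p :: "'k \<Rightarrow> real"
    and \<mu> :: "('g \<Rightarrow> 'k) measure"
  assumes "r \<ge> 1"
    and "free_group_on G s r \<or> free_semigroup_on G s r"
    and "countable K"
    and "transition_system (gen_set G s r) K P p"
    and "invariant_system G (gen_set G s r) K P p"
    and "(\<lambda>i. p i * ln (p i)) summable_on K"
    and "induced_measure G (gen_set G s r) K P p \<mu>"
  shows "f_invariant G s r \<mu> (shift_action G) =
    ereal ((2 * real r - 1) * (\<Sum>\<^sub>\<infinity>i\<in>K. p i * ln (p i))
           - (\<Sum>t\<in>s ` {1..r}. \<Sum>\<^sub>\<infinity>(i, j)\<in>K \<times> K. p i * P t i j * ln (p i * P t i j)))"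
proof -
  have ps: "prob_space \<mu>" using assms(7) by (simp add: induced_measure_def)
  obtain L where L: "free_words G s r L" "\<And>a. a \<in> L \<Longrightarrow> inv_letter a \<in> L \<Longrightarrow> group G"
  proof (cases "free_group_on G s r")
    case True
    then show ?thesis using free_words_group[OF assms(1) True] by (intro that) (auto simp: free_group_on_def)
  next
    case False
    then have sg: "free_semigroup_on G s r" using assms(2) by blast
    show ?thesis by (rule that[OF free_words_semigroup[OF assms(1) sg]]) (auto simp: inv_letter_def)
  qed
  interpret finite_entropy_process G s r L \<mu> K P p
    using L ps assms(3,5,6,7)
    by (intro finite_entropy_process.intro markov_process.intro markov_process_axioms.intro finite_entropy_process_axioms.intro)
  show ?thesis unfolding f_invariant_eq F_obs_origin ..
qed

end
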